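(* For every positive integer $D$ and every $\varepsilon>0$ there exists a constant $M$ such that the following holds. Let $G$ be a connected $D$-degenerate graph on vertex set $[n]$, let $R\sim G(n,\varepsilon/n)$ and $G^*=G\cup R$. Then asymptotically almost surely $T_{\mathrm{mix}}(G^* )\le M\log^2 n$.
   Context: $G(n,p)$ denotes the binomial random graph on $[n]$ with each pair an edge independently with probability $p$; $G\cup R$ is the graph on $[n]$ with edge set the union of those of $G$ and $R$. A graph is $D$-degenerate if every subgraph has a vertex of degree at most $D$. The lazy random walk on a connected graph $H=(V,E)$ is the Markov chain on $V$ which at a vertex $u$ stays put with probability $1/2$ and otherwise moves to a uniformly random neighbor of $u$; its stationary distribution is $\pi(u)=\deg(u)/(2|E|)$. With $P$ its transition matrix and $d_{TV}(p_1,p_2)=\max_{A\subseteq V}|p_1(A)-p_2(A)|$, the mixing time is $T_{\mathrm{mix}}(H)=\sup_{x_0}\min\{t : d_{TV}(x_0P^t,\pi)\le 1/4\}$, the supremum over all probability distributions $x_0$ on $V$. Asymptotically almost surely means with probability tending to $1$ as $n\to\infty$, for an arbitrary sequence of such graphs $G=G_n$. *)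

theory Defs
  imports "HOL-Analysis.Analysis"
begin

text \<open>Graphs on vertex set [n] = {0..<n}, given by their edge sets: sets of 2-element subsets.\<close>

definition all_pairs :: "nat \<Rightarrow> nat set set" where
  "all_pairs n = {e. e \<subseteq> {..<n} \<and> card e = 2}"

definition is_graph :: "nat \<Rightarrow> nat set set \<Rightarrow> bool" where
  "is_graph n E \<longleftrightarrow> E \<subseteq> all_pairs n"

definition adj :: "nat set set \<Rightarrow> (nat \<times> nat) set" where
  "adj E = {(u, v). {u, v} \<in> E}"

definition connected_graph :: "nat \<Rightarrow> nat set set \<Rightarrow> bool" where
  "connected_graph n E \<longleftrightarrow> (\<forall>u<n. \<forall>v<n. (u, v) \<in> (adj E)\<^sup>*)"

definition degree :: "nat set set \<Rightarrow> nat \<Rightarrow> nat" where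
  "degree E v = card {e \<in> E. v \<in> e}"

text \<open>D-degenerate: every (nonempty) subgraph (S, F) has a vertex of degree at most D.\<close>
definition degenerate :: "nat \<Rightarrow> nat \<Rightarrow> nat set set \<Rightarrow> bool" where
  "degenerate D n E \<longleftrightarrow>
     (\<forall>S F. S \<subseteq> {..<n} \<and> S \<noteq> {} \<and> F \<subseteq> E \<and> (\<forall>e\<in>F. e \<subseteq> S)
        \<longrightarrow> (\<exists>v\<in>S. degree F v \<le> D))"

text \<open>Probability that R ~ G(n,p) satisfies Q.\<close>
definition gnp_prob :: "nat \<Rightarrow> real \<Rightarrow> (nat set set \<Rightarrow> bool) \<Rightarrow> real" where
  "gnp_prob n p Q =
     (\<Sum>R\<in>Pow (all_pairs n).
        if Q R then p ^ card R * (1 - p) ^ (card (all_pairs n) - card R) else 0)"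

text \<open>Lazy random walk.\<close>
definition trans :: "nat set set \<Rightarrow> nat \<Rightarrow> nat \<Rightarrow> real" where
  "trans E u v = (if u = v then 1/2 else 0)
                 + (if {u, v} \<in> E then 1 / (2 * real (degree E u)) else 0)"

definition walk_step :: "nat \<Rightarrow> nat set set \<Rightarrow> (nat \<Rightarrow> real) \<Rightarrow> (nat \<Rightarrow> real)" where
  "walk_step n E x = (\<lambda>v. \<Sum>u<n. x u * trans E u v)"

definition stationary :: "nat set set \<Rightarrow> nat \<Rightarrow> real" where
  "stationary E u = real (degree E u) / (2 * real (card E))"

definition is_distribution :: "nat \<Rightarrow> (nat \<Rightarrow> real) \<Rightarrow> bool" where
  "is_distribution n x \<longleftrightarrow> (\<forall>v<n. 0 \<le> x v) \<and> (\<Sum>v<n. x v) = 1"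

definition dTV :: "nat \<Rightarrow> (nat \<Rightarrow> real) \<Rightarrow> (nat \<Rightarrow> real) \<Rightarrow> real" where
  "dTV n p1 p2 = Max ((\<lambda>A. \<bar>(\<Sum>v\<in>A. p1 v) - (\<Sum>v\<in>A. p2 v)\<bar>) ` Pow {..<n})"

text \<open>Mixing time (infinite if some start never gets within 1/4).\<close>
definition mixing_time :: "nat \<Rightarrow> nat set set \<Rightarrow> enat" where
  "mixing_time n E =
     (SUP x \<in> {x. is_distribution n x}.
        INF t \<in> {t. dTV n ((walk_step n E ^^ t) x) (stationary E) \<le> 1/4}. enat t)"

end

theory Submission
  imports Defs
begin

text \<open>Start the chain at \<open>s\<close> and stop it greedily so that the stopped mass never exceeds \<open>5/4\<close> times the
  stationary distribution \<open>\<pi>\<close>. Let \<open>x\<close> be the expected numbers of exits before stopping. Since any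
  two stopped distributions overlap substantially, Cesaro averages over a window of length \<open>O(\<Sum>x)\<close>
  contract oscillations, and a square-function maximal inequality for reversible lazy chains upgrades
  this to total variation mixing at a fixed time of order \<open>\<Sum>x\<close>.

  The function \<open>f = x/\<pi>\<close> satisfies a maximum principle, so each level set \<open>{f > c}\<close> is connected, has
  \<open>\<pi>\<close>-measure at most \<open>4/5\<close>, and passes at most one unit of flow. Integrating along the levels bounds
  \<open>\<Sum>x\<close> by a sum over scales of squared inverse conductances of connected sets only: connected sets of
  size at least \<open>K ln n\<close> expand linearly and contribute \<open>O(ln n)\<close>, smaller ones have at least one boundary
  edge and contribute \<open>O((ln n)\<^sup>2)\<close>.

  Linear expansion is a first moment bound. The sets \<open>S\<close> that are connected in \<open>G \<union> R\<close> with few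
  boundary edges cannot be counted directly, as degrees in \<open>G\<close> may be unbounded; instead the probability
  that \<open>S\<close> is bad is compared with the probability that \<open>S\<close> is exactly the cluster of a given vertex in a
  percolation that keeps each edge of \<open>G\<close> with probability \<open>1 - \<eta>\<close> and each other pair with probability
  \<open>p/2\<close>. For a fixed vertex these events are disjoint. The comparison costs \<open>(8/\<eta>)^b\<close>, where \<open>b\<close> bounds
  the boundary, because at most \<open>b\<close> random edges are needed to connect the \<open>G\<close>-components of \<open>S\<close>.\<close>

section \<open>Reversible lazy chains\<close>

text \<open>The time at which the filling rule stops depends on the path, so a bound on its mean
  alone says nothing about one fixed time. The cap on the stopped law is the remedy: an L1(\<pi>)
  bound on the maximum of |P^k \<phi>| over a whole time window can be evaluated at the stopped
  position, however position and stopping time are correlated. The constant 5/4 serves twice: two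
  probability laws below 5/4 \<pi> share mass at least 3/4, and the flow lives on a set of measure
  at most 4/5, so that there is always an outside to expand into.

  In the percolation comparison, halving p is a gain as well as a cost. Inside \<open>S\<close> it
  costs only 2^b, because few random edges are essential. Across the cut every pair saves a factor 1
  - p/4, which adds up to a gain exponential in |S| as long as the outside of \<open>S\<close> has
  linear size. All costs are exponential in |S| too, but with rates that become arbitrarily small
  with \<eta> and with the expansion constant c.\<close>

lemma even_odd_split:
  fixes k :: nat obtains j where "k = j + j" | j where "k = Suc j + j"
  by (metis add_Suc mult_2 oddE evenE Suc_eq_plus1)

locale lazy_chain =
  fixes V :: "'a set" and P :: "'a \<Rightarrow> 'a \<Rightarrow> real" and \<mu> :: "'a \<Rightarrow> real"
  assumes finV: "finite V"
    and P_nonneg: "\<And>u v. u \<in> V \<Longrightarrow> v \<in> V \<Longrightarrow> 0 \<le> P u v"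
    and P_sum: "\<And>u. u \<in> V \<Longrightarrow> (\<Sum>v\<in>V. P u v) = 1"
    and lazy: "\<And>u. u \<in> V \<Longrightarrow> 1/2 \<le> P u u"
    and mu_pos: "\<And>u. u \<in> V \<Longrightarrow> 0 < \<mu> u"
    and mu_sum: "(\<Sum>u\<in>V. \<mu> u) = 1"
    and rev: "\<And>u v. u \<in> V \<Longrightarrow> v \<in> V \<Longrightarrow> \<mu> u * P u v = \<mu> v * P v u"
begin

definition op :: "('a \<Rightarrow> real) \<Rightarrow> 'a \<Rightarrow> real" where
  "op \<phi> u = (\<Sum>v\<in>V. P u v * \<phi> v)"

definition ip :: "('a \<Rightarrow> real) \<Rightarrow> ('a \<Rightarrow> real) \<Rightarrow> real" where
  "ip f g = (\<Sum>u\<in>V. \<mu> u * f u * g u)"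

text \<open>Spectrally this is the k-th moment of the spectral measure of \<open>\<phi>\<close>,
  carried by [0,1] because the chain is lazy. Hence it is nonnegative, decreasing and convex in
  \<open>k\<close>; these facts are derived below from quadratic forms, without
  diagonalising.\<close>

definition corr :: "('a \<Rightarrow> real) \<Rightarrow> nat \<Rightarrow> real" where
  "corr \<phi> k = ip ((op ^^ k) \<phi>) \<phi>"

lemma mu_P_sum: "v \<in> V \<Longrightarrow> (\<Sum>u\<in>V. \<mu> u * P u v) = \<mu> v"
proof -
  assume v: "v \<in> V"
  have "(\<Sum>u\<in>V. \<mu> u * P u v) = (\<Sum>u\<in>V. \<mu> v * P v u)"
    by (rule sum.cong) (use v rev in auto)
  then show ?thesis using P_sum[OF v] by (simp flip: sum_distrib_left)
qed

lemma op_diff: "op (\<lambda>u. f u - g u) = (\<lambda>u. op f u - op g u)"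
  by (auto simp: op_def algebra_simps sum_subtractf)

lemma funpow_op_diff: "(op ^^ k) (\<lambda>u. f u - g u) = (\<lambda>u. (op ^^ k) f u - (op ^^ k) g u)"
  by (induction k) (auto simp: op_diff)

lemma op_sum: "op (\<lambda>u. \<Sum>i\<in>I. c * g i u) = (\<lambda>u. \<Sum>i\<in>I. c * op (g i) u)"
  by (rule ext) (simp add: op_def sum_distrib_left sum.swap[of _ V I] algebra_simps)

lemma funpow_op_sum:
  "(op ^^ k) (\<lambda>u. \<Sum>i\<in>I. c * g i u) = (\<lambda>u. \<Sum>i\<in>I. c * (op ^^ k) (g i) u)"
  by (induction k) (auto simp: op_sum)

lemma ip_diff_left: "ip (\<lambda>u. f u - g u) h = ip f h - ip g h"
  by (simp add: ip_def algebra_simps sum_subtractf)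

lemma ip_diff_right: "ip h (\<lambda>u. f u - g u) = ip h f - ip h g"
  by (simp add: ip_def algebra_simps sum_subtractf)

lemma ip_sum_left: "ip (\<lambda>u. \<Sum>i\<in>I. c * g i u) h = (\<Sum>i\<in>I. c * ip (g i) h)"
  by (simp add: ip_def sum_distrib_left sum_distrib_right sum.swap[of _ V I] algebra_simps)

lemma ip_nonneg: "0 \<le> ip f f"
  unfolding ip_def by (rule sum_nonneg) (use mu_pos in \<open>auto simp: mult.assoc less_imp_le\<close>)

lemma ip_op: "ip (op f) g = ip f (op g)"
proof -
  have "ip (op f) g = (\<Sum>u\<in>V. \<Sum>v\<in>V. (\<mu> u * P u v) * (f v * g u))"
    by (simp add: ip_def op_def sum_distrib_left sum_distrib_right algebra_simps)
  also have "\<dots> = (\<Sum>u\<in>V. \<Sum>v\<in>V. (\<mu> v * P v u) * (f v * g u))"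
    by (intro sum.cong refl) (metis rev)
  also have "\<dots> = (\<Sum>v\<in>V. \<Sum>u\<in>V. (\<mu> v * P v u) * (f v * g u))"
    by (rule sum.swap)
  also have "\<dots> = ip f (op g)"
    by (simp add: ip_def op_def sum_distrib_left sum_distrib_right algebra_simps)
  finally show ?thesis .
qed

lemma ip_funpow: "ip ((op ^^ (i + j)) f) g = ip ((op ^^ i) f) ((op ^^ j) g)"
proof (induction j arbitrary: g)
  case (Suc j)
  have "ip ((op ^^ (i + Suc j)) f) g = ip ((op ^^ (i + j)) f) (op g)"
    by (simp add: ip_op)
  then show ?case by (simp add: Suc funpow_swap1)
qed simp

text \<open>The sign -1 gives the Dirichlet form and thus P \<le> 1; the sign +1, together with
  laziness, gives P \<ge> 0.\<close>

lemma sum_square_expand: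
  fixes \<sigma> :: real
  assumes "\<sigma>\<^sup>2 = 1"
  shows "(\<Sum>u\<in>V. \<Sum>v\<in>V. \<mu> u * P u v * (f u + \<sigma> * f v)\<^sup>2) = 2 * ip f f + 2 * \<sigma> * ip (op f) f"
proof -
  have "(\<Sum>u\<in>V. \<Sum>v\<in>V. \<mu> u * P u v * (f u + \<sigma> * f v)\<^sup>2)
      = (\<Sum>u\<in>V. \<Sum>v\<in>V. (\<mu> u * f u * f u) * P u v + (\<mu> u * P u v) * (f v * f v)
           + 2 * \<sigma> * (\<mu> u * (P u v * f v) * f u))"
    using assms by (intro sum.cong refl) (simp add: power2_eq_square algebra_simps)
  also have "\<dots> = (\<Sum>u\<in>V. \<Sum>v\<in>V. (\<mu> u * f u * f u) * P u v)
      + (\<Sum>u\<in>V. \<Sum>v\<in>V. (\<mu> u * P u v) * (f v * f v))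
      + 2 * \<sigma> * (\<Sum>u\<in>V. \<Sum>v\<in>V. \<mu> u * (P u v * f v) * f u)"
    by (simp add: sum.distrib sum_distrib_left)
  also have "(\<Sum>u\<in>V. \<Sum>v\<in>V. (\<mu> u * f u * f u) * P u v) = ip f f"
    using P_sum by (simp add: ip_def flip: sum_distrib_left)
  also have "(\<Sum>u\<in>V. \<Sum>v\<in>V. (\<mu> u * P u v) * (f v * f v)) = ip f f"
    by (subst sum.swap) (simp add: ip_def mu_P_sum mult.assoc[symmetric] flip: sum_distrib_right)
  also have "(\<Sum>u\<in>V. \<Sum>v\<in>V. \<mu> u * (P u v * f v) * f u) = ip (op f) f"
    by (simp add: ip_def op_def sum_distrib_left sum_distrib_right)
  finally show ?thesis by simp
qed

lemma ip_op_le: "ip (op f) f \<le> ip f f"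
proof -
  have "0 \<le> (\<Sum>u\<in>V. \<Sum>v\<in>V. \<mu> u * P u v * (f u + (-1) * f v)\<^sup>2)"
    by (intro sum_nonneg mult_nonneg_nonneg) (use mu_pos P_nonneg in \<open>auto simp: less_imp_le\<close>)
  then show ?thesis by (subst (asm) sum_square_expand) auto
qed

text \<open>Laziness enters here: the diagonal terms of the form with sign +1 alone already amount
  to \<open>2 * ip f f\<close>.\<close>

lemma ip_op_nonneg: "0 \<le> ip (op f) f"
proof -
  have "2 * ip f f = (\<Sum>u\<in>V. \<mu> u * (1/2) * (f u + 1 * f u)\<^sup>2)"
    by (simp add: ip_def sum_distrib_left power2_eq_square algebra_simps)
  also have "\<dots> \<le> (\<Sum>u\<in>V. \<mu> u * P u u * (f u + 1 * f u)\<^sup>2)"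
    by (intro sum_mono mult_right_mono mult_left_mono) (use lazy mu_pos in \<open>auto simp: less_imp_le\<close>)
  also have "\<dots> \<le> (\<Sum>u\<in>V. \<Sum>v\<in>V. \<mu> u * P u v * (f u + 1 * f v)\<^sup>2)"
  proof (rule sum_mono)
    fix u assume u: "u \<in> V"
    show "\<mu> u * P u u * (f u + 1 * f u)\<^sup>2 \<le> (\<Sum>v\<in>V. \<mu> u * P u v * (f u + 1 * f v)\<^sup>2)"
      by (rule member_le_sum[OF u])
        (use mu_pos P_nonneg u finV in \<open>auto simp: less_imp_le intro!: mult_nonneg_nonneg\<close>)
  qed
  also have "\<dots> = 2 * ip f f + 2 * 1 * ip (op f) f"
    by (rule sum_square_expand) simp
  finally show ?thesis by simp
qed

text \<open>P - P^2 = (1 - P) P (1 - P) + P (1 - P) P, a sum of two nonnegative forms.\<close>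

lemma ip_op_op_le: "ip (op f) (op f) \<le> ip (op f) f"
proof -
  have "ip (op f) f - ip (op f) (op f)
      = ip (op (\<lambda>u. f u - op f u)) (\<lambda>u. f u - op f u) + (ip (op f) (op f) - ip (op (op f)) (op f))"
    by (simp add: op_diff ip_diff_left ip_diff_right ip_op)
  then show ?thesis using ip_op_nonneg[of "\<lambda>u. f u - op f u"] ip_op_le[of "op f"] by linarith
qed

lemma corr_nonneg: "0 \<le> corr \<phi> k"
proof (cases k rule: even_odd_split)
  case (1 j)
  then show ?thesis by (simp add: corr_def ip_funpow ip_nonneg)
next
  case (2 j)
  have "corr \<phi> k = ip (op ((op ^^ j) \<phi>)) ((op ^^ j) \<phi>)"
    unfolding corr_def 2 ip_funpow by simp
  then show ?thesis by (simp add: ip_op_nonneg)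
qed

lemma corr_Suc_le: "corr \<phi> (Suc k) \<le> corr \<phi> k"
proof (cases k rule: even_odd_split)
  case (1 j)
  have "corr \<phi> (Suc k) = ip (op ((op ^^ j) \<phi>)) ((op ^^ j) \<phi>)"
    unfolding corr_def 1 add_Suc[symmetric] ip_funpow by simp
  moreover have "corr \<phi> k = ip ((op ^^ j) \<phi>) ((op ^^ j) \<phi>)"
    unfolding corr_def 1 ip_funpow by simp
  ultimately show ?thesis by (simp add: ip_op_le)
next
  case (2 j)
  have "corr \<phi> (Suc k) = ip (op ((op ^^ j) \<phi>)) (op ((op ^^ j) \<phi>))"
    unfolding corr_def 2 add_Suc_right[symmetric] ip_funpow by simp
  moreover have "corr \<phi> k = ip (op ((op ^^ j) \<phi>)) ((op ^^ j) \<phi>)"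
    unfolding corr_def 2 ip_funpow by simp
  ultimately show ?thesis by (simp add: ip_op_op_le)
qed

lemma corr_antimono: "i \<le> j \<Longrightarrow> corr \<phi> j \<le> corr \<phi> i"
  by (rule lift_Suc_antimono_le[of "corr \<phi>"]) (auto simp: corr_Suc_le)

text \<open>Convexity: the second difference is itself a correlation, that of (1 - P)\<phi>, and so
  is nonnegative.\<close>

lemma corr_second_diff:
  "corr (\<lambda>u. \<phi> u - op \<phi> u) k = corr \<phi> k - 2 * corr \<phi> (Suc k) + corr \<phi> (Suc (Suc k))"
proof -
  have "ip ((op ^^ k) (op \<phi>)) (op \<phi>) = ip ((op ^^ (k + 2)) \<phi>) \<phi>"
    by (metis add_2_eq_Suc' comp_apply funpow_Suc_right funpow.simps(2) ip_op)
  moreover have "ip ((op ^^ k) \<phi>) (op \<phi>) = corr \<phi> (Suc k)"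
    by (simp add: corr_def ip_op)
  moreover have "ip ((op ^^ k) (op \<phi>)) \<phi> = corr \<phi> (Suc k)"
    by (simp add: corr_def funpow_swap1)
  ultimately show ?thesis
    by (simp add: corr_def funpow_op_diff ip_diff_left ip_diff_right)
qed

lemma corr_decrement_antimono:
  assumes "i \<le> j"
  shows "corr \<phi> j - corr \<phi> (Suc j) \<le> corr \<phi> i - corr \<phi> (Suc i)"
  using assms
proof (rule lift_Suc_antimono_le[rotated])
  fix k
  show "corr \<phi> (Suc k) - corr \<phi> (Suc (Suc k)) \<le> corr \<phi> k - corr \<phi> (Suc k)"
    using corr_nonneg[of "\<lambda>u. \<phi> u - op \<phi> u" k] corr_second_diff[of \<phi> k] by linarith
qed

text \<open>Decrements decrease, so the one at time 2t is at most the average of the t preceding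
  ones, whose sum telescopes.\<close>

lemma corr_decrement_le: "real t * (corr \<phi> (2 * t) - corr \<phi> (Suc (2 * t))) \<le> corr \<phi> t"
proof -
  have "real t * (corr \<phi> (2 * t) - corr \<phi> (Suc (2 * t)))
      = (\<Sum>i\<in>{t..<2*t}. corr \<phi> (2 * t) - corr \<phi> (Suc (2 * t)))" by simp
  also have "\<dots> \<le> (\<Sum>i\<in>{t..<2*t}. corr \<phi> i - corr \<phi> (Suc i))"
    by (rule sum_mono, rule corr_decrement_antimono) auto
  also have "\<dots> = corr \<phi> t - corr \<phi> (2 * t)"
    using sum_Suc_diff'[of t "2*t" "corr \<phi>"] by (simp add: sum_subtractf)
  finally show ?thesis using corr_nonneg[of \<phi> "2*t"] by linarith
qed

text \<open>Only even times occur. The decrement at the odd time in between is replaced by the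
  smaller one at the next even time, after which the sum telescopes.\<close>

lemma sum_second_diff_le:
  "(\<Sum>r\<in>{t..<2*t}. corr (\<lambda>u. \<phi> u - op \<phi> u) (2 * r)) \<le> corr \<phi> (2 * t) - corr \<phi> (Suc (2 * t))"
proof -
  let ?d = "\<lambda>k. corr \<phi> k - corr \<phi> (Suc k)"
  have "(\<Sum>r\<in>{t..<2*t}. corr (\<lambda>u. \<phi> u - op \<phi> u) (2 * r)) \<le> (\<Sum>r\<in>{t..<2*t}. ?d (2 * r) - ?d (2 * Suc r))"
  proof (rule sum_mono)
    fix r
    have "?d (2 * Suc r) \<le> ?d (Suc (2 * r))" by (rule corr_decrement_antimono) simp
    then show "corr (\<lambda>u. \<phi> u - op \<phi> u) (2 * r) \<le> ?d (2 * r) - ?d (2 * Suc r)"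
      unfolding corr_second_diff by linarith
  qed
  also have "\<dots> = ?d (2 * t) - ?d (2 * (2 * t))"
    using sum_Suc_diff'[of t "2*t" "\<lambda>r. - ?d (2 * r)"] by (simp add: algebra_simps)
  also have "\<dots> \<le> ?d (2 * t)" using corr_Suc_le[of \<phi> "2 * (2 * t)"] by simp
  finally show ?thesis .
qed

end

text \<open>A discrete Sobolev inequality in time: a value of a^2 exceeds its mean over the window
  by at most the total variation of a^2.\<close>

lemma square_le_mean_plus_variation:
  fixes a :: "nat \<Rightarrow> real"
  assumes t: "0 < t" and k: "t \<le> k" "k \<le> 2 * t"
  shows "(a k)\<^sup>2 \<le> (2 / t) * (\<Sum>r\<in>{t..2*t}. (a r)\<^sup>2) + t * (\<Sum>r\<in>{t..<2*t}. (a r - a (Suc r))\<^sup>2)"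
proof -
  define A where "A = (\<Sum>r\<in>{t..2*t}. (a r)\<^sup>2)"
  define B where "B = (\<Sum>r\<in>{t..<2*t}. (a r - a (Suc r))\<^sup>2)"
  define W where "W = (\<Sum>r\<in>{t..<2*t}. \<bar>(a (Suc r))\<^sup>2 - (a r)\<^sup>2\<bar>)"
  have tel: "\<bar>(a j)\<^sup>2 - (a i)\<^sup>2\<bar> \<le> W" if "t \<le> i" "i \<le> j" "j \<le> 2 * t" for i j
  proof -
    have "\<bar>(a j)\<^sup>2 - (a i)\<^sup>2\<bar> = \<bar>\<Sum>r\<in>{i..<j}. (a (Suc r))\<^sup>2 - (a r)\<^sup>2\<bar>"
      using sum_Suc_diff'[of i j "\<lambda>r. (a r)\<^sup>2"] that by simp
    also have "\<dots> \<le> (\<Sum>r\<in>{i..<j}. \<bar>(a (Suc r))\<^sup>2 - (a r)\<^sup>2\<bar>)" by (rule sum_abs)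
    also have "\<dots> \<le> W" unfolding W_def by (rule sum_mono2) (use that in auto)
    finally show ?thesis .
  qed
  have tel': "(a k)\<^sup>2 \<le> (a r)\<^sup>2 + W" if "t \<le> r" "r \<le> 2 * t" for r
    using tel[of r k] tel[of k r] that k by (cases "r \<le> k") auto
  have "(real t + 1) * (a k)\<^sup>2 = (\<Sum>r\<in>{t..2*t}. (a k)\<^sup>2)" by simp
  also have "\<dots> \<le> (\<Sum>r\<in>{t..2*t}. (a r)\<^sup>2 + W)" by (rule sum_mono) (use tel' in auto)
  also have "\<dots> = A + (real t + 1) * W" by (simp add: A_def sum.distrib)
  finally have 1: "(a k)\<^sup>2 \<le> A / (real t + 1) + W" by (simp add: field_simps)
  have "A \<ge> 0" unfolding A_def by (rule sum_nonneg) simp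
  then have 2: "A / (real t + 1) \<le> A / t" using t by (simp add: frac_le)
  \<comment> \<open>The arithmetic-geometric inequality is weighted by t, so that the part without
    differences, summed over the window, is only a second copy of the mean.\<close>
  have pw: "\<bar>y\<^sup>2 - x\<^sup>2\<bar> \<le> t * (x - y)\<^sup>2 + (1 / (2 * t)) * (x\<^sup>2 + y\<^sup>2)" for x y :: real
  proof -
    have "\<bar>y\<^sup>2 - x\<^sup>2\<bar> = \<bar>x - y\<bar> * \<bar>x + y\<bar>" by (simp add: abs_mult[symmetric] power2_eq_square algebra_simps abs_minus_commute)
    also have "\<dots> \<le> t * \<bar>x - y\<bar>\<^sup>2 + (1 / (4 * t)) * \<bar>x + y\<bar>\<^sup>2"
    proof -
      have "0 \<le> (2 * t * \<bar>x - y\<bar> - \<bar>x + y\<bar>)\<^sup>2" by simp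
      then have "4 * t * (\<bar>x - y\<bar> * \<bar>x + y\<bar>) \<le> 4 * t * (t * \<bar>x - y\<bar>\<^sup>2) + \<bar>x + y\<bar>\<^sup>2"
        by (simp add: power2_eq_square algebra_simps)
      then show ?thesis using t by (simp add: field_simps)
    qed
    also have "\<dots> \<le> t * (x - y)\<^sup>2 + (1 / (4 * t)) * (2 * (x\<^sup>2 + y\<^sup>2))"
    proof -
      have "(x + y)\<^sup>2 \<le> 2 * (x\<^sup>2 + y\<^sup>2)" using sum_squares_bound[of x y] by (simp add: power2_sum)
      then show ?thesis by (simp add: divide_right_mono)
    qed
    also have "\<dots> = t * (x - y)\<^sup>2 + (1 / (2 * t)) * (x\<^sup>2 + y\<^sup>2)" using t by (simp add: field_simps)
    finally show ?thesis .
  qed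
  have "W \<le> (\<Sum>r\<in>{t..<2*t}. t * (a r - a (Suc r))\<^sup>2 + (1 / (2 * t)) * ((a r)\<^sup>2 + (a (Suc r))\<^sup>2))"
    unfolding W_def by (rule sum_mono) (rule pw)
  also have "\<dots> = t * B + (1 / (2 * t)) * ((\<Sum>r\<in>{t..<2*t}. (a r)\<^sup>2) + (\<Sum>r\<in>{t..<2*t}. (a (Suc r))\<^sup>2))"
    by (simp add: B_def sum.distrib sum_distrib_left flip: sum_divide_distrib)
  also have "(\<Sum>r\<in>{t..<2*t}. (a (Suc r))\<^sup>2) = (\<Sum>r\<in>{Suc t..<Suc (2*t)}. (a r)\<^sup>2)"
    by (rule sum.shift_bounds_Suc_ivl[symmetric])
  also have "\<dots> \<le> A" unfolding A_def by (rule sum_mono2) auto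
  also have "(\<Sum>r\<in>{t..<2*t}. (a r)\<^sup>2) \<le> A" unfolding A_def by (rule sum_mono2) auto
  finally have "W \<le> t * B + A / t" using t by (simp add: mult_left_mono divide_right_mono)
  then show ?thesis using 1 2 unfolding A_def[symmetric] B_def[symmetric] by simp
qed

context lazy_chain
begin

text \<open>The pointwise bound controls all times in \<open>[t, 2t]\<close> at once; convexity of \<^const>\<open>corr\<close> bounds the variation term.\<close>

lemma maximal_ineq:
  assumes t: "0 < t"
  obtains F where "\<And>k x. t \<le> k \<Longrightarrow> k \<le> 2 * t \<Longrightarrow> \<bar>(op ^^ k) \<phi> x\<bar> \<le> F x"
    and "(\<Sum>x\<in>V. \<mu> x * F x) \<le> sqrt (5 * corr \<phi> t)" and "\<And>x. 0 \<le> F x"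
proof -
  define a where "a = (\<lambda>x r. (op ^^ r) \<phi> x)"
  define F2 where "F2 = (\<lambda>x. (2 / t) * (\<Sum>r\<in>{t..2*t}. (a x r)\<^sup>2) + t * (\<Sum>r\<in>{t..<2*t}. (a x r - a x (Suc r))\<^sup>2))"
  have F2nn: "0 \<le> F2 x" for x unfolding F2_def by (intro add_nonneg_nonneg mult_nonneg_nonneg sum_nonneg) auto
  have sq: "(\<Sum>x\<in>V. \<mu> x * (a x r)\<^sup>2) = corr \<phi> (2 * r)" for r
    unfolding mult_2 corr_def ip_funpow by (simp add: ip_def a_def power2_eq_square mult.assoc)
  have sq2: "(\<Sum>x\<in>V. \<mu> x * (a x r - a x (Suc r))\<^sup>2) = corr (\<lambda>u. \<phi> u - op \<phi> u) (2 * r)" for r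
    unfolding mult_2 corr_def ip_funpow
    by (simp add: ip_def a_def power2_eq_square mult.assoc funpow_op_diff funpow_swap1)
  have "(\<Sum>x\<in>V. \<mu> x * F2 x) = (2 / t) * (\<Sum>r\<in>{t..2*t}. \<Sum>x\<in>V. \<mu> x * (a x r)\<^sup>2)
      + t * (\<Sum>r\<in>{t..<2*t}. \<Sum>x\<in>V. \<mu> x * (a x r - a x (Suc r))\<^sup>2)"
  proof -
    have "(\<Sum>x\<in>V. \<mu> x * F2 x) = (\<Sum>x\<in>V. (2 / t) * (\<Sum>r\<in>{t..2*t}. \<mu> x * (a x r)\<^sup>2)
      + t * (\<Sum>r\<in>{t..<2*t}. \<mu> x * (a x r - a x (Suc r))\<^sup>2))"
      unfolding F2_def by (rule sum.cong) (auto simp: distrib_left mult.left_commute simp flip: sum_distrib_left)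
    then show ?thesis
      by (simp add: sum.distrib sum_distrib_left sum_divide_distrib sum.swap[of _ V])
  qed
  also have "\<dots> = (2 / t) * (\<Sum>r\<in>{t..2*t}. corr \<phi> (2 * r)) + t * (\<Sum>r\<in>{t..<2*t}. corr (\<lambda>u. \<phi> u - op \<phi> u) (2 * r))"
    by (simp add: sq sq2)
  \<comment> \<open>In the first sum 2r \<ge> t, so each of the t + 1 terms is at most
    \<open>corr \<phi> t\<close>, in total 4 of them; the variation term costs a fifth.\<close>
  also have "\<dots> \<le> (2 / t) * ((t + 1) * corr \<phi> t) + t * (corr \<phi> (2 * t) - corr \<phi> (Suc (2 * t)))"
  proof (intro add_mono mult_left_mono sum_second_diff_le)
    have "(\<Sum>r\<in>{t..2*t}. corr \<phi> (2 * r)) \<le> (\<Sum>r\<in>{t..2*t}. corr \<phi> t)"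
      by (rule sum_mono, rule corr_antimono) auto
    then show "(\<Sum>r\<in>{t..2*t}. corr \<phi> (2 * r)) \<le> (t + 1) * corr \<phi> t" by simp
  qed auto
  also have "\<dots> \<le> 4 * corr \<phi> t + corr \<phi> t"
  proof (rule add_mono[OF _ corr_decrement_le])
    have "(2 / t) * (t + 1) \<le> (4::real)" using t by (simp add: field_simps)
    then show "(2 / t) * ((t + 1) * corr \<phi> t) \<le> 4 * corr \<phi> t"
      using corr_nonneg[of \<phi> t] by (metis mult.assoc mult_right_mono)
  qed
  finally have F2sum: "(\<Sum>x\<in>V. \<mu> x * F2 x) \<le> 5 * corr \<phi> t" by simp
  show ?thesis
  proof (rule that[of "\<lambda>x. sqrt (F2 x)"])
    fix k x assume "t \<le> k" "k \<le> 2 * t"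
    then have "((op ^^ k) \<phi> x)\<^sup>2 \<le> F2 x"
      using square_le_mean_plus_variation[OF t, of k "a x"] unfolding F2_def a_def by simp
    then show "\<bar>(op ^^ k) \<phi> x\<bar> \<le> sqrt (F2 x)" by (simp add: real_le_rsqrt)
  next
    have "(\<Sum>x\<in>V. \<mu> x * sqrt (F2 x))\<^sup>2 = (\<Sum>x\<in>V. sqrt (\<mu> x) * (sqrt (\<mu> x) * sqrt (F2 x)))\<^sup>2"
      using mu_pos by (simp add: less_imp_le flip: mult.assoc cong: sum.cong)
    also have "\<dots> \<le> (\<Sum>x\<in>V. (sqrt (\<mu> x))\<^sup>2) * (\<Sum>x\<in>V. (sqrt (\<mu> x) * sqrt (F2 x))\<^sup>2)"
      by (rule Cauchy_Schwarz_ineq_sum)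
    also have "\<dots> = (\<Sum>x\<in>V. \<mu> x * F2 x)"
      using mu_pos mu_sum F2nn by (simp add: less_imp_le power_mult_distrib cong: sum.cong)
    finally show "(\<Sum>x\<in>V. \<mu> x * sqrt (F2 x)) \<le> sqrt (5 * corr \<phi> t)"
      using F2sum by (simp add: real_le_rsqrt)
  qed (use F2nn in auto)
qed

end

section \<open>The filling rule\<close>

context lazy_chain
begin

definition push :: "('a \<Rightarrow> real) \<Rightarrow> 'a \<Rightarrow> real" where
  "push x v = (\<Sum>u\<in>V. x u * P u v)"

text \<open>Mass starting at \<open>s\<close> moves with the chain and is stopped at \<open>v\<close> as soon
  as possible, as long as at most \<open>\<kappa> * \<mu> v\<close> has been stopped there.  The two components are the
  moving mass and the mass stopped before time \<open>t\<close>.\<close>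

primrec fill :: "real \<Rightarrow> 'a \<Rightarrow> nat \<Rightarrow> ('a \<Rightarrow> real) \<times> ('a \<Rightarrow> real)" where
  "fill \<kappa> s 0 = ((\<lambda>v. if v = s then 1 else 0), (\<lambda>v. 0))"
| "fill \<kappa> s (Suc t) = (let a = fst (fill \<kappa> s t); S = snd (fill \<kappa> s t);
     q = (\<lambda>v. min (a v) (\<kappa> * \<mu> v - S v)) in (push (\<lambda>v. a v - q v), (\<lambda>v. S v + q v)))"

definition moving :: "real \<Rightarrow> 'a \<Rightarrow> nat \<Rightarrow> 'a \<Rightarrow> real" where
  "moving \<kappa> s t = fst (fill \<kappa> s t)"

definition stopped :: "real \<Rightarrow> 'a \<Rightarrow> nat \<Rightarrow> 'a \<Rightarrow> real" where
  "stopped \<kappa> s t = snd (fill \<kappa> s t)"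

definition stop_at :: "real \<Rightarrow> 'a \<Rightarrow> nat \<Rightarrow> 'a \<Rightarrow> real" where
  "stop_at \<kappa> s t v = min (moving \<kappa> s t v) (\<kappa> * \<mu> v - stopped \<kappa> s t v)"

definition remain :: "real \<Rightarrow> 'a \<Rightarrow> nat \<Rightarrow> 'a \<Rightarrow> real" where
  "remain \<kappa> s t v = moving \<kappa> s t v - stop_at \<kappa> s t v"

definition exits :: "real \<Rightarrow> 'a \<Rightarrow> nat \<Rightarrow> 'a \<Rightarrow> real" where
  "exits \<kappa> s t v = (\<Sum>i<t. remain \<kappa> s i v)"

lemma moving_0: "moving \<kappa> s 0 = (\<lambda>v. if v = s then 1 else 0)"
  and stopped_0: "stopped \<kappa> s 0 = (\<lambda>v. 0)"
  by (auto simp: moving_def stopped_def)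

lemma moving_Suc: "moving \<kappa> s (Suc t) = push (remain \<kappa> s t)"
  and stopped_Suc: "stopped \<kappa> s (Suc t) v = stopped \<kappa> s t v + stop_at \<kappa> s t v"
  by (simp_all add: moving_def stopped_def remain_def[abs_def] stop_at_def[abs_def] Let_def)

lemma exits_Suc: "exits \<kappa> s (Suc t) v = exits \<kappa> s t v + remain \<kappa> s t v"
  by (simp add: exits_def)

lemma push_nonneg: "(\<And>u. u \<in> V \<Longrightarrow> 0 \<le> x u) \<Longrightarrow> v \<in> V \<Longrightarrow> 0 \<le> push x v"
  unfolding push_def by (intro sum_nonneg mult_nonneg_nonneg) (auto simp: P_nonneg)

lemma push_add: "push (\<lambda>u. x u + y u) v = push x v + push y v"
  by (simp add: push_def algebra_simps sum.distrib)

lemma sum_push: "(\<Sum>v\<in>V. push x v * \<phi> v) = (\<Sum>v\<in>V. x v * op \<phi> v)"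
  unfolding push_def op_def sum_distrib_right sum_distrib_left
  by (subst sum.swap) (simp add: mult.assoc)

lemma op_one: "v \<in> V \<Longrightarrow> op (\<lambda>_. 1) v = 1"
  by (simp add: op_def P_sum)

lemma sum_push_mass: "(\<Sum>v\<in>V. push x v) = (\<Sum>v\<in>V. x v)"
  using sum_push[of x "\<lambda>_. 1"] by (simp add: op_one)

lemma remain_nonneg: "0 \<le> remain \<kappa> s t v"
  by (simp add: remain_def stop_at_def)

lemma fill_bounds:
  assumes "0 \<le> \<kappa>" "v \<in> V"
  shows "0 \<le> moving \<kappa> s t v \<and> 0 \<le> stopped \<kappa> s t v \<and> stopped \<kappa> s t v \<le> \<kappa> * \<mu> v"
proof (induction t)
  case 0
  then show ?case using assms mu_pos[of v] by (auto simp: moving_0 stopped_0)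
next
  case (Suc t)
  then show ?case using assms
    by (auto simp: moving_Suc stopped_Suc stop_at_def remain_nonneg intro!: push_nonneg)
qed

lemma stop_at_nonneg: "0 \<le> \<kappa> \<Longrightarrow> v \<in> V \<Longrightarrow> 0 \<le> stop_at \<kappa> s t v"
  using fill_bounds[of \<kappa> v s t] by (simp add: stop_at_def)

lemma stopped_mono:
  assumes "0 \<le> \<kappa>" "v \<in> V" "i \<le> j"
  shows "stopped \<kappa> s i v \<le> stopped \<kappa> s j v"
  using assms(3)
  by (rule lift_Suc_mono_le[rotated]) (use stop_at_nonneg assms in \<open>auto simp: stopped_Suc\<close>)

text \<open>Mass leaves v only when the minimum in \<open>stop_at\<close> is the free capacity; from
  then on the capacity at v is exhausted for good.\<close>

lemma exits_pos_full:
  assumes "0 \<le> \<kappa>" "v \<in> V" "0 < exits \<kappa> s t v"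
  shows "stopped \<kappa> s t v = \<kappa> * \<mu> v"
proof -
  obtain i where i: "i < t" "remain \<kappa> s i v \<noteq> 0"
    using assms(3) unfolding exits_def by (metis less_numeral_extra(3) lessThan_iff sum.neutral)
  then have "stopped \<kappa> s (Suc i) v = \<kappa> * \<mu> v"
    by (auto simp: remain_def stop_at_def stopped_Suc min_def split: if_splits)
  then show ?thesis
    using stopped_mono[of \<kappa> v "Suc i" t s] fill_bounds[of \<kappa> v s t] i assms by auto
qed

lemma fill_mass: "s \<in> V \<Longrightarrow> (\<Sum>v\<in>V. moving \<kappa> s t v) + (\<Sum>v\<in>V. stopped \<kappa> s t v) = 1"
proof (induction t)
  case 0
  then show ?case using finV by (simp add: moving_0 stopped_0)
next
  case (Suc t)
  then show ?case
    by (simp add: moving_Suc sum_push_mass stopped_Suc sum.distrib remain_def sum_subtractf)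
qed

lemma remain_mass_le:
  assumes "0 \<le> \<kappa>" "i \<le> j"
  shows "(\<Sum>v\<in>V. remain \<kappa> s j v) \<le> (\<Sum>v\<in>V. remain \<kappa> s i v)"
  using assms(2)
proof (rule lift_Suc_antimono_le[rotated])
  fix t
  have "(\<Sum>v\<in>V. remain \<kappa> s (Suc t) v) \<le> (\<Sum>v\<in>V. moving \<kappa> s (Suc t) v)"
    by (rule sum_mono) (use stop_at_nonneg assms in \<open>auto simp: remain_def\<close>)
  then show "(\<Sum>v\<in>V. remain \<kappa> s (Suc t) v) \<le> (\<Sum>v\<in>V. remain \<kappa> s t v)"
    by (simp add: moving_Suc sum_push_mass)
qed

text \<open>Markov's inequality for the stopping time: \<open>remain\<close> at time t has as total
  mass the probability of not having stopped by then, and the sum of \<open>exits\<close> is a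
  truncated expectation.\<close>

lemma remain_mass_le_exits:
  assumes "0 \<le> \<kappa>"
  shows "real (Suc t) * (\<Sum>v\<in>V. remain \<kappa> s t v) \<le> (\<Sum>v\<in>V. exits \<kappa> s (Suc t) v)"
proof -
  have "real (Suc t) * (\<Sum>v\<in>V. remain \<kappa> s t v) = (\<Sum>i<Suc t. (\<Sum>v\<in>V. remain \<kappa> s t v))"
    by simp
  also have "\<dots> \<le> (\<Sum>i<Suc t. (\<Sum>v\<in>V. remain \<kappa> s i v))"
    by (rule sum_mono, rule remain_mass_le) (use assms in auto)
  also have "\<dots> = (\<Sum>v\<in>V. exits \<kappa> s (Suc t) v)"
    unfolding exits_def by (rule sum.swap)
  finally show ?thesis .
qed

text \<open>Conservation of mass at v: what started or arrived there has stopped, is still waiting,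
  or has left. Thus \<open>exits\<close> is the Green function of the stopped chain.\<close>

lemma exits_balance:
  "stopped \<kappa> s (Suc t) v + remain \<kappa> s t v + exits \<kappa> s t v = (if v = s then 1 else 0) + push (exits \<kappa> s t) v"
proof (induction t)
  case 0
  then show ?case by (simp add: stopped_Suc stopped_0 remain_def moving_0 exits_def push_def)
next
  case (Suc t)
  have "push (exits \<kappa> s (Suc t)) v = push (exits \<kappa> s t) v + push (remain \<kappa> s t) v"
    unfolding push_add[symmetric] exits_Suc ..
  moreover have "remain \<kappa> s (Suc t) v + stop_at \<kappa> s (Suc t) v = push (remain \<kappa> s t) v"
    by (simp add: remain_def moving_Suc)
  ultimately show ?case
    using Suc unfolding exits_Suc stopped_Suc[of \<kappa> s "Suc t"] by linarith
qed

lemma exits_nonneg: "0 \<le> exits \<kappa> s t v"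
  by (simp add: exits_def sum_nonneg remain_nonneg)

text \<open>The balance identity at the preceding time, with the arrivals of the last step dropped.
  Full capacity turns the stopped mass into \<kappa>\<mu>, which makes the density of
  \<open>exits\<close> strictly subharmonic away from s.\<close>

lemma exits_drift:
  assumes "0 \<le> \<kappa>" "v \<in> V" "0 < exits \<kappa> s t v"
  shows "exits \<kappa> s t v - push (exits \<kappa> s t) v \<le> (if v = s then 1 else 0) - \<kappa> * \<mu> v"
proof (cases t)
  case 0
  then show ?thesis using assms by (simp add: exits_def)
next
  case (Suc i)
  have "push (exits \<kappa> s t) v = push (exits \<kappa> s i) v + push (remain \<kappa> s i) v"
    unfolding push_add[symmetric] exits_Suc Suc ..
  moreover have "0 \<le> push (remain \<kappa> s i) v"
    by (rule push_nonneg) (auto simp: remain_nonneg assms)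
  ultimately show ?thesis
    using exits_balance[of \<kappa> s i v] exits_pos_full[OF assms] by (auto simp: Suc exits_Suc)
qed

text \<open>Every point of the support holds its full capacity, and at most one unit of mass is
  stopped in all. For \<kappa> = 5/4 this is the measure bound 4/5.\<close>

lemma exits_support:
  assumes "0 \<le> \<kappa>" "s \<in> V"
  shows "\<kappa> * (\<Sum>v\<in>{v\<in>V. 0 < exits \<kappa> s t v}. \<mu> v) \<le> 1"
proof -
  have "\<kappa> * (\<Sum>v\<in>{v\<in>V. 0 < exits \<kappa> s t v}. \<mu> v) = (\<Sum>v\<in>{v\<in>V. 0 < exits \<kappa> s t v}. stopped \<kappa> s t v)"
    unfolding sum_distrib_left by (rule sum.cong) (use exits_pos_full assms in auto)
  also have "\<dots> \<le> (\<Sum>v\<in>V. stopped \<kappa> s t v)"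
    by (rule sum_mono2) (use fill_bounds assms finV in auto)
  also have "\<dots> \<le> 1"
  proof -
    have "0 \<le> (\<Sum>v\<in>V. moving \<kappa> s t v)" by (rule sum_nonneg) (use fill_bounds assms in auto)
    then show ?thesis using fill_mass[of s \<kappa> t] assms by linarith
  qed
  finally show ?thesis .
qed

text \<open>Optional stopping for \<open>\<psi>\<close>: its value at s is its mean at the stopped
  position plus the accumulated drift, which \<open>exits\<close> weights.\<close>

lemma exits_balance_dual:
  assumes "s \<in> V"
  shows "\<psi> s = (\<Sum>v\<in>V. stopped \<kappa> s (Suc t) v * \<psi> v) + (\<Sum>v\<in>V. remain \<kappa> s t v * \<psi> v)
     + (\<Sum>v\<in>V. exits \<kappa> s t v * (\<psi> v - op \<psi> v))"
proof -
  have "\<psi> s + (\<Sum>v\<in>V. push (exits \<kappa> s t) v * \<psi> v)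
      = (\<Sum>v\<in>V. ((if v = s then 1 else 0) + push (exits \<kappa> s t) v) * \<psi> v)"
    using assms finV by (simp add: distrib_right sum.distrib if_distrib[of "\<lambda>x. x * _"] cong: if_cong)
  also have "\<dots> = (\<Sum>v\<in>V. (stopped \<kappa> s (Suc t) v + remain \<kappa> s t v + exits \<kappa> s t v) * \<psi> v)"
    by (simp only: exits_balance)
  finally show ?thesis
    by (simp add: sum_push distrib_right right_diff_distrib sum.distrib sum_subtractf)
qed

text \<open>The strong Markov property at the stopping time truncated at t.\<close>

lemma fill_decomposition:
  assumes "s \<in> V" "t \<le> T"
  shows "(op ^^ T) \<phi> s = (\<Sum>r<t. \<Sum>v\<in>V. stop_at \<kappa> s r v * (op ^^ (T - r)) \<phi> v)
      + (\<Sum>v\<in>V. moving \<kappa> s t v * (op ^^ (T - t)) \<phi> v)"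
  using assms(2)
proof (induction t)
  case 0
  then show ?case using assms finV
    by (simp add: moving_0 if_distrib[of "\<lambda>x. x * _"] cong: if_cong)
next
  case (Suc t)
  have "(\<Sum>v\<in>V. moving \<kappa> s t v * (op ^^ (T - t)) \<phi> v)
     = (\<Sum>v\<in>V. stop_at \<kappa> s t v * (op ^^ (T - t)) \<phi> v) + (\<Sum>v\<in>V. remain \<kappa> s t v * (op ^^ (T - t)) \<phi> v)"
    unfolding sum.distrib[symmetric] by (simp add: remain_def flip: distrib_right)
  also have "T - t = Suc (T - Suc t)" using Suc by simp
  then have "(\<Sum>v\<in>V. remain \<kappa> s t v * (op ^^ (T - t)) \<phi> v) = (\<Sum>v\<in>V. moving \<kappa> s (Suc t) v * (op ^^ (T - Suc t)) \<phi> v)"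
    by (simp add: moving_Suc sum_push)
  finally show ?case using Suc by simp
qed

lemma stop_at_sum: "(\<Sum>r<t. stop_at \<kappa> s r v) = stopped \<kappa> s t v"
  by (induction t) (auto simp: stopped_0 stopped_Suc)

lemma op_bounds:
  assumes "\<And>v. v \<in> V \<Longrightarrow> l \<le> \<phi> v \<and> \<phi> v \<le> b" "u \<in> V"
  shows "l \<le> op \<phi> u \<and> op \<phi> u \<le> b"
proof
  have "(\<Sum>v\<in>V. P u v * l) \<le> op \<phi> u"
    unfolding op_def by (intro sum_mono mult_left_mono) (use assms P_nonneg in auto)
  then show "l \<le> op \<phi> u" using P_sum assms by (simp flip: sum_distrib_right)
  have "op \<phi> u \<le> (\<Sum>v\<in>V. P u v * b)"
    unfolding op_def by (intro sum_mono mult_left_mono) (use assms P_nonneg in auto)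
  then show "op \<phi> u \<le> b" using P_sum assms by (simp flip: sum_distrib_right)
qed

lemma funpow_op_bounds:
  assumes "\<And>v. v \<in> V \<Longrightarrow> l \<le> \<phi> v \<and> \<phi> v \<le> b" "u \<in> V"
  shows "l \<le> (op ^^ k) \<phi> u \<and> (op ^^ k) \<phi> u \<le> b"
  using assms(2)
proof (induction k arbitrary: u)
  case (Suc k)
  then show ?case using op_bounds[of l "(op ^^ k) \<phi>" b u] by simp
qed (use assms(1) in simp)

section \<open>Cesaro averages and mixing at a fixed time\<close>

definition avg :: "nat \<Rightarrow> ('a \<Rightarrow> real) \<Rightarrow> 'a \<Rightarrow> real" where
  "avg N \<phi> u = (\<Sum>i<N. (1 / real N) * (op ^^ i) \<phi> u)"

lemma avg_bounds:
  assumes "\<And>v. v \<in> V \<Longrightarrow> l \<le> \<phi> v \<and> \<phi> v \<le> b" "u \<in> V" "0 < N"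
  shows "l \<le> avg N \<phi> u \<and> avg N \<phi> u \<le> b"
proof
  have "(\<Sum>i<N. (1 / real N) * l) \<le> avg N \<phi> u"
    unfolding avg_def by (intro sum_mono mult_left_mono) (use assms funpow_op_bounds[of l \<phi> b] in auto)
  then show "l \<le> avg N \<phi> u" using assms by simp
  have "avg N \<phi> u \<le> (\<Sum>i<N. (1 / real N) * b)"
    unfolding avg_def by (intro sum_mono mult_left_mono) (use assms funpow_op_bounds[of l \<phi> b] in auto)
  then show "avg N \<phi> u \<le> b" using assms by simp
qed

lemma avg_diff_op: "avg N \<phi> u - op (avg N \<phi>) u = (\<phi> u - (op ^^ N) \<phi> u) / N"
proof -
  have "op (avg N \<phi>) u = (\<Sum>i<N. (1 / real N) * (op ^^ Suc i) \<phi> u)"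
    unfolding avg_def op_sum by simp
  then have "avg N \<phi> u - op (avg N \<phi>) u = (1 / real N) * (\<Sum>i<N. (op ^^ i) \<phi> u - (op ^^ Suc i) \<phi> u)"
    by (simp add: avg_def right_diff_distrib sum_subtractf sum_divide_distrib)
  also have "(\<Sum>i<N. (op ^^ i) \<phi> u - (op ^^ Suc i) \<phi> u) = \<phi> u - (op ^^ N) \<phi> u"
    using sum_lessThan_telescope'[of "\<lambda>i. (op ^^ i) \<phi> u" N] by simp
  finally show ?thesis by simp
qed

text \<open>Averaging makes the function nearly harmonic: its drift is at most w/N, so the drift
  collected before stopping costs h w/N for each start. Both stopped laws lie below \<kappa>\<mu>,
  which limits their disagreement to \<kappa> - 1 = 1/4 plus the missing mass h/N. Altogether there
  are four errors h/N, and N \<ge> 16h makes them at most another 1/4.\<close>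

lemma avg_osc:
  assumes h: "\<And>s t. s \<in> V \<Longrightarrow> (\<Sum>v\<in>V. exits (5/4) s t v) \<le> h"
    and N: "16 * h \<le> real N" "0 < N"
    and osc: "\<And>u v. u \<in> V \<Longrightarrow> v \<in> V \<Longrightarrow> \<phi> u - \<phi> v \<le> w"
    and s: "s \<in> V" "s' \<in> V"
  shows "avg N \<phi> s - avg N \<phi> s' \<le> w / 2"
proof -
  define \<kappa> where "\<kappa> = (5/4 :: real)"
  \<comment> \<open>The balance identity at t contains the mass stopped before time t + 1 =
    N.\<close>
  define t where "t = N - 1"
  have Nt: "N = Suc t" using N by (simp add: t_def)
  define l where "l = Min (\<phi> ` V)"
  have range: "l \<le> \<phi> v \<and> \<phi> v \<le> l + w" if "v \<in> V" for v
  proof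
    show "l \<le> \<phi> v" unfolding l_def using finV that by simp
    have "l \<in> \<phi> ` V" unfolding l_def using finV that by (intro Min_in) auto
    then obtain u where "u \<in> V" "l = \<phi> u" by auto
    then show "\<phi> v \<le> l + w" using osc[OF that] by force
  qed
  have w: "0 \<le> w" using osc[OF s(1) s(1)] by simp
  define \<psi> where "\<psi> = avg N \<phi>"
  have psi: "0 \<le> \<psi> v - l \<and> \<psi> v - l \<le> w" if "v \<in> V" for v
    unfolding \<psi>_def using avg_bounds[of l \<phi> "l + w" v N] range that N by auto
  have drift: "\<bar>\<psi> v - op \<psi> v\<bar> \<le> w / N" if "v \<in> V" for v
  proof -
    have "\<bar>\<phi> v - (op ^^ N) \<phi> v\<bar> \<le> w"
      using funpow_op_bounds[of l \<phi> "l + w" v N] range that by (smt (verit, best))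
    then show ?thesis unfolding \<psi>_def avg_diff_op by (simp add: divide_right_mono)
  qed
  have E: "\<bar>\<Sum>v\<in>V. exits \<kappa> s t v * (\<psi> v - op \<psi> v)\<bar> \<le> h * (w / N)" if "s \<in> V" for s
  proof -
    have "\<bar>\<Sum>v\<in>V. exits \<kappa> s t v * (\<psi> v - op \<psi> v)\<bar> \<le> (\<Sum>v\<in>V. \<bar>exits \<kappa> s t v * (\<psi> v - op \<psi> v)\<bar>)"
      by (rule sum_abs)
    also have "\<dots> \<le> (\<Sum>v\<in>V. exits \<kappa> s t v * (w / N))"
      by (rule sum_mono) (metis abs_mult abs_of_nonneg drift exits_nonneg mult_left_mono)
    also have "\<dots> = (\<Sum>v\<in>V. exits \<kappa> s t v) * (w / N)" by (simp only: sum_distrib_right)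
    also have "\<dots> \<le> h * (w / N)"
      by (rule mult_right_mono) (use h that w in \<open>auto simp: \<kappa>_def\<close>)
    finally show ?thesis .
  qed
  have m: "(\<Sum>v\<in>V. remain \<kappa> s t v) \<le> h / N" if "s \<in> V" for s
  proof -
    have "real N * (\<Sum>v\<in>V. remain \<kappa> s t v) \<le> h"
      using remain_mass_le_exits[of \<kappa> t s] h[OF that, of "Suc t"] unfolding Nt \<kappa>_def by linarith
    then show ?thesis using N by (simp add: field_simps)
  qed
  have mass: "(\<Sum>v\<in>V. stopped \<kappa> s (Suc t) v) + (\<Sum>v\<in>V. remain \<kappa> s t v) = 1" if "s \<in> V" for s
    using fill_mass[OF that, of \<kappa> "Suc t"] by (simp add: moving_Suc sum_push_mass)
  have rep: "\<psi> s - l = (\<Sum>v\<in>V. stopped \<kappa> s (Suc t) v * (\<psi> v - l)) + (\<Sum>v\<in>V. remain \<kappa> s t v * (\<psi> v - l))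
     + (\<Sum>v\<in>V. exits \<kappa> s t v * (\<psi> v - op \<psi> v))" if "s \<in> V" for s
  proof -
    have "(\<Sum>v\<in>V. stopped \<kappa> s (Suc t) v * l) + (\<Sum>v\<in>V. remain \<kappa> s t v * l) = l"
      using mass[OF that] by (simp flip: sum_distrib_right distrib_right)
    then show ?thesis using exits_balance_dual[OF that, of \<psi> \<kappa> t]
      by (simp add: right_diff_distrib sum_subtractf)
  qed
  have R: "(\<Sum>v\<in>V. remain \<kappa> s t v * (\<psi> v - l)) \<le> (h / N) * w"
  proof -
    have "(\<Sum>v\<in>V. remain \<kappa> s t v * (\<psi> v - l)) \<le> (\<Sum>v\<in>V. remain \<kappa> s t v * w)"
      by (rule sum_mono, rule mult_left_mono) (use psi remain_nonneg in auto)
    also have "\<dots> = (\<Sum>v\<in>V. remain \<kappa> s t v) * w" by (simp only: sum_distrib_right)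
    also have "\<dots> \<le> (h / N) * w" using m[OF s(1)] w by (rule mult_right_mono)
    finally show ?thesis .
  qed
  have R': "0 \<le> (\<Sum>v\<in>V. remain \<kappa> s' t v * (\<psi> v - l))"
    by (intro sum_nonneg mult_nonneg_nonneg) (use psi remain_nonneg in auto)
  let ?S = "stopped \<kappa> s (Suc t)" and ?S' = "stopped \<kappa> s' (Suc t)"
  have "(\<Sum>v\<in>V. ?S v * (\<psi> v - l)) - (\<Sum>v\<in>V. ?S' v * (\<psi> v - l)) = (\<Sum>v\<in>V. (?S v - ?S' v) * (\<psi> v - l))"
    by (simp add: sum_subtractf left_diff_distrib)
  \<comment> \<open>The first law is replaced by its cap; what remains is the free capacity of the
    second law, whose total is small.\<close>
  also have "\<dots> \<le> (\<Sum>v\<in>V. (\<kappa> * \<mu> v - ?S' v) * w)"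
  proof (rule sum_mono)
    fix v assume v: "v \<in> V"
    have "(?S v - ?S' v) * (\<psi> v - l) \<le> (\<kappa> * \<mu> v - ?S' v) * (\<psi> v - l)"
      by (rule mult_right_mono) (use fill_bounds[of \<kappa> v s "Suc t"] psi v in \<open>auto simp: \<kappa>_def\<close>)
    also have "\<dots> \<le> (\<kappa> * \<mu> v - ?S' v) * w"
      by (rule mult_left_mono) (use fill_bounds[of \<kappa> v s' "Suc t"] psi v in \<open>auto simp: \<kappa>_def\<close>)
    finally show "(?S v - ?S' v) * (\<psi> v - l) \<le> (\<kappa> * \<mu> v - ?S' v) * w" .
  qed
  also have "\<dots> = (\<kappa> - (\<Sum>v\<in>V. ?S' v)) * w"
    using mu_sum by (simp add: sum_subtractf flip: sum_distrib_right sum_distrib_left)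
  also have "\<dots> \<le> (\<kappa> - 1 + h / N) * w"
    using mass[OF s(2)] m[OF s(2)] w by (intro mult_right_mono) auto
  finally have "\<psi> s - \<psi> s' \<le> (\<kappa> - 1 + h / N) * w + (h / N) * w + 2 * (h * (w / N))"
    using rep[OF s(1)] rep[OF s(2)] E[OF s(1)] E[OF s(2)] R R' by linarith
  also have "\<dots> = (1/4 + 4 * (h / N)) * w" by (simp add: \<kappa>_def field_simps)
  also have "\<dots> \<le> (1/4 + 1/4) * w"
    using N by (intro mult_right_mono w add_left_mono) (simp add: field_simps)
  finally show ?thesis by (simp add: \<psi>_def)
qed

text \<open>Since \<open>corr\<close> decreases, its value at the end of a block of N steps is at
  most its mean over the block. So contraction of averages bounds the correlation at a true time,
  although the oscillation of P^k \<phi> itself is not yet controlled.\<close>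

lemma corr_le_avg: "0 < N \<Longrightarrow> corr \<phi> (k + j * N) \<le> ip ((op ^^ k) ((avg N ^^ j) \<phi>)) \<phi>"
proof (induction j arbitrary: k)
  case 0
  then show ?case by (simp add: corr_def)
next
  case (Suc j)
  have "corr \<phi> (k + Suc j * N) = (\<Sum>i<N. (1 / real N) * corr \<phi> (k + Suc j * N))"
    using Suc by simp
  also have "\<dots> \<le> (\<Sum>i<N. (1 / real N) * corr \<phi> ((k + i) + j * N))"
    by (intro sum_mono mult_left_mono corr_antimono) auto
  also have "\<dots> \<le> (\<Sum>i<N. (1 / real N) * ip ((op ^^ (k + i)) ((avg N ^^ j) \<phi>)) \<phi>)"
    by (intro sum_mono mult_left_mono Suc.IH Suc.prems) auto
  also have "\<dots> = ip ((op ^^ k) (avg N ((avg N ^^ j) \<phi>))) \<phi>"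
    unfolding avg_def[abs_def] funpow_op_sum ip_sum_left funpow_add by simp
  finally show ?case by simp
qed

lemma sum_mu_op: "(\<Sum>u\<in>V. \<mu> u * op \<phi> u) = (\<Sum>u\<in>V. \<mu> u * \<phi> u)"
proof -
  have "(\<Sum>u\<in>V. \<mu> u * op \<phi> u) = ip (op \<phi>) (\<lambda>_. 1)" by (simp add: ip_def)
  also have "\<dots> = ip \<phi> (\<lambda>_. 1)" unfolding ip_op by (simp add: ip_def op_one cong: sum.cong)
  finally show ?thesis by (simp add: ip_def)
qed

lemma sum_mu_funpow_op: "(\<Sum>u\<in>V. \<mu> u * (op ^^ k) \<phi> u) = (\<Sum>u\<in>V. \<mu> u * \<phi> u)"
  by (induction k) (auto simp: sum_mu_op)

lemma sum_mu_avg: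
  assumes "0 < N"
  shows "(\<Sum>u\<in>V. \<mu> u * avg N \<phi> u) = (\<Sum>u\<in>V. \<mu> u * \<phi> u)"
proof -
  have "(\<Sum>u\<in>V. \<mu> u * avg N \<phi> u) = ip (avg N \<phi>) (\<lambda>_. 1)" by (simp add: ip_def)
  also have "\<dots> = (\<Sum>i<N. (1 / real N) * ip ((op ^^ i) \<phi>) (\<lambda>_. 1))"
    unfolding avg_def[abs_def] ip_sum_left ..
  also have "\<dots> = (\<Sum>u\<in>V. \<mu> u * \<phi> u)"
    using assms by (simp add: ip_def sum_mu_funpow_op)
  finally show ?thesis .
qed

lemma abs_le_osc:
  assumes "(\<Sum>u\<in>V. \<mu> u * \<phi> u) = 0" and "\<And>u v. u \<in> V \<Longrightarrow> v \<in> V \<Longrightarrow> \<phi> u - \<phi> v \<le> w" and "x \<in> V"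
  shows "\<bar>\<phi> x\<bar> \<le> w"
proof -
  have e: "\<phi> x = (\<Sum>u\<in>V. \<mu> u * (\<phi> x - \<phi> u))"
    using assms(1) mu_sum by (simp add: right_diff_distrib sum_subtractf flip: sum_distrib_right)
  have "\<bar>\<phi> x\<bar> \<le> (\<Sum>u\<in>V. \<bar>\<mu> u * (\<phi> x - \<phi> u)\<bar>)" by (subst e) (rule sum_abs)
  also have "\<dots> \<le> (\<Sum>u\<in>V. \<mu> u * w)"
  proof (rule sum_mono)
    fix u assume u: "u \<in> V"
    have "\<bar>\<phi> x - \<phi> u\<bar> \<le> w" using assms(2)[OF u assms(3)] assms(2)[OF assms(3) u] by linarith
    then show "\<bar>\<mu> u * (\<phi> x - \<phi> u)\<bar> \<le> \<mu> u * w" using mu_pos[OF u] by (simp add: abs_mult)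
  qed
  finally show ?thesis using mu_sum by (simp flip: sum_distrib_right)
qed

text \<open>Ten averages give \<open>corr \<phi> t \<le> 1/1024\<close> at t = 10N, and the maximal
  function on [t, 2t] then has mean at most sqrt(5/1024) \<le> 1/10. Paths stopped by time t
  contribute at most 5/4 * 1/10 = 1/8, the others at most 1/16.\<close>

lemma mixing_of_exits:
  assumes h: "\<And>s t. s \<in> V \<Longrightarrow> (\<Sum>v\<in>V. exits (5/4) s t v) \<le> h"
    and N: "16 * h \<le> real N" "0 < N"
    and mean: "(\<Sum>u\<in>V. \<mu> u * \<phi> u) = 0" and osc: "\<And>u v. u \<in> V \<Longrightarrow> v \<in> V \<Longrightarrow> \<phi> u - \<phi> v \<le> 1"
    and s: "s \<in> V"
  shows "\<bar>(op ^^ (20 * N)) \<phi> s\<bar> \<le> 1/4"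
proof -
  define \<kappa> where "\<kappa> = (5/4 :: real)"
  have \<kappa>0: "0 \<le> \<kappa>" by (simp add: \<kappa>_def)
  define t where "t = 10 * N"
  have t: "0 < t" using N by (simp add: t_def)
  have A: "(\<Sum>u\<in>V. \<mu> u * (avg N ^^ j) \<phi> u) = 0 \<and>
      (\<forall>u\<in>V. \<forall>v\<in>V. (avg N ^^ j) \<phi> u - (avg N ^^ j) \<phi> v \<le> (1/2) ^ j)" for j
  proof (induction j)
    case 0
    then show ?case using mean osc by simp
  next
    case (Suc j)
    then show ?case using avg_osc[OF h N, of "(avg N ^^ j) \<phi>" "(1/2) ^ j"] sum_mu_avg[OF N(2)] by auto
  qed
  have abs_phi: "\<bar>\<phi> v\<bar> \<le> 1" if "v \<in> V" for v by (rule abs_le_osc[OF mean osc that])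
  have "corr \<phi> t \<le> ip ((avg N ^^ 10) \<phi>) \<phi>"
    using corr_le_avg[OF N(2), of \<phi> 0 10] by (simp add: t_def)
  also have "\<dots> \<le> (\<Sum>u\<in>V. \<mu> u * (1/2) ^ 10)"
    unfolding ip_def
  proof (rule sum_mono)
    fix u assume u: "u \<in> V"
    have "\<bar>(avg N ^^ 10) \<phi> u\<bar> \<le> (1/2) ^ 10"
      using abs_le_osc[of "(avg N ^^ 10) \<phi>" "(1/2) ^ 10" u] A[of 10] u by blast
    then have "\<bar>(avg N ^^ 10) \<phi> u * \<phi> u\<bar> \<le> (1/2) ^ 10 * 1"
      unfolding abs_mult using abs_phi[OF u] by (intro mult_mono) auto
    then have "(avg N ^^ 10) \<phi> u * \<phi> u \<le> (1/2) ^ 10" by linarith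
    then show "\<mu> u * (avg N ^^ 10) \<phi> u * \<phi> u \<le> \<mu> u * (1/2) ^ 10"
      using mu_pos[OF u] by (simp add: mult.assoc)
  qed
  also have "\<dots> = (1/2) ^ 10" using mu_sum by (simp flip: sum_distrib_right)
  also have "\<dots> = 1 / 1024" by (simp add: power_divide)
  finally have c: "corr \<phi> t \<le> 1 / 1024" .
  obtain F where F: "\<And>k x. t \<le> k \<Longrightarrow> k \<le> 2 * t \<Longrightarrow> \<bar>(op ^^ k) \<phi> x\<bar> \<le> F x"
    and Fsum: "(\<Sum>x\<in>V. \<mu> x * F x) \<le> sqrt (5 * corr \<phi> t)" and Fnn: "\<And>x. 0 \<le> F x"
    using maximal_ineq[OF t] by blast
  have "sqrt (5 * corr \<phi> t) \<le> 1/10"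
    by (rule real_le_lsqrt) (use c corr_nonneg in \<open>auto simp: power2_eq_square\<close>)
  then have Fs: "(\<Sum>x\<in>V. \<mu> x * F x) \<le> 1/10" using Fsum by linarith
  \<comment> \<open>Stopping at r \<le> t leaves 2t - r further steps, a number inside the window
    [t, 2t] of the maximal inequality.\<close>
  have dec: "(op ^^ (2 * t)) \<phi> s = (\<Sum>r<Suc t. \<Sum>v\<in>V. stop_at \<kappa> s r v * (op ^^ (2 * t - r)) \<phi> v)
      + (\<Sum>v\<in>V. moving \<kappa> s (Suc t) v * (op ^^ (2 * t - Suc t)) \<phi> v)"
    by (rule fill_decomposition) (use s t in auto)
  have "\<bar>\<Sum>r<Suc t. \<Sum>v\<in>V. stop_at \<kappa> s r v * (op ^^ (2 * t - r)) \<phi> v\<bar>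
     \<le> (\<Sum>r<Suc t. \<Sum>v\<in>V. stop_at \<kappa> s r v * F v)"
  proof (rule order.trans[OF sum_abs], rule sum_mono, rule order.trans[OF sum_abs], rule sum_mono)
    fix r v assume "r \<in> {..<Suc t}" and v: "v \<in> V"
    then have "\<bar>(op ^^ (2 * t - r)) \<phi> v\<bar> \<le> F v" by (intro F) auto
    then show "\<bar>stop_at \<kappa> s r v * (op ^^ (2 * t - r)) \<phi> v\<bar> \<le> stop_at \<kappa> s r v * F v"
      using stop_at_nonneg[of \<kappa> v s r] v by (simp add: abs_mult mult_left_mono \<kappa>_def)
  qed
  also have "\<dots> = (\<Sum>v\<in>V. stopped \<kappa> s (Suc t) v * F v)"
    by (subst sum.swap) (simp only: stop_at_sum flip: sum_distrib_right)
  also have "\<dots> \<le> (\<Sum>v\<in>V. (\<kappa> * \<mu> v) * F v)"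
    by (intro sum_mono mult_right_mono) (use fill_bounds[of \<kappa> _ s "Suc t"] \<kappa>0 Fnn in auto)
  also have "\<dots> = \<kappa> * (\<Sum>v\<in>V. \<mu> v * F v)" by (simp add: sum_distrib_left mult.assoc)
  also have "\<dots> \<le> \<kappa> * (1/10)" by (rule mult_left_mono) (use Fs in \<open>auto simp: \<kappa>_def\<close>)
  finally have I: "\<bar>\<Sum>r<Suc t. \<Sum>v\<in>V. stop_at \<kappa> s r v * (op ^^ (2 * t - r)) \<phi> v\<bar> \<le> 1/8"
    by (simp add: \<kappa>_def)
  have bnd: "\<bar>(op ^^ k) \<phi> v\<bar> \<le> 1" if "v \<in> V" for k v
    using funpow_op_bounds[of "-1" \<phi> 1 v k] abs_phi that by (simp add: abs_le_iff minus_le_iff)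
  have "\<bar>\<Sum>v\<in>V. moving \<kappa> s (Suc t) v * (op ^^ (2 * t - Suc t)) \<phi> v\<bar> \<le> (\<Sum>v\<in>V. moving \<kappa> s (Suc t) v)"
  proof (rule order.trans[OF sum_abs], rule sum_mono)
    fix v assume v: "v \<in> V"
    have "0 \<le> moving \<kappa> s (Suc t) v" using fill_bounds[of \<kappa> v s "Suc t"] v by (simp add: \<kappa>_def)
    then show "\<bar>moving \<kappa> s (Suc t) v * (op ^^ (2 * t - Suc t)) \<phi> v\<bar> \<le> moving \<kappa> s (Suc t) v"
      using bnd[OF v] by (simp add: abs_mult mult_left_le)
  qed
  also have "\<dots> = (\<Sum>v\<in>V. remain \<kappa> s t v)" by (simp add: moving_Suc sum_push_mass)
  also have "\<dots> \<le> 1/16"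
  proof -
    have "real (Suc t) * (\<Sum>v\<in>V. remain \<kappa> s t v) \<le> h"
      using remain_mass_le_exits[of \<kappa> t s] h[OF s, of "Suc t"] unfolding \<kappa>_def by linarith
    also have "h \<le> real (Suc t) * (1/16)" using N by (simp add: t_def)
    finally show ?thesis using mult_le_cancel_left_pos[of "real (Suc t)"] by simp
  qed
  finally have "\<bar>(op ^^ (2 * t)) \<phi> s\<bar> \<le> 1/4" using I dec by linarith
  then show ?thesis by (simp add: t_def)
qed

end

section \<open>Isoperimetry along level sets\<close>

text \<open>The layer-cake formula writes the left side as the integral of the volume of {f > c}
  over c. The integral is carried out as an induction over the values of f, which avoids
  differentiating the piecewise linear \<nu>.\<close>

lemma level_sum_bound:
  fixes f w :: "'a \<Rightarrow> real" and lo hi :: "'e \<Rightarrow> real" and \<Lambda> A L :: real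
  assumes V: "finite V" and E: "finite E"
    and f: "\<And>v. v \<in> V \<Longrightarrow> 0 \<le> f v"
    and pos: "0 < \<Lambda>" "0 \<le> A" "0 \<le> L"
    and hi: "\<And>e. e \<in> E \<Longrightarrow> hi e \<in> f ` V"
    and bd: "\<And>c. 0 \<le> c \<Longrightarrow> \<exists>v\<in>V. c < f v \<Longrightarrow> 1 \<le> card {e \<in> E. lo e \<le> c \<and> c < hi e}"
    and flow: "\<And>c. 0 \<le> c \<Longrightarrow> \<exists>v\<in>V. c < f v \<Longrightarrow> (\<Sum>e | e \<in> E \<and> lo e \<le> c \<and> c < hi e. hi e - lo e) \<le> \<Lambda>"
    and inner: "\<And>c. 0 \<le> c \<Longrightarrow> \<exists>v\<in>V. c < f v \<Longrightarrow> real (card {e \<in> E. c < hi e}) \<le> (\<Sum>v | v \<in> V \<and> c < f v. w v)"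
    and iso: "\<And>c. 0 \<le> c \<Longrightarrow> \<exists>v\<in>V. c < f v \<Longrightarrow>
      (\<Sum>v | v \<in> V \<and> c < f v. w v) \<le> A * real (card {e \<in> E. lo e \<le> c \<and> c < hi e})
      \<or> (\<Sum>v | v \<in> V \<and> c < f v. w v) \<le> L"
  shows "(\<Sum>v\<in>V. w v * f v) \<le> \<Lambda> * (A * (1 + A) * ln (1 + real (card E)) + L * L)"
proof -
  define cut where "cut = (\<lambda>c. {e \<in> E. lo e \<le> c \<and> c < hi e})"
  define vol where "vol = (\<lambda>c. \<Sum>v | v \<in> V \<and> c < f v. w v)"
  define clamp where "clamp = (\<lambda>x::real. max 0 (min 1 x))"
  \<comment> \<open>\<open>\<nu> c\<close> counts edges above level \<open>c\<close>, with crossing edges counted fractionally. Cauchy--Schwarz gives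
    \<open>- \<nu>'(c) \<ge> b(c)\<^sup>2 / \<Lambda>\<close>, where \<open>b(c)\<close> is the number of crossing edges; \<open>\<Theta>\<close> is chosen such that
    \<open>\<Theta>' \<ge> vol / b\<^sup>2\<close> in both cases of the isoperimetric hypothesis.\<close>
  define \<nu> where "\<nu> = (\<lambda>c. \<Sum>e | e \<in> E \<and> lo e < hi e. clamp ((hi e - c) / (hi e - lo e)))"
  define \<Theta> where "\<Theta> = (\<lambda>x. A * (1 + A) * ln (1 + x) + L * min x L)"
  have nu0: "0 \<le> \<nu> c" for c unfolding \<nu>_def by (rule sum_nonneg) (simp add: clamp_def)
  have nu_le: "\<nu> c \<le> real (card {e \<in> E. c < hi e})" for c
  proof -
    have "\<nu> c \<le> (\<Sum>e | e \<in> E \<and> lo e < hi e. if c < hi e then 1 else 0)"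
      unfolding \<nu>_def
    proof (rule sum_mono)
      fix e assume "e \<in> {e. e \<in> E \<and> lo e < hi e}"
      then have "hi e \<le> c \<Longrightarrow> (hi e - c) / (hi e - lo e) \<le> 0" by (simp add: divide_le_0_iff)
      then show "clamp ((hi e - c) / (hi e - lo e)) \<le> (if c < hi e then 1 else 0)"
        by (auto simp: clamp_def)
    qed
    also have "\<dots> \<le> (\<Sum>e\<in>E. if c < hi e then 1 else 0)"
      by (rule sum_mono2) (use E in auto)
    also have "\<dots> = real (card {e \<in> E. c < hi e})"
      using E by (simp add: sum.If_cases Int_def)
    finally show ?thesis .
  qed
  have "(\<Sum>v\<in>V. w v * max 0 (f v - c)) \<le> \<Lambda> * \<Theta> (\<nu> c)" if "0 \<le> c" for c
    using that
  proof (induction "card {v \<in> V. c < f v}" arbitrary: c rule: less_induct)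
    case less
    show ?case
    proof (cases "\<exists>v\<in>V. c < f v")
      case False
      then have "(\<Sum>v\<in>V. w v * max 0 (f v - c)) = 0"
        by (intro sum.neutral) (auto simp: not_less)
      also have "0 \<le> \<Lambda> * \<Theta> (\<nu> c)"
        using pos nu0[of c] by (simp add: \<Theta>_def)
      finally show ?thesis .
    next
      case True
      \<comment> \<open>The next value of f above c: the level set does not change on [c, d), and
        every edge that reaches above c reaches d.\<close>
      define d where "d = Min (f ` {v \<in> V. c < f v})"
      have d_in: "d \<in> f ` {v \<in> V. c < f v}"
        unfolding d_def using True V by (intro Min_in) auto
      have d_le: "d \<le> f v" if "v \<in> V" "c < f v" for v
        unfolding d_def using that V by (intro Min_le) auto
      have cd: "c < d" using d_in by auto
      have "{v \<in> V. d < f v} \<subset> {v \<in> V. c < f v}" using cd d_in by force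
      then have "card {v \<in> V. d < f v} < card {v \<in> V. c < f v}"
        by (rule psubset_card_mono[rotated]) (use V in auto)
      then have IH: "(\<Sum>v\<in>V. w v * max 0 (f v - d)) \<le> \<Lambda> * \<Theta> (\<nu> d)"
        using less.hyps cd less.prems by simp
      have "(\<Sum>v\<in>V. w v * max 0 (f v - c)) = (\<Sum>v\<in>V. w v * max 0 (f v - d) + (if c < f v then (d - c) * w v else 0))"
      proof (rule sum.cong)
        fix v assume "v \<in> V"
        then show "w v * max 0 (f v - c) = w v * max 0 (f v - d) + (if c < f v then (d - c) * w v else 0)"
          using d_le[of v] cd by (auto simp: max_def algebra_simps)
      qed simp
      also have "\<dots> = (\<Sum>v\<in>V. w v * max 0 (f v - d)) + (d - c) * vol c"
        using V by (simp add: sum.distrib sum.If_cases vol_def Int_def sum_distrib_left)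
      finally have step: "(\<Sum>v\<in>V. w v * max 0 (f v - c)) = (\<Sum>v\<in>V. w v * max 0 (f v - d)) + (d - c) * vol c" .
      define b where "b = real (card (cut c))"
      have b1: "1 \<le> b" using bd[OF less.prems True] by (simp add: b_def cut_def)
      have fl: "(\<Sum>e\<in>cut c. hi e - lo e) \<le> \<Lambda>" using flow[OF less.prems True] by (simp add: cut_def)
      have hid: "d \<le> hi e" if "e \<in> E" "c < hi e" for e
        using hi[OF that(1)] d_le that(2) by auto
      have "(d - c) * (\<Sum>e\<in>cut c. 1 / (hi e - lo e)) \<le> \<nu> c - \<nu> d"
      proof -
        have "(d - c) * (\<Sum>e\<in>cut c. 1 / (hi e - lo e)) = (\<Sum>e\<in>cut c. (d - c) / (hi e - lo e))"
          by (simp add: sum_distrib_left)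
        also have "\<dots> \<le> (\<Sum>e\<in>cut c. clamp ((hi e - c) / (hi e - lo e)) - clamp ((hi e - d) / (hi e - lo e)))"
        proof (rule sum_mono)
          fix e assume e: "e \<in> cut c"
          then have le: "lo e \<le> c" "c < hi e" "d \<le> hi e" "lo e < hi e" using hid by (auto simp: cut_def)
          then have "clamp ((hi e - c) / (hi e - lo e)) = (hi e - c) / (hi e - lo e)"
            by (simp add: clamp_def min_def max_def field_simps)
          moreover have "clamp ((hi e - d) / (hi e - lo e)) = (hi e - d) / (hi e - lo e)"
            using le cd by (simp add: clamp_def min_def max_def field_simps)
          ultimately show "(d - c) / (hi e - lo e) \<le> clamp ((hi e - c) / (hi e - lo e)) - clamp ((hi e - d) / (hi e - lo e))"
            by (simp flip: diff_divide_distrib)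
        qed
        also have "\<dots> \<le> (\<Sum>e | e \<in> E \<and> lo e < hi e. clamp ((hi e - c) / (hi e - lo e)) - clamp ((hi e - d) / (hi e - lo e)))"
        proof (rule sum_mono2)
          fix e assume "e \<in> {e. e \<in> E \<and> lo e < hi e} - cut c"
          then have "(hi e - d) / (hi e - lo e) \<le> (hi e - c) / (hi e - lo e)"
            using cd by (intro divide_right_mono) auto
          then show "0 \<le> clamp ((hi e - c) / (hi e - lo e)) - clamp ((hi e - d) / (hi e - lo e))"
            by (auto simp: clamp_def)
        qed (use E in \<open>auto simp: cut_def\<close>)
        also have "\<dots> = \<nu> c - \<nu> d" by (simp add: \<nu>_def sum_subtractf)
        finally show ?thesis .
      qed
      moreover have "b\<^sup>2 \<le> \<Lambda> * (\<Sum>e\<in>cut c. 1 / (hi e - lo e))"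
      proof -
        have p: "0 < hi e - lo e" if "e \<in> cut c" for e using that by (auto simp: cut_def)
        have "b\<^sup>2 = (\<Sum>e\<in>cut c. sqrt (hi e - lo e) * (1 / sqrt (hi e - lo e)))\<^sup>2"
        proof -
          have "(\<Sum>e\<in>cut c. sqrt (hi e - lo e) * (1 / sqrt (hi e - lo e))) = (\<Sum>e\<in>cut c. 1)"
          proof (rule sum.cong)
            fix e assume "e \<in> cut c"
            then show "sqrt (hi e - lo e) * (1 / sqrt (hi e - lo e)) = 1" using p[of e] by simp
          qed simp
          then show ?thesis by (simp add: b_def)
        qed
        also have "\<dots> \<le> (\<Sum>e\<in>cut c. (sqrt (hi e - lo e))\<^sup>2) * (\<Sum>e\<in>cut c. (1 / sqrt (hi e - lo e))\<^sup>2)"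
          by (rule Cauchy_Schwarz_ineq_sum)
        also have "\<dots> = (\<Sum>e\<in>cut c. hi e - lo e) * (\<Sum>e\<in>cut c. 1 / (hi e - lo e))"
          using p by (simp add: power_divide less_imp_le)
        also have "\<dots> \<le> \<Lambda> * (\<Sum>e\<in>cut c. 1 / (hi e - lo e))"
          by (rule mult_right_mono[OF fl sum_nonneg]) (use p in \<open>auto simp: less_imp_le\<close>)
        finally show ?thesis .
      qed
      ultimately have key: "(d - c) * b\<^sup>2 \<le> \<Lambda> * (\<nu> c - \<nu> d)"
      proof -
        assume 1: "(d - c) * (\<Sum>e\<in>cut c. 1 / (hi e - lo e)) \<le> \<nu> c - \<nu> d"
          and 2: "b\<^sup>2 \<le> \<Lambda> * (\<Sum>e\<in>cut c. 1 / (hi e - lo e))"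
        have "(d - c) * b\<^sup>2 \<le> \<Lambda> * ((d - c) * (\<Sum>e\<in>cut c. 1 / (hi e - lo e)))"
          using mult_left_mono[OF 2, of "d - c"] cd by (simp add: mult.left_commute)
        also have "\<dots> \<le> \<Lambda> * (\<nu> c - \<nu> d)" using 1 pos by (intro mult_left_mono) auto
        finally show ?thesis .
      qed
      define x y where "x = \<nu> c" and "y = \<nu> d"
      have xy: "0 \<le> y" "y \<le> x"
      proof -
        show "0 \<le> y" using nu0 by (simp add: y_def)
        have "0 \<le> (d - c) * b\<^sup>2" using cd by simp
        then have "0 \<le> \<Lambda> * (x - y)" using key unfolding x_def y_def by linarith
        then show "y \<le> x" using pos by (simp add: zero_le_mult_iff)
      qed
      have xvol: "x \<le> vol c"
        using nu_le[of c] inner[OF less.prems True] unfolding x_def vol_def by linarith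
      have ln_ge: "(x - y) / (1 + x) \<le> ln (1 + x) - ln (1 + y)"
      proof -
        have "ln ((1 + y) / (1 + x)) \<le> (1 + y) / (1 + x) - 1" using xy by (intro ln_le_minus_one) auto
        also have "\<dots> = - ((x - y) / (1 + x))" using xy by (simp add: field_simps)
        finally show ?thesis using xy by (simp add: ln_div)
      qed
      have lmono: "ln (1 + y) \<le> ln (1 + x)" using xy by simp
      have ratio: "vol c * (x - y) \<le> b\<^sup>2 * (\<Theta> x - \<Theta> y)"
      proof (cases "vol c \<le> A * b")
        case True
        \<comment> \<open>Linear regime: vol/b^2 \<le> A/b \<le> A (1 + A)/(1 + x), which integrates
          to the logarithm in \<Theta>.\<close>
        have "1 + x \<le> b * (1 + A)" using xvol True b1 by (simp add: algebra_simps)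
        then have "(x - y) / (b * (1 + A)) \<le> (x - y) / (1 + x)"
          using xy b1 pos by (intro divide_left_mono) auto
        then have "(x - y) / (b * (1 + A)) \<le> ln (1 + x) - ln (1 + y)" using ln_ge by linarith
        moreover have "0 < b * (1 + A)" using b1 pos by simp
        ultimately have "x - y \<le> b * (1 + A) * (ln (1 + x) - ln (1 + y))"
          by (simp only: pos_divide_le_eq mult.commute)
        then have "(A * b) * (x - y) \<le> (A * b) * (b * (1 + A) * (ln (1 + x) - ln (1 + y)))"
          using b1 pos by (intro mult_left_mono) auto
        moreover have "vol c * (x - y) \<le> (A * b) * (x - y)" using True xy by (intro mult_right_mono) auto
        moreover have "0 \<le> b\<^sup>2 * (L * (min x L - min y L))"
          using pos xy by (intro mult_nonneg_nonneg) auto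
        ultimately show ?thesis by (simp add: \<Theta>_def power2_eq_square algebra_simps)
      next
        case False
        \<comment> \<open>Small volume: a cut of one edge is all that is available, but here x \<le>
          vol \<le> L, so the minima in \<Theta> are inactive and this regime contributes at most
          L^2 in total.\<close>
        then have vL: "vol c \<le> L" using iso[OF less.prems True] unfolding vol_def b_def cut_def by blast
        have "vol c * (x - y) \<le> L * (x - y)" using vL xy by (intro mult_right_mono) auto
        also have "\<dots> \<le> b\<^sup>2 * (L * (x - y))"
          using b1 pos xy mult_right_mono[of 1 "b\<^sup>2" "L * (x - y)"] by simp
        also have "\<dots> = b\<^sup>2 * (L * min x L - L * min y L)" using xy xvol vL by (simp add: algebra_simps)
        also have "\<dots> \<le> b\<^sup>2 * (\<Theta> x - \<Theta> y)"
        proof (rule mult_left_mono)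
          have "0 \<le> A * (1 + A) * (ln (1 + x) - ln (1 + y))" using pos lmono by simp
          then show "L * min x L - L * min y L \<le> \<Theta> x - \<Theta> y" by (simp add: \<Theta>_def algebra_simps)
        qed simp
        finally show ?thesis .
      qed
      have v0: "0 \<le> vol c" using xvol xy by linarith
      have "b\<^sup>2 * ((d - c) * vol c) \<le> \<Lambda> * (vol c * (x - y))"
        using mult_right_mono[OF key v0] unfolding x_def y_def by (simp add: algebra_simps)
      also have "\<dots> \<le> \<Lambda> * (b\<^sup>2 * (\<Theta> x - \<Theta> y))" using ratio pos by (intro mult_left_mono) auto
      finally have "b\<^sup>2 * ((d - c) * vol c) \<le> b\<^sup>2 * (\<Lambda> * (\<Theta> x - \<Theta> y))" by (simp add: algebra_simps)
      then have "(d - c) * vol c \<le> \<Lambda> * (\<Theta> x - \<Theta> y)" using b1 by (subst (asm) mult_le_cancel_left_pos) auto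
      then show ?thesis using step IH unfolding x_def y_def by (simp add: algebra_simps)
    qed
  qed
  from this[of 0] have "(\<Sum>v\<in>V. w v * f v) \<le> \<Lambda> * \<Theta> (\<nu> 0)"
    using f by (simp add: max_def cong: sum.cong)
  also have "\<dots> \<le> \<Lambda> * (A * (1 + A) * ln (1 + real (card E)) + L * L)"
  proof (rule mult_left_mono)
    have "real (card {e \<in> E. 0 < hi e}) \<le> real (card E)" using E by (intro of_nat_mono card_mono) auto
    then have "\<nu> 0 \<le> real (card E)" using nu_le[of 0] by linarith
    then have "ln (1 + \<nu> 0) \<le> ln (1 + real (card E))" using nu0[of 0] by simp
    then show "\<Theta> (\<nu> 0) \<le> A * (1 + A) * ln (1 + real (card E)) + L * L"
      unfolding \<Theta>_def using pos by (intro add_mono mult_left_mono) auto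
  qed (use pos in simp)
  finally show ?thesis .
qed

section \<open>Flow through the level sets of the exit density\<close>

context lazy_chain
begin

text \<open>A divergence theorem: by reversibility the net flow between two points of S is
  antisymmetric, so all contributions inside S cancel.\<close>

lemma flow_out:
  assumes "S \<subseteq> V"
  shows "(\<Sum>v\<in>S. \<Sum>u\<in>V - S. \<mu> v * P v u * (f v - f u)) = (\<Sum>v\<in>S. \<mu> v * (f v - op f v))"
proof -
  have "(\<Sum>v\<in>S. \<Sum>u\<in>S. \<mu> v * P v u * (f v - f u)) = (\<Sum>v\<in>S. \<Sum>u\<in>S. \<mu> u * P u v * (f v - f u))"
    by (intro sum.cong refl) (use assms rev in auto)
  also have "\<dots> = (\<Sum>v\<in>S. \<Sum>u\<in>S. \<mu> v * P v u * (f u - f v))" by (rule sum.swap)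
  also have "\<dots> = - (\<Sum>v\<in>S. \<Sum>u\<in>S. \<mu> v * P v u * (f v - f u))"
    unfolding sum_negf[symmetric] by (simp add: algebra_simps)
  finally have inside: "(\<Sum>v\<in>S. \<Sum>u\<in>S. \<mu> v * P v u * (f v - f u)) = 0" by simp
  have "(\<Sum>v\<in>S. \<mu> v * (f v - op f v)) = (\<Sum>v\<in>S. \<Sum>u\<in>V. \<mu> v * P v u * (f v - f u))"
  proof (rule sum.cong)
    fix v assume "v \<in> S"
    then have "f v = (\<Sum>u\<in>V. P v u * f v)" using assms P_sum[of v] by (auto simp flip: sum_distrib_right)
    then have "\<mu> v * (f v - op f v) = \<mu> v * ((\<Sum>u\<in>V. P v u * f v) - op f v)" by simp
    also have "\<dots> = (\<Sum>u\<in>V. \<mu> v * P v u * (f v - f u))"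
      by (simp add: op_def right_diff_distrib sum_subtractf sum_distrib_left mult.assoc)
    finally show "\<mu> v * (f v - op f v) = (\<Sum>u\<in>V. \<mu> v * P v u * (f v - f u))" .
  qed simp
  also have "\<dots> = (\<Sum>v\<in>S. (\<Sum>u\<in>V - S. \<mu> v * P v u * (f v - f u)) + (\<Sum>u\<in>S. \<mu> v * P v u * (f v - f u)))"
    by (intro sum.cong refl sum.subset_diff assms finV)
  finally show ?thesis by (simp add: sum.distrib inside)
qed

text \<open>Reversibility converts transport of mass into \<open>op\<close> acting on
  densities.\<close>

lemma exits_density:
  assumes "v \<in> V"
  shows "\<mu> v * (exits \<kappa> s t v / \<mu> v - op (\<lambda>u. exits \<kappa> s t u / \<mu> u) v) = exits \<kappa> s t v - push (exits \<kappa> s t) v"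
proof -
  have "\<mu> v * op (\<lambda>u. exits \<kappa> s t u / \<mu> u) v = push (exits \<kappa> s t) v"
    unfolding op_def push_def sum_distrib_left
  proof (rule sum.cong)
    fix u assume u: "u \<in> V"
    have "\<mu> v * (P v u * (exits \<kappa> s t u / \<mu> u)) = (\<mu> v * P v u) * (exits \<kappa> s t u / \<mu> u)" by simp
    also have "\<dots> = exits \<kappa> s t u * P u v" using rev[OF assms u] mu_pos[OF u] by simp
    finally show "\<mu> v * (P v u * (exits \<kappa> s t u / \<mu> u)) = exits \<kappa> s t u * P u v" .
  qed simp
  then show ?thesis using mu_pos[OF assms] by (simp add: right_diff_distrib)
qed

lemma exits_flow:
  assumes "0 \<le> \<kappa>" "S \<subseteq> V" "\<And>v. v \<in> S \<Longrightarrow> 0 < exits \<kappa> s t v"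
  defines "f \<equiv> \<lambda>v. exits \<kappa> s t v / \<mu> v"
  shows "(\<Sum>v\<in>S. \<Sum>u\<in>V - S. \<mu> v * P v u * (f v - f u)) \<le> 1"
proof -
  have fS: "finite S" using assms(2) finV finite_subset by blast
  have "(\<Sum>v\<in>S. \<mu> v * (f v - op f v)) \<le> (\<Sum>v\<in>S. (if v = s then 1 else 0))"
  proof (rule sum_mono)
    fix v assume v: "v \<in> S"
    then have vV: "v \<in> V" using assms by auto
    have "\<mu> v * (f v - op f v) \<le> (if v = s then 1 else 0) - \<kappa> * \<mu> v"
      unfolding f_def exits_density[OF vV] using exits_drift[OF assms(1) vV assms(3)[OF v]] .
    then show "\<mu> v * (f v - op f v) \<le> (if v = s then 1 else 0)"
      using mult_nonneg_nonneg[of \<kappa> "\<mu> v"] mu_pos[OF vV] assms(1) by linarith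
  qed
  also have "\<dots> \<le> 1" using fS by simp
  finally show ?thesis unfolding flow_out[OF assms(2)] .
qed

text \<open>The maximum principle behind the connectedness of the level sets.\<close>

lemma exits_climb:
  assumes "0 < \<kappa>" "v \<in> V" "v \<noteq> s" "0 < exits \<kappa> s t v"
  defines "f \<equiv> \<lambda>v. exits \<kappa> s t v / \<mu> v"
  shows "\<exists>u\<in>V. 0 < P v u \<and> f v < f u"
proof (rule ccontr)
  assume "\<not> ?thesis"
  then have "P v u * f u \<le> P v u * f v" if "u \<in> V" for u
    using that P_nonneg[OF assms(2) that] by (cases "P v u = 0") (auto simp: not_less)
  then have "op f v \<le> (\<Sum>u\<in>V. P v u * f v)" unfolding op_def by (intro sum_mono)
  also have "\<dots> = f v" using P_sum[OF assms(2)] by (simp flip: sum_distrib_right)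
  finally have "0 \<le> \<mu> v * (f v - op f v)" using mu_pos[OF assms(2)] by simp
  also have "\<dots> \<le> (if v = s then 1 else 0) - \<kappa> * \<mu> v"
    unfolding f_def exits_density[OF assms(2)] by (rule exits_drift) (use assms in auto)
  finally show False using mult_pos_pos[OF assms(1) mu_pos[OF assms(2)]] assms(3) by simp
qed

end

section \<open>The lazy random walk on a graph\<close>

definition boundary :: "nat set set \<Rightarrow> nat set \<Rightarrow> nat set set" where
  "boundary E S = {e \<in> E. e \<inter> S \<noteq> {} \<and> \<not> e \<subseteq> S}"

definition inside :: "nat set set \<Rightarrow> nat set \<Rightarrow> nat set set" where
  "inside E S = {e \<in> E. e \<subseteq> S}"

text \<open>Connectedness of the subgraph induced on S, in terms of cuts instead of paths: it is
  monotone in E, depends only on edges inside S, and is what the maximum principle delivers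
  directly.\<close>

definition cutconn :: "nat set set \<Rightarrow> nat set \<Rightarrow> bool" where
  "cutconn E S \<longleftrightarrow> (\<forall>U. U \<subseteq> S \<and> U \<noteq> {} \<and> U \<noteq> S \<longrightarrow> (\<exists>x\<in>U. \<exists>y\<in>S - U. {x, y} \<in> E))"

lemma finite_all_pairs: "finite (all_pairs n)"
  by (rule finite_subset[of _ "Pow {..<n}"]) (auto simp: all_pairs_def)

lemma finite_graph: "is_graph n E \<Longrightarrow> finite E"
  using finite_all_pairs finite_subset by (auto simp: is_graph_def)

lemma graph_edge:
  assumes "is_graph n E" "e \<in> E"
  obtains u v where "e = {u, v}" "u \<noteq> v" "u < n" "v < n"
proof -
  have "e \<subseteq> {..<n}" "card e = 2" using assms by (auto simp: is_graph_def all_pairs_def)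
  then show ?thesis using that by (auto simp: card_2_iff)
qed

lemma graph_edgeD:
  assumes "is_graph n E" "{u, v} \<in> E"
  shows "u \<noteq> v" "u < n" "v < n"
  using assms unfolding is_graph_def all_pairs_def by (auto simp: card_2_iff' dest!: subsetD[of _ _ "{u, v}"])

lemma sum_degree:
  assumes E: "is_graph n E" and S: "finite S"
  shows "(\<Sum>v\<in>S. degree E v) = 2 * card (inside E S) + card (boundary E S)"
proof -
  note fE = finite_graph[OF E]
  have "(\<Sum>v\<in>S. degree E v) = (\<Sum>v\<in>S. \<Sum>e\<in>E. if v \<in> e then 1 else 0)"
    unfolding degree_def using fE by (simp add: sum.If_cases Int_def)
  also have "\<dots> = (\<Sum>e\<in>E. \<Sum>v\<in>S. if v \<in> e then 1 else 0)" by (rule sum.swap)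
  also have "\<dots> = (\<Sum>e\<in>E. (if e \<in> inside E S then 2 else 0) + (if e \<in> boundary E S then 1 else 0))"
  proof (rule sum.cong)
    fix e assume e: "e \<in> E"
    from graph_edge[OF E e] obtain u v where uv: "e = {u, v}" "u \<noteq> v" by metis
    have "(\<Sum>v\<in>S. if v \<in> e then 1 else 0) = card (S \<inter> {u, v})"
      using S unfolding uv by (subst sum.If_cases) (auto intro!: arg_cong[of _ _ card])
    also have "\<dots> = (if e \<in> inside E S then 2 else 0) + (if e \<in> boundary E S then 1 else 0)"
      using uv e by (cases "u \<in> S"; cases "v \<in> S") (auto simp: inside_def boundary_def)
    finally show "(\<Sum>v\<in>S. if v \<in> e then 1 else 0) = (if e \<in> inside E S then 2 else 0) + (if e \<in> boundary E S then 1 else (0::nat))" .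
  qed simp
  also have "\<dots> = 2 * card (inside E S) + card (boundary E S)"
    unfolding sum.distrib using fE by (simp add: sum.If_cases inside_def boundary_def Int_def)
  finally show ?thesis .
qed

lemma sum_degree_all: "is_graph n E \<Longrightarrow> (\<Sum>v<n. degree E v) = 2 * card E"
proof -
  assume E: "is_graph n E"
  have "inside E {..<n} = E" "boundary E {..<n} = {}"
    using E by (auto simp: is_graph_def all_pairs_def inside_def boundary_def)
  then show ?thesis using sum_degree[OF E, of "{..<n}"] by simp
qed

lemma degree_neighbours:
  assumes E: "is_graph n E"
  shows "degree E u = card {v. v < n \<and> {u, v} \<in> E}"
proof -
  have "bij_betw (\<lambda>v. {u, v}) {v. v < n \<and> {u, v} \<in> E} {e \<in> E. u \<in> e}"
    unfolding bij_betw_def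
  proof
    show "inj_on (\<lambda>v. {u, v}) {v. v < n \<and> {u, v} \<in> E}"
      by (auto simp: inj_on_def doubleton_eq_iff)
    show "(\<lambda>v. {u, v}) ` {v. v < n \<and> {u, v} \<in> E} = {e \<in> E. u \<in> e}"
    proof (intro set_eqI iffI)
      fix e assume "e \<in> {e \<in> E. u \<in> e}"
      then have e: "e \<in> E" "u \<in> e" by auto
      obtain a b where "e = {a, b}" "a < n" "b < n" using graph_edge[OF E e(1)] by metis
      then show "e \<in> (\<lambda>v. {u, v}) ` {v. v < n \<and> {u, v} \<in> E}"
        using e by (auto simp: insert_commute)
    qed auto
  qed
  then show ?thesis unfolding degree_def by (simp add: bij_betw_same_card)
qed

lemma cutconn_degree_pos:
  assumes E: "is_graph n E" and conn: "cutconn E {..<n}" and n: "2 \<le> n" and u: "u < n"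
  shows "0 < degree E u"
proof -
  have "{u} \<noteq> {..<n}"
  proof
    assume "{u} = {..<n}"
    then have "card {u} = card {..<n}" by simp
    then show False using n by simp
  qed
  then obtain y where "y < n" "{u, y} \<in> E" using conn u unfolding cutconn_def by blast
  then have "{v. v < n \<and> {u, v} \<in> E} \<noteq> {}" by auto
  then show ?thesis unfolding degree_neighbours[OF E] by (simp add: card_gt_0_iff)
qed

lemma lazy_chain_graph:
  assumes E: "is_graph n E" and conn: "cutconn E {..<n}" and n: "2 \<le> n"
  shows "lazy_chain {..<n} (trans E) (stationary E)"
proof
  note dp = cutconn_degree_pos[OF E conn n]
  have "0 < (\<Sum>v<n. degree E v)" using dp n by (intro sum_pos) (auto simp: lessThan_empty_iff)
  then have m: "0 < card E" unfolding sum_degree_all[OF E] by simp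
  fix u v assume u: "u \<in> {..<n}"
  show "0 \<le> trans E u v" by (simp add: trans_def)
  show "1/2 \<le> trans E u u" by (simp add: trans_def)
  show "0 < stationary E u" using dp[of u] u m by (simp add: stationary_def)
  show "stationary E u * trans E u v = stationary E v * trans E v u" if "v \<in> {..<n}"
    using dp[of u] dp[of v] u that by (auto simp: trans_def stationary_def insert_commute)
  have "(\<Sum>v<n. trans E u v) = 1/2 + (\<Sum>v<n. if {u, v} \<in> E then 1 / (2 * real (degree E u)) else 0)"
    using u by (simp add: trans_def sum.distrib)
  also have "(\<Sum>v<n. if {u, v} \<in> E then 1 / (2 * real (degree E u)) else 0)
     = real (card {v. v < n \<and> {u, v} \<in> E}) * (1 / (2 * real (degree E u)))"
    by (simp add: sum.If_cases Int_def)
  also have "\<dots> = 1/2" using dp[of u] u unfolding degree_neighbours[OF E, of u, symmetric] by simp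
  finally show "(\<Sum>v\<in>{..<n}. trans E u v) = 1" by simp
next
  have "0 < (\<Sum>v<n. degree E v)" using cutconn_degree_pos[OF E conn n] n by (intro sum_pos) (auto simp: lessThan_empty_iff)
  then have m: "0 < card E" unfolding sum_degree_all[OF E] by simp
  have "(\<Sum>u\<in>{..<n}. stationary E u) = real (\<Sum>v<n. degree E v) / (2 * real (card E))"
    by (simp add: stationary_def sum_divide_distrib)
  then show "(\<Sum>u\<in>{..<n}. stationary E u) = 1" using m unfolding sum_degree_all[OF E] by simp
qed simp

text \<open>\<open>level_sum_bound\<close> for the density f = exits/\<pi> with degrees as weights.
  An edge carries \<pi>(v) P(v,u) = 1/(4m), so unit flow means \<Lambda> = 4m; returning from
  degrees to \<pi> divides by 2m, which leaves the factor 2. The volume restriction is 4/5 of the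
  total volume 2m.\<close>

lemma exits_bound_graph:
  assumes E: "is_graph n E" and conn: "cutconn E {..<n}" and n: "2 \<le> n" and s: "s < n"
    and AL: "0 \<le> A" "0 \<le> L"
    and iso: "\<And>S. S \<subseteq> {..<n} \<Longrightarrow> S \<noteq> {} \<Longrightarrow> cutconn E S \<Longrightarrow> 5 * (\<Sum>v\<in>S. degree E v) \<le> 8 * card E \<Longrightarrow>
       real (\<Sum>v\<in>S. degree E v) \<le> A * real (card (boundary E S)) \<or> real (\<Sum>v\<in>S. degree E v) \<le> L"
  shows "(\<Sum>v<n. lazy_chain.exits {..<n} (trans E) (stationary E) (5/4) s t v)
      \<le> 2 * (A * (1 + A) * ln (1 + real (card E)) + L * L)"
proof -
  interpret lazy_chain "{..<n}" "trans E" "stationary E" by (rule lazy_chain_graph[OF E conn n])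
  note dp = cutconn_degree_pos[OF E conn n]
  define m where "m = real (card E)"
  have "0 < (\<Sum>v<n. degree E v)" using dp n by (intro sum_pos) (auto simp: lessThan_empty_iff)
  then have m: "0 < m" unfolding sum_degree_all[OF E] m_def by simp
  define x where "x = exits (5/4) s t"
  define f where "f = (\<lambda>v. x v / stationary E v)"
  define lo hi where "lo = (\<lambda>e. Min (f ` e))" and "hi = (\<lambda>e. Max (f ` e))"
  note fE = finite_graph[OF E]
  have f0: "0 \<le> f v" if "v < n" for v
    using exits_nonneg mu_pos[of v] that by (simp add: f_def x_def less_imp_le)
  have lohi: "lo {u, v} = min (f u) (f v)" "hi {u, v} = max (f u) (f v)" for u v
    by (auto simp: lo_def hi_def)
  define lev where "lev = (\<lambda>c. {v. v < n \<and> c < f v})"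
  have xpos: "0 < x v" if "v \<in> lev c" "0 \<le> c" for v c
  proof -
    have "0 < x v / stationary E v" "0 < stationary E v" using that mu_pos[of v] by (auto simp: lev_def f_def)
    then show ?thesis by (auto simp: zero_less_divide_iff)
  qed
  have bdry: "{e \<in> E. lo e \<le> c \<and> c < hi e} = boundary E (lev c)" if "0 \<le> c" for c
  proof (intro set_eqI)
    fix e
    show "e \<in> {e \<in> E. lo e \<le> c \<and> c < hi e} \<longleftrightarrow> e \<in> boundary E (lev c)"
    proof (cases "e \<in> E")
      case True
      then obtain u v where "e = {u, v}" "u \<noteq> v" "u < n" "v < n" using graph_edge[OF E] by metis
      then show ?thesis by (auto simp: boundary_def lohi lev_def)
    qed (auto simp: boundary_def)
  qed
  have climb: "\<exists>u<n. {v, u} \<in> E \<and> f v < f u" if v: "v \<in> lev c" "v \<noteq> s" "0 \<le> c" for v c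
  proof -
    have "\<exists>u\<in>{..<n}. 0 < trans E v u \<and> f v < f u"
      unfolding f_def x_def by (rule exits_climb) (use v xpos[OF v(1,3)] in \<open>auto simp: lev_def x_def\<close>)
    then show ?thesis by (auto simp: trans_def split: if_splits)
  qed
  have cc: "cutconn E (lev c)" if c: "0 \<le> c" for c
    unfolding cutconn_def
  proof (intro allI impI)
    fix U assume U: "U \<subseteq> lev c \<and> U \<noteq> {} \<and> U \<noteq> lev c"
    \<comment> \<open>The side of the cut that avoids s: climbing from its highest vertex must leave
      W, yet stays inside the level set.\<close>
    define W where "W = (if s \<in> U then lev c - U else U)"
    have W: "W \<subseteq> lev c" "W \<noteq> {}" "s \<notin> W" using U by (auto simp: W_def)
    have fW: "finite W" using W(1) by (rule finite_subset) (simp add: lev_def)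
    have "Max (f ` W) \<in> f ` W" using W fW by (intro Max_in) auto
    then obtain v where v: "v \<in> W" "f v = Max (f ` W)" by force
    obtain u where u: "u < n" "{v, u} \<in> E" "f v < f u" using climb[of v c] v W c by blast
    have "u \<in> lev c" using u v W by (auto simp: lev_def)
    moreover have "u \<notin> W"
    proof
      assume "u \<in> W"
      then have "f u \<le> Max (f ` W)" using fW by simp
      then show False using u v by simp
    qed
    ultimately show "\<exists>x\<in>U. \<exists>y\<in>lev c - U. {x, y} \<in> E"
    proof (cases "s \<in> U")
      case True
      then have WU: "W = lev c - U" by (simp add: W_def)
      have "u \<in> U" "v \<in> lev c - U" using \<open>u \<in> lev c\<close> \<open>u \<notin> W\<close> v(1) unfolding WU by blast+
      moreover have "{u, v} \<in> E" using u(2) by (metis insert_commute)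
      ultimately show ?thesis by (intro bexI[of _ u] bexI[of _ v])
    next
      case False
      then have WU: "W = U" by (simp add: W_def)
      have "v \<in> U" "u \<in> lev c - U" using \<open>u \<in> lev c\<close> \<open>u \<notin> W\<close> v(1) unfolding WU by blast+
      then show ?thesis using u(2) by (intro bexI[of _ v] bexI[of _ u])
    qed
  qed
  have volume: "5 * (\<Sum>v\<in>lev c. degree E v) \<le> 8 * card E" if c: "0 \<le> c" for c
  proof -
    have "(5/4) * (\<Sum>v\<in>lev c. stationary E v) \<le> (5/4) * (\<Sum>v\<in>{v\<in>{..<n}. 0 < exits (5/4) s t v}. stationary E v)"
      by (intro mult_left_mono sum_mono2) (use xpos[OF _ c] mu_pos in \<open>auto simp: lev_def x_def less_imp_le\<close>)
    also have "\<dots> \<le> 1" by (rule exits_support) (use s in auto)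
    also have "(\<Sum>v\<in>lev c. stationary E v) = real (\<Sum>v\<in>lev c. degree E v) / (2 * m)"
      by (simp add: stationary_def m_def sum_divide_distrib)
    finally have "5 * real (\<Sum>v\<in>lev c. degree E v) \<le> 8 * m" using m by (simp add: field_simps)
    then have "real (5 * (\<Sum>v\<in>lev c. degree E v)) \<le> real (8 * card E)" by (simp add: m_def)
    then show ?thesis by (simp only: of_nat_le_iff)
  qed
  have flow: "(\<Sum>e\<in>boundary E (lev c). hi e - lo e) \<le> 4 * m" if c: "0 \<le> c" for c
  proof -
    let ?Q = "{(v, u). v \<in> lev c \<and> u \<in> {..<n} - lev c \<and> {v, u} \<in> E}"
    have bij: "bij_betw (\<lambda>(v, u). {v, u}) ?Q (boundary E (lev c))"
      unfolding bij_betw_def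
    proof
      show "inj_on (\<lambda>(v, u). {v, u}) ?Q" by (auto simp: inj_on_def doubleton_eq_iff)
      show "(\<lambda>(v, u). {v, u}) ` ?Q = boundary E (lev c)"
      proof (intro set_eqI iffI)
        fix e assume e: "e \<in> boundary E (lev c)"
        then have "e \<in> E" by (simp add: boundary_def)
        then obtain u v where uv: "e = {u, v}" "u < n" "v < n" using graph_edge[OF E] by metis
        have vu: "e = {v, u}" using uv(1) by (simp add: insert_commute)
        have "(u, v) \<in> ?Q \<or> (v, u) \<in> ?Q" using e uv vu by (auto simp: boundary_def)
        then show "e \<in> (\<lambda>(v, u). {v, u}) ` ?Q"
        proof
          assume "(u, v) \<in> ?Q" then show ?thesis using uv(1) by (intro image_eqI[of _ _ "(u, v)"]) simp_all
        next
          assume "(v, u) \<in> ?Q" then show ?thesis using vu by (intro image_eqI[of _ _ "(v, u)"]) simp_all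
        qed
      qed (auto simp: boundary_def)
    qed
    have "(\<Sum>e\<in>boundary E (lev c). hi e - lo e) = (\<Sum>(v, u)\<in>?Q. f v - f u)"
      by (subst sum.reindex_bij_betw[OF bij, symmetric], rule sum.cong) (auto simp: lohi lev_def max_def min_def)
    also have "\<dots> = (\<Sum>(v, u)\<in>lev c \<times> ({..<n} - lev c). if {v, u} \<in> E then f v - f u else 0)"
      by (rule sum.mono_neutral_cong_left) (auto simp: lev_def split: if_splits)
    also have "\<dots> = (\<Sum>v\<in>lev c. \<Sum>u\<in>{..<n} - lev c. if {v, u} \<in> E then f v - f u else 0)"
      by (rule sum.cartesian_product[symmetric])
    \<comment> \<open>All edges have the same conductance 1/(4m), whatever the degrees of their
      ends.\<close>
    also have "\<dots> = (\<Sum>v\<in>lev c. \<Sum>u\<in>{..<n} - lev c. 4 * m * (stationary E v * trans E v u * (f v - f u)))"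
    proof (intro sum.cong refl)
      fix v u assume "v \<in> lev c" "u \<in> {..<n} - lev c"
      then have "v \<noteq> u" "0 < degree E v" using dp[of v] by (auto simp: lev_def)
      then show "(if {v, u} \<in> E then f v - f u else 0) = 4 * m * (stationary E v * trans E v u * (f v - f u))"
        using m by (auto simp: trans_def stationary_def m_def)
    qed
    also have "\<dots> = 4 * m * (\<Sum>v\<in>lev c. \<Sum>u\<in>{..<n} - lev c. stationary E v * trans E v u * (f v - f u))"
      by (simp add: sum_distrib_left)
    also have "\<dots> \<le> 4 * m * 1"
    proof (rule mult_left_mono)
      show "(\<Sum>v\<in>lev c. \<Sum>u\<in>{..<n} - lev c. stationary E v * trans E v u * (f v - f u)) \<le> 1"
        unfolding f_def x_def by (rule exits_flow) (use xpos[OF _ c] in \<open>auto simp: lev_def x_def\<close>)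
    qed (use m in simp)
    finally show ?thesis by simp
  qed
  have levV: "lev c \<subseteq> {..<n}" "finite (lev c)" for c by (auto simp: lev_def)
  have "(\<Sum>v\<in>{..<n}. real (degree E v) * f v) \<le> (4 * m) * (A * (1 + A) * ln (1 + real (card E)) + L * L)"
  proof (rule level_sum_bound[where lo = lo and hi = hi])
    fix e assume "e \<in> E"
    then obtain u v where "e = {u, v}" "u < n" "v < n" using graph_edge[OF E] by metis
    then show "hi e \<in> f ` {..<n}" by (auto simp: lohi max_def)
  next
    fix c :: real assume c: "0 \<le> c" "\<exists>v\<in>{..<n}. c < f v"
    have ne: "lev c \<noteq> {}" using c by (auto simp: lev_def)
    have lev_eq: "{v. v \<in> {..<n} \<and> c < f v} = lev c" by (auto simp: lev_def)
    \<comment> \<open>The volume of the whole graph is 2m, above the permitted 8m/5; so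
      connectedness supplies a boundary edge.\<close>
    have ball: "lev c \<noteq> {..<n}"
    proof
      assume "lev c = {..<n}"
      then have "10 * card E \<le> 8 * card E" using volume[OF c(1)] sum_degree_all[OF E] by simp
      then show False using m by (simp add: m_def)
    qed
    obtain x y where "x \<in> lev c" "y \<in> {..<n} - lev c" "{x, y} \<in> E"
      using conn ne ball levV(1)[of c] unfolding cutconn_def by blast
    then have "boundary E (lev c) \<noteq> {}" by (auto simp: boundary_def)
    then show "1 \<le> card {e \<in> E. lo e \<le> c \<and> c < hi e}"
      unfolding bdry[OF c(1)] using fE by (simp add: Suc_le_eq card_gt_0_iff boundary_def)
    show "(\<Sum>e | e \<in> E \<and> lo e \<le> c \<and> c < hi e. hi e - lo e) \<le> 4 * m"
      unfolding bdry[OF c(1)] by (rule flow[OF c(1)])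
    have "{e \<in> E. c < hi e} \<subseteq> inside E (lev c) \<union> boundary E (lev c)"
    proof
      fix e assume e: "e \<in> {e \<in> E. c < hi e}"
      then have "e \<in> E" by simp
      then obtain u v where "e = {u, v}" "u < n" "v < n" using graph_edge[OF E] by metis
      then show "e \<in> inside E (lev c) \<union> boundary E (lev c)"
        using e by (auto simp: lohi lev_def inside_def boundary_def)
    qed
    then have "card {e \<in> E. c < hi e} \<le> card (inside E (lev c) \<union> boundary E (lev c))"
      using fE by (intro card_mono) (auto simp: inside_def boundary_def)
    also have "\<dots> \<le> card (inside E (lev c)) + card (boundary E (lev c))" by (rule card_Un_le)
    also have "\<dots> \<le> (\<Sum>v\<in>lev c. degree E v)" unfolding sum_degree[OF E levV(2)] by simp
    finally have "card {e \<in> E. c < hi e} \<le> (\<Sum>v\<in>lev c. degree E v)" .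
    then have "real (card {e \<in> E. c < hi e}) \<le> real (\<Sum>v\<in>lev c. degree E v)" by (simp only: of_nat_le_iff)
    then show "real (card {e \<in> E. c < hi e}) \<le> (\<Sum>v | v \<in> {..<n} \<and> c < f v. real (degree E v))"
      unfolding lev_eq by simp
    show "(\<Sum>v | v \<in> {..<n} \<and> c < f v. real (degree E v)) \<le> A * real (card {e \<in> E. lo e \<le> c \<and> c < hi e}) \<or>
          (\<Sum>v | v \<in> {..<n} \<and> c < f v. real (degree E v)) \<le> L"
      unfolding bdry[OF c(1)] lev_eq using iso[OF levV(1) ne cc volume] c(1) by simp
  qed (use fE AL m f0 in auto)
  moreover have "(\<Sum>v\<in>{..<n}. x v) = (1 / (2 * m)) * (\<Sum>v\<in>{..<n}. real (degree E v) * f v)"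
    unfolding sum_distrib_left
  proof (rule sum.cong)
    fix v assume "v \<in> {..<n}"
    then show "x v = 1 / (2 * m) * (real (degree E v) * f v)"
      using dp[of v] m by (simp add: f_def stationary_def m_def)
  qed simp
  ultimately have "(\<Sum>v\<in>{..<n}. x v) \<le> (1 / (2 * m)) * ((4 * m) * (A * (1 + A) * ln (1 + real (card E)) + L * L))"
    using m by (simp only: mult_left_mono divide_nonneg_nonneg less_imp_le mult_nonneg_nonneg zero_le_numeral zero_le_one)
  also have "\<dots> = 2 * (A * (1 + A) * ln (1 + real (card E)) + L * L)" using m by simp
  finally show ?thesis by (simp add: x_def)
qed

section \<open>Connected sets in a union of two graphs\<close>

lemma cutconn_mono: "cutconn E S \<Longrightarrow> E \<subseteq> E' \<Longrightarrow> cutconn E' S"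
  unfolding cutconn_def by blast

lemma cutconnD:
  assumes "cutconn E S" "U \<subseteq> S" "U \<noteq> {}" "U \<noteq> S"
  obtains x y where "x \<in> U" "y \<in> S - U" "{x, y} \<in> E"
  using assms unfolding cutconn_def by blast

lemma cutconn_inside: "cutconn (inside E S) S \<longleftrightarrow> cutconn E S"
proof
  show "cutconn (inside E S) S \<Longrightarrow> cutconn E S" by (rule cutconn_mono) (auto simp: inside_def)
  assume c: "cutconn E S"
  show "cutconn (inside E S) S" unfolding cutconn_def
  proof (intro allI impI)
    fix U assume U: "U \<subseteq> S \<and> U \<noteq> {} \<and> U \<noteq> S"
    then obtain x y where "x \<in> U" "y \<in> S - U" "{x, y} \<in> E" using cutconnD[OF c, of U] by blast
    then show "\<exists>x\<in>U. \<exists>y\<in>S - U. {x, y} \<in> inside E S" using U by (auto simp: inside_def)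
  qed
qed

lemma cutconn_Un:
  assumes U: "cutconn E U" and W: "cutconn E W" and xy: "x \<in> U" "y \<in> W" "{x, y} \<in> E" and dj: "U \<inter> W = {}"
  shows "cutconn E (U \<union> W)"
  unfolding cutconn_def
proof (intro allI impI)
  fix T assume T: "T \<subseteq> U \<union> W \<and> T \<noteq> {} \<and> T \<noteq> U \<union> W"
  consider "T \<inter> U \<noteq> {}" "T \<inter> U \<noteq> U" | "T \<inter> W \<noteq> {}" "T \<inter> W \<noteq> W" | "T = U" | "T = W"
    using T by blast
  then show "\<exists>x\<in>T. \<exists>y\<in>U \<union> W - T. {x, y} \<in> E"
  proof cases
    case 1
    obtain x y where "x \<in> T \<inter> U" "y \<in> U - T \<inter> U" "{x, y} \<in> E"
      by (rule cutconnD[OF U, of "T \<inter> U"]) (use 1 in auto)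
    then show ?thesis by blast
  next
    case 2
    obtain x y where "x \<in> T \<inter> W" "y \<in> W - T \<inter> W" "{x, y} \<in> E"
      by (rule cutconnD[OF W, of "T \<inter> W"]) (use 2 in auto)
    then show ?thesis by blast
  next
    case 3 then show ?thesis using xy dj by blast
  next
    case 4
    have "{y, x} \<in> E" using xy(3) by (simp add: insert_commute)
    then show ?thesis using xy dj 4 by blast
  qed
qed

text \<open>For \<open>W \<subseteq> S\<close>: W is a union of components of the graph that G
  induces on S.\<close>

definition closed_in :: "nat set set \<Rightarrow> nat set \<Rightarrow> nat set \<Rightarrow> bool" where
  "closed_in G S W \<longleftrightarrow> (\<forall>x\<in>W. \<forall>y\<in>S - W. {x, y} \<notin> G)"

text \<open>A minimal closed set around y is its component. An edge of G leaving it cannot end in S,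
  so it is a boundary edge of S; its only end in S lies in this component, so distinct components
  own distinct boundary edges.\<close>

lemma component_exists:
  assumes S: "finite S" and W0: "W0 \<subseteq> S" "y \<in> W0" "closed_in G S W0"
    and leave: "\<And>U. U \<subseteq> S \<Longrightarrow> U \<noteq> {} \<Longrightarrow> \<exists>x\<in>U. \<exists>z. z \<notin> U \<and> {x, z} \<in> G"
  obtains W e where "W \<subseteq> W0" "y \<in> W" "closed_in G S W" "cutconn G W"
    "e \<in> boundary G S" "e \<inter> S \<subseteq> W" "e \<inter> W \<noteq> {}"
proof -
  let ?P = "\<lambda>W. W \<subseteq> W0 \<and> y \<in> W \<and> closed_in G S W"
  obtain W where W: "?P W" and min: "\<And>W'. ?P W' \<Longrightarrow> card W \<le> card W'"
    using ex_has_least_nat[of ?P W0 card] W0 by blast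
  have fin: "finite W" using W W0 S by (meson finite_subset)
  have small: "\<not> closed_in G S T" if "T \<subset> W" "y \<in> T" for T
    using min[of T] psubset_card_mono[OF fin that(1)] that W by auto
  have "cutconn G W" unfolding cutconn_def
  proof (intro allI impI)
    fix U assume U: "U \<subseteq> W \<and> U \<noteq> {} \<and> U \<noteq> W"
    show "\<exists>x\<in>U. \<exists>y\<in>W - U. {x, y} \<in> G"
    proof (cases "y \<in> U")
      case True
      then obtain a b where "a \<in> U" "b \<in> S - U" "{a, b} \<in> G"
        using small[of U] U unfolding closed_in_def by blast
      then show ?thesis using W U unfolding closed_in_def by blast
    next
      case False
      then have "W - U \<subset> W" "y \<in> W - U" using U W by auto
      then obtain a b where ab: "a \<in> W - U" "b \<in> S - (W - U)" "{a, b} \<in> G"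
        using small[of "W - U"] unfolding closed_in_def by blast
      then have "b \<in> U" using W U unfolding closed_in_def by blast
      then show ?thesis using ab by (metis insert_commute)
    qed
  qed
  obtain a b where ab: "a \<in> W" "b \<notin> W" "{a, b} \<in> G" using leave[of W] W W0 by blast
  then have "b \<notin> S" using W unfolding closed_in_def by blast
  moreover have "a \<in> S" using ab W W0 by blast
  ultimately have "{a, b} \<in> boundary G S" "{a, b} \<inter> S \<subseteq> W" "{a, b} \<inter> W \<noteq> {}"
    using ab by (auto simp: boundary_def)
  then show ?thesis using that[of W "{a, b}"] W \<open>cutconn G W\<close> by blast
qed

text \<open>The components of \<open>S\<close> in \<open>G\<close> are joined one at a time, each bringing at least one new boundary edge of \<open>G\<close>.\<close>

lemma few_extra_edges:
  assumes S: "finite S" "S \<noteq> {}" and fb: "finite (boundary G S)"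
    and leave: "\<And>U. U \<subseteq> S \<Longrightarrow> U \<noteq> {} \<Longrightarrow> \<exists>x\<in>U. \<exists>z. z \<notin> U \<and> {x, z} \<in> G"
    and conn: "cutconn (G \<union> C) S"
  obtains C' where "C' \<subseteq> C" "finite C'" "card C' \<le> card (boundary G S)" "cutconn (G \<union> C') S"
proof -
  define bb where "bb = (\<lambda>U. {e \<in> boundary G S. e \<inter> U \<noteq> {}})"
  have fbb: "finite (bb U)" for U using fb by (simp add: bb_def)
  \<comment> \<open>The invariant compares the edges of C used so far with the boundary edges
    touching U. It is strict from the start, since the first component needs no edge of C but owns a
    boundary edge.\<close>
  have main: "\<exists>C''. C'' \<subseteq> C \<and> finite C'' \<and> card C'' < card (boundary G S) \<and> cutconn (G \<union> C'') S"
    if "U \<subseteq> S" "U \<noteq> {}" "closed_in G S U" "C' \<subseteq> C" "finite C'" "cutconn (G \<union> C') U" "card C' < card (bb U)" for U C'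
    using that
  proof (induction "card (S - U)" arbitrary: U C' rule: less_induct)
    case less
    note prems = less.prems
    show ?case
    proof (cases "U = S")
      case True
      have "card (bb U) \<le> card (boundary G S)" using fb by (intro card_mono) (auto simp: bb_def)
      then show ?thesis using prems True by (intro exI[of _ C']) auto
    next
      case False
      then obtain x y where xy: "x \<in> U" "y \<in> S - U" "{x, y} \<in> G \<union> C"
        using cutconnD[OF conn prems(1,2)] by blast
      have "{x, y} \<in> C" using xy prems(3) unfolding closed_in_def by blast
      have "closed_in G S (S - U)" using prems(1,3) unfolding closed_in_def
        by (metis DiffD1 DiffD2 DiffI insert_commute)
      from component_exists[OF S(1) _ xy(2) this leave]
      obtain W e where W: "W \<subseteq> S - U" "y \<in> W" "closed_in G S W" "cutconn G W"
        and e: "e \<in> boundary G S" "e \<inter> S \<subseteq> W" "e \<inter> W \<noteq> {}" by blast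
      let ?C = "insert {x, y} C'"
      have "card (S - (U \<union> W)) < card (S - U)"
        by (rule psubset_card_mono) (use S W xy in auto)
      moreover have "closed_in G S (U \<union> W)" using prems(3) W(3) unfolding closed_in_def by blast
      moreover have "cutconn (G \<union> ?C) (U \<union> W)"
        by (rule cutconn_Un[OF cutconn_mono[OF prems(6)] cutconn_mono[OF W(4)] xy(1) W(2)]) (use W in auto)
      moreover have "card ?C < card (bb (U \<union> W))"
      proof -
        have "e \<notin> bb U" using e W prems(1) by (auto simp: bb_def)
        moreover have "insert e (bb U) \<subseteq> bb (U \<union> W)" using e by (auto simp: bb_def)
        ultimately have "Suc (card (bb U)) \<le> card (bb (U \<union> W))"
          using card_mono[OF fbb] fbb by (metis card_insert_disjoint)
        then show ?thesis using prems(5,7) card_insert_le_m1[of "Suc (card C')"] by (simp add: card_insert_if)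
      qed
      ultimately show ?thesis
        using less.hyps[of "U \<union> W" ?C] prems W(1) \<open>{x, y} \<in> C\<close> by auto
    qed
  qed
  obtain y where y: "y \<in> S" using S by blast
  have "closed_in G S S" by (simp add: closed_in_def)
  from component_exists[OF S(1) _ y this leave]
  obtain W e where W: "W \<subseteq> S" "y \<in> W" "closed_in G S W" "cutconn G W"
    and e: "e \<in> boundary G S" "e \<inter> S \<subseteq> W" "e \<inter> W \<noteq> {}" by blast
  have "e \<in> bb W" using e by (simp add: bb_def)
  then have "0 < card (bb W)" using fbb card_gt_0_iff by blast
  then show ?thesis using main[of W "{}"] W that by (auto intro: less_imp_le)
qed

text \<open>Vertices are peeled off one by one, each of degree at most D in the subgraph induced on
  those left.\<close>

lemma card_inside_degenerate:
  assumes E: "is_graph n E" and deg: "degenerate D n E" and S: "S \<subseteq> {..<n}"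
  shows "card (inside E S) \<le> D * card S"
proof -
  have "finite S" using S finite_subset by blast
  then show ?thesis using S
  proof (induction "card S" arbitrary: S)
    case 0
    have "inside E {} = {}" using E by (auto simp: inside_def is_graph_def all_pairs_def)
    then show ?case using 0 by simp
  next
    case (Suc k)
    have "S \<noteq> {}" using Suc by auto
    moreover have "inside E S \<subseteq> E" "\<forall>e\<in>inside E S. e \<subseteq> S" by (auto simp: inside_def)
    ultimately obtain v where v: "v \<in> S" "degree (inside E S) v \<le> D"
      using deg Suc.prems unfolding degenerate_def by blast
    have ck: "card (S - {v}) = k" using v(1) Suc.hyps(2) Suc.prems(1) by simp
    have "inside E S = inside E (S - {v}) \<union> {e \<in> inside E S. v \<in> e}" by (auto simp: inside_def)
    then have "card (inside E S) \<le> card (inside E (S - {v})) + degree (inside E S) v"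
      unfolding degree_def by (metis card_Un_le)
    also have "\<dots> \<le> D * card (S - {v}) + D"
      using Suc.hyps(1)[of "S - {v}"] ck Suc.prems v by (intro add_mono) auto
    also have "\<dots> = D * card S" using ck Suc.hyps(2) by (metis mult_Suc_right add.commute)
    finally show ?case .
  qed
qed

section \<open>Random edge sets\<close>

text \<open>Weights of an inhomogeneous random subset of \<open>X\<close>. The summands \<open>a e\<close> and \<open>b e\<close> need not add up to 1, so
  that exponential moments can be absorbed into \<open>a\<close>.\<close>

definition wt :: "'e set \<Rightarrow> ('e \<Rightarrow> real) \<Rightarrow> ('e \<Rightarrow> real) \<Rightarrow> 'e set \<Rightarrow> real" where
  "wt X a b R = (\<Prod>e\<in>R. a e) * (\<Prod>e\<in>X - R. b e)"

lemma sum_Pow_insert: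
  assumes "finite X" "x \<notin> X"
  shows "(\<Sum>R\<in>Pow (insert x X). g R) = (\<Sum>R\<in>Pow X. g R) + (\<Sum>R\<in>Pow X. g (insert x R))"
proof -
  have "inj_on (insert x) (Pow X)" using assms by (auto simp: inj_on_def)
  moreover have "Pow X \<inter> insert x ` Pow X = {}" using assms by auto
  ultimately show ?thesis using assms unfolding Pow_insert
    by (simp add: sum.union_disjoint sum.reindex)
qed

lemma wt_insert:
  assumes "finite X" "x \<notin> X" "R \<subseteq> X"
  shows "wt (insert x X) a b R = b x * wt X a b R" "wt (insert x X) a b (insert x R) = a x * wt X a b R"
proof -
  have f: "finite R" "x \<notin> R" using assms finite_subset by auto
  have "insert x X - R = insert x (X - R)" "insert x X - insert x R = X - R" using assms by auto
  then show "wt (insert x X) a b R = b x * wt X a b R" "wt (insert x X) a b (insert x R) = a x * wt X a b R"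
    using assms f by (auto simp: wt_def)
qed

lemma sum_wt: "finite X \<Longrightarrow> (\<Sum>R\<in>Pow X. wt X a b R) = (\<Prod>e\<in>X. a e + b e)"
proof (induction X rule: finite_induct)
  case (insert x X)
  then show ?case
    by (simp add: sum_Pow_insert wt_insert distrib_right flip: sum_distrib_left)
qed (simp add: wt_def)

lemma wt_nonneg: "(\<And>e. e \<in> X \<Longrightarrow> 0 \<le> a e \<and> 0 \<le> b e) \<Longrightarrow> R \<subseteq> X \<Longrightarrow> 0 \<le> wt X a b R"
  unfolding wt_def by (intro mult_nonneg_nonneg prod_nonneg) auto

text \<open>Independence of the parts of the random set in X and in Y.\<close>

lemma sum_Pow_Un:
  assumes "finite X" "finite Y" "X \<inter> Y = {}"
  shows "(\<Sum>R\<in>Pow (X \<union> Y). wt (X \<union> Y) a b R * g (R \<inter> X) * h (R \<inter> Y))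
      = (\<Sum>R\<in>Pow X. wt X a b R * g R) * (\<Sum>R\<in>Pow Y. wt Y a b R * h R)"
proof -
  have bij: "bij_betw (\<lambda>(A, B). A \<union> B) (Pow X \<times> Pow Y) (Pow (X \<union> Y))"
    by (rule bij_betw_byWitness[where f' = "\<lambda>R. (R \<inter> X, R \<inter> Y)"]) (use assms in auto)
  have "(\<Sum>R\<in>Pow (X \<union> Y). wt (X \<union> Y) a b R * g (R \<inter> X) * h (R \<inter> Y))
      = (\<Sum>(A, B)\<in>Pow X \<times> Pow Y. (wt X a b A * g A) * (wt Y a b B * h B))"
    unfolding sum.reindex_bij_betw[OF bij, symmetric]
  proof (rule sum.cong)
    fix z assume "z \<in> Pow X \<times> Pow Y"
    then obtain A B where z: "z = (A, B)" "A \<subseteq> X" "B \<subseteq> Y" by auto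
    have 1: "(A \<union> B) \<inter> X = A" "(A \<union> B) \<inter> Y = B" using z assms by auto
    have 2: "(X \<union> Y) - (A \<union> B) = (X - A) \<union> (Y - B)" using z assms by auto
    have 3: "(\<Prod>e\<in>A \<union> B. a e) = (\<Prod>e\<in>A. a e) * (\<Prod>e\<in>B. a e)"
      by (rule prod.union_disjoint) (use z assms finite_subset in auto)
    have 4: "(\<Prod>e\<in>(X - A) \<union> (Y - B). b e) = (\<Prod>e\<in>X - A. b e) * (\<Prod>e\<in>Y - B. b e)"
      by (rule prod.union_disjoint) (use z assms in auto)
    show "wt (X \<union> Y) a b (case z of (A, B) \<Rightarrow> A \<union> B) * g ((case z of (A, B) \<Rightarrow> A \<union> B) \<inter> X)
         * h ((case z of (A, B) \<Rightarrow> A \<union> B) \<inter> Y) = (case z of (A, B) \<Rightarrow> (wt X a b A * g A) * (wt Y a b B * h B))"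
      unfolding z(1) case_prod_conv 1 by (simp add: wt_def 2 3 4)
  qed simp
  also have "\<dots> = (\<Sum>A\<in>Pow X. \<Sum>B\<in>Pow Y. (wt X a b A * g A) * (wt Y a b B * h B))"
    by (rule sum.cartesian_product[symmetric])
  also have "\<dots> = (\<Sum>R\<in>Pow X. wt X a b R * g R) * (\<Sum>R\<in>Pow Y. wt Y a b R * h R)"
    by (rule sum_product[symmetric])
  finally show ?thesis .
qed

text \<open>The factor (1/2)^|C| is the uniform law on subsets of C: a p-random set, each element of
  which survives a fair coin, is a p/2-random set.\<close>

lemma thinning_identity:
  assumes "finite K"
  shows "(\<Sum>C\<in>Pow K. wt K (\<lambda>_. p) (\<lambda>_. 1 - p) C * (\<Sum>B\<in>Pow C. (1/2) ^ card C * h B))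
     = (\<Sum>B\<in>Pow K. wt K (\<lambda>_. p / 2) (\<lambda>_. 1 - p / 2) B * h B)"
  using assms
proof (induction K arbitrary: h rule: finite_induct)
  case empty
  then show ?case by (simp add: wt_def)
next
  case (insert x K)
  let ?w = "wt K (\<lambda>_. p) (\<lambda>_. 1 - p)"
  let ?T = "\<lambda>h. (\<Sum>C\<in>Pow K. ?w C * (\<Sum>B\<in>Pow C. (1/2) ^ card C * h B))"
  have "(\<Sum>C\<in>Pow (insert x K). wt (insert x K) (\<lambda>_. p) (\<lambda>_. 1 - p) C * (\<Sum>B\<in>Pow C. (1/2) ^ card C * h B))
     = (\<Sum>C\<in>Pow K. (1 - p) * (?w C * (\<Sum>B\<in>Pow C. (1/2) ^ card C * h B)))
     + (\<Sum>C\<in>Pow K. (p / 2) * (?w C * (\<Sum>B\<in>Pow C. (1/2) ^ card C * h B) + ?w C * (\<Sum>B\<in>Pow C. (1/2) ^ card C * h (insert x B))))"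
    unfolding sum_Pow_insert[OF insert.hyps]
  proof (intro arg_cong2[of _ _ _ _ "(+)"] sum.cong refl)
    fix C assume C: "C \<in> Pow K"
    then have f: "finite C" "x \<notin> C" using insert.hyps finite_subset by auto
    show "wt (insert x K) (\<lambda>_. p) (\<lambda>_. 1 - p) C * (\<Sum>B\<in>Pow C. (1/2) ^ card C * h B)
      = (1 - p) * (?w C * (\<Sum>B\<in>Pow C. (1/2) ^ card C * h B))"
      using C insert.hyps by (simp add: wt_insert)
    show "wt (insert x K) (\<lambda>_. p) (\<lambda>_. 1 - p) (insert x C) * (\<Sum>B\<in>Pow (insert x C). (1/2) ^ card (insert x C) * h B)
      = (p / 2) * (?w C * (\<Sum>B\<in>Pow C. (1/2) ^ card C * h B) + ?w C * (\<Sum>B\<in>Pow C. (1/2) ^ card C * h (insert x B)))"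
    proof -
      have half: "(\<Sum>B\<in>Pow C. (1/2) ^ Suc (card C) * g B) = (1/2) * (\<Sum>B\<in>Pow C. (1/2) ^ card C * g B)" for g :: "'a set \<Rightarrow> real"
        by (simp add: sum_distrib_left)
      show ?thesis
        using C insert.hyps f by (simp add: wt_insert sum_Pow_insert distrib_left half del: power_Suc)
    qed
  qed
  also have "\<dots> = (1 - p) * ?T h + (p / 2) * (?T h + ?T (\<lambda>B. h (insert x B)))"
    by (simp add: sum_distrib_left sum.distrib distrib_left)
  also have "\<dots> = (1 - p / 2) * ?T h + (p / 2) * ?T (\<lambda>B. h (insert x B))"
    by (simp add: field_simps)
  also have "\<dots> = (\<Sum>B\<in>Pow (insert x K). wt (insert x K) (\<lambda>_. p / 2) (\<lambda>_. 1 - p / 2) B * h B)"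
    unfolding insert.IH sum_Pow_insert[OF insert.hyps]
    using insert.hyps by (simp add: wt_insert sum_distrib_left mult.assoc)
  finally show ?case .
qed

text \<open>Given a set with property M, all elements of a witness of size at most b survive the
  coins with probability at least 2^(-b), and M is increasing.\<close>

lemma thinning:
  assumes K: "finite K" and p: "0 \<le> p" "p \<le> 1"
    and up: "\<And>A B. A \<subseteq> B \<Longrightarrow> B \<subseteq> K \<Longrightarrow> M A \<Longrightarrow> M B"
    and small: "\<And>C. C \<subseteq> K \<Longrightarrow> M C \<Longrightarrow> \<exists>C'\<subseteq>C. M C' \<and> card C' \<le> b"
  shows "(\<Sum>C\<in>Pow K. wt K (\<lambda>_. p) (\<lambda>_. 1 - p) C * of_bool (M C))
     \<le> 2 ^ b * (\<Sum>C\<in>Pow K. wt K (\<lambda>_. p / 2) (\<lambda>_. 1 - p / 2) C * of_bool (M C))"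
proof -
  have ge: "of_bool (M C) \<le> 2 ^ b * (\<Sum>B\<in>Pow C. (1/2) ^ card C * of_bool (M B) :: real)" if C: "C \<subseteq> K" for C
  proof (cases "M C")
    case True
    from small[OF C this] obtain C' where C': "C' \<subseteq> C" "M C'" "card C' \<le> b" by blast
    have fC: "finite C" using C K finite_subset by blast
    have inj: "inj_on (\<lambda>A. C' \<union> A) (Pow (C - C'))" by (auto simp: inj_on_def)
    have "(2::real) ^ card (C - C') = (\<Sum>B\<in>(\<lambda>A. C' \<union> A) ` Pow (C - C'). 1)"
      using fC by (simp add: card_image[OF inj] card_Pow)
    also have "\<dots> \<le> (\<Sum>B\<in>Pow C. of_bool (M B))"
    proof (rule order.trans[OF sum_mono sum_mono2])
      fix B assume "B \<in> (\<lambda>A. C' \<union> A) ` Pow (C - C')"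
      then have "C' \<subseteq> B" "B \<subseteq> C" using C' by auto
      then have "M B" using up[of C' B] C C' by auto
      then show "1 \<le> (of_bool (M B) :: real)" by simp
    qed (use fC C' in auto)
    finally have 1: "(2::real) ^ card (C - C') \<le> (\<Sum>B\<in>Pow C. of_bool (M B))" .
    have "card C = card (C - C') + card C'"
      using fC C' by (metis card_Diff_subset card_mono finite_subset le_add_diff_inverse2)
    then have "(2::real) ^ card C \<le> 2 ^ b * 2 ^ card (C - C')"
      using C'(3) by (simp flip: power_add)
    also have "\<dots> \<le> 2 ^ b * (\<Sum>B\<in>Pow C. of_bool (M B))" using 1 by simp
    finally have "1 \<le> (1/2) ^ card C * (2 ^ b * (\<Sum>B\<in>Pow C. of_bool (M B) :: real))"
      by (simp add: power_divide field_simps)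
    then show ?thesis using True by (simp add: mult.left_commute flip: sum_distrib_left)
  qed (auto intro!: sum_nonneg mult_nonneg_nonneg)
  have "(\<Sum>C\<in>Pow K. wt K (\<lambda>_. p) (\<lambda>_. 1 - p) C * of_bool (M C))
     \<le> (\<Sum>C\<in>Pow K. wt K (\<lambda>_. p) (\<lambda>_. 1 - p) C * (2 ^ b * (\<Sum>B\<in>Pow C. (1/2) ^ card C * of_bool (M B))))"
    by (intro sum_mono mult_left_mono ge wt_nonneg) (use p in auto)
  also have "\<dots> = 2 ^ b * (\<Sum>C\<in>Pow K. wt K (\<lambda>_. p) (\<lambda>_. 1 - p) C * (\<Sum>B\<in>Pow C. (1/2) ^ card C * of_bool (M B)))"
    unfolding sum_distrib_left[of "2 ^ b" _ "Pow K"] by (intro sum.cong refl mult.left_commute)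
  also have "\<dots> = 2 ^ b * (\<Sum>C\<in>Pow K. wt K (\<lambda>_. p / 2) (\<lambda>_. 1 - p / 2) C * of_bool (M C))"
    by (subst thinning_identity[OF K]) simp
  finally show ?thesis .
qed

section \<open>Comparison with percolation clusters\<close>

lemma cluster_unique:
  assumes "cutconn R S" "boundary R S = {}" "cutconn R S'" "boundary R S' = {}" "v \<in> S" "v \<in> S'"
  shows "S = S'"
proof -
  have *: "S \<subseteq> S'" if c: "cutconn R S" "boundary R S' = {}" "v \<in> S" "v \<in> S'" for S S'
  proof (rule ccontr)
    assume "\<not> S \<subseteq> S'"
    then obtain x y where "x \<in> S \<inter> S'" "y \<in> S - S \<inter> S'" "{x, y} \<in> R"
      using cutconnD[OF c(1), of "S \<inter> S'"] c by blast
    then have "{x, y} \<in> boundary R S'" by (auto simp: boundary_def)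
    then show False using c by simp
  qed
  show ?thesis using *[of S S'] *[of S' S] assms by auto
qed

text \<open>Pointwise in R at most one S is the component of v. This takes the place of a count of
  connected sets in the union bound.\<close>

lemma cluster_sum_le:
  assumes X: "finite X" and r: "\<And>e. e \<in> X \<Longrightarrow> 0 \<le> r e \<and> r e \<le> 1"
  shows "(\<Sum>S | S \<subseteq> {..<n} \<and> v \<in> S. \<Sum>R\<in>Pow X. wt X r (\<lambda>e. 1 - r e) R * of_bool (cutconn R S \<and> boundary R S = {})) \<le> 1"
proof -
  let ?F = "{S. S \<subseteq> {..<n} \<and> v \<in> S}"
  have fin: "finite ?F" by (rule finite_subset[of _ "Pow {..<n}"]) auto
  have "(\<Sum>S\<in>?F. \<Sum>R\<in>Pow X. wt X r (\<lambda>e. 1 - r e) R * of_bool (cutconn R S \<and> boundary R S = {}))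
     = (\<Sum>R\<in>Pow X. wt X r (\<lambda>e. 1 - r e) R * (\<Sum>S\<in>?F. of_bool (cutconn R S \<and> boundary R S = {})))"
    unfolding sum_distrib_left by (rule sum.swap)
  also have "\<dots> \<le> (\<Sum>R\<in>Pow X. wt X r (\<lambda>e. 1 - r e) R * 1)"
  proof (intro sum_mono mult_left_mono)
    fix R assume "R \<in> Pow X"
    have "(\<Sum>S\<in>?F. of_bool (cutconn R S \<and> boundary R S = {}) :: real)
        = real (card {S \<in> ?F. cutconn R S \<and> boundary R S = {}})"
      using fin by (simp add: sum.If_cases of_bool_def Int_def)
    also have "card {S \<in> ?F. cutconn R S \<and> boundary R S = {}} \<le> Suc 0"
      using fin cluster_unique[of R _ _ v] by (subst card_le_Suc0_iff_eq) auto
    finally show "(\<Sum>S\<in>?F. of_bool (cutconn R S \<and> boundary R S = {}) :: real) \<le> 1" by simp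
  qed (use r in \<open>auto intro!: wt_nonneg\<close>)
  also have "\<dots> = 1" using X by (simp add: sum_wt)
  finally show ?thesis .
qed

lemma card_boundary_all_pairs:
  assumes S: "S \<subseteq> {..<n}"
  shows "card S * (n - card S) \<le> card (boundary (all_pairs n) S)"
proof -
  have fS: "finite S" using S finite_subset by blast
  have "inj_on (\<lambda>(u, v). {u, v}) (S \<times> ({..<n} - S))"
    by (auto simp: inj_on_def doubleton_eq_iff)
  then have "card ((\<lambda>(u, v). {u, v}) ` (S \<times> ({..<n} - S))) = card S * (n - card S)"
    using fS S by (simp add: card_image card_cartesian_product card_Diff_subset)
  moreover have "(\<lambda>(u, v). {u, v}) ` (S \<times> ({..<n} - S)) \<subseteq> boundary (all_pairs n) S"
    using S by (auto simp: boundary_def all_pairs_def card_2_iff)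
  ultimately show ?thesis
    using card_mono[of "boundary (all_pairs n) S" "(\<lambda>(u, v). {u, v}) ` (S \<times> ({..<n} - S))"]
      finite_all_pairs by (simp add: boundary_def)
qed

lemma cutconn_cong_inside: "inside E S = inside E' S \<Longrightarrow> cutconn E S = cutconn E' S"
  by (metis cutconn_inside)

text \<open>A multiplicative functional is absorbed into the weights; this covers exponential
  moments as well as avoidance events, where some weights become 0.\<close>

lemma sum_wt_reweight:
  assumes "finite Y" "\<And>C. C \<subseteq> Y \<Longrightarrow> (\<Prod>e\<in>C. a e) * h C = (\<Prod>e\<in>C. a' e)"
  shows "(\<Sum>C\<in>Pow Y. wt Y a b C * h C) = (\<Prod>e\<in>Y. a' e + b e)"
proof -
  have "(\<Sum>C\<in>Pow Y. wt Y a b C * h C) = (\<Sum>C\<in>Pow Y. wt Y a' b C)"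
  proof (rule sum.cong)
    fix C assume "C \<in> Pow Y"
    then have "(\<Prod>e\<in>C. a e) * h C = (\<Prod>e\<in>C. a' e)" using assms(2) by simp
    then show "wt Y a b C * h C = wt Y a' b C" unfolding wt_def by (metis mult.assoc mult.commute)
  qed simp
  then show ?thesis by (simp add: sum_wt assms(1))
qed

lemma prod_if_pow:
  assumes "finite Y"
  shows "(\<Prod>e\<in>Y. if e \<in> B then c else 1) = (c::real) ^ card (Y \<inter> B)"
  using assms by (simp add: prod.If_cases Int_def)

text \<open>The cost (8/\<eta>)^b is 4^b for the exponential Markov bound on the random boundary,
  2^b for thinning inside S, and \<eta>^(-b) for deleting the boundary edges of G. The power of 1/(1
  - \<eta>) pays for keeping all edges of G inside S, at most D|S| by degeneracy. The power of 1 -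
  p/4 is the gain at the crossing pairs.\<close>

lemma bad_set_prob:
  fixes p \<eta> :: real
  assumes G: "is_graph n G" and conn: "cutconn G {..<n}" and deg: "degenerate D n G"
    and S: "S \<subseteq> {..<n}" "S \<noteq> {}" "S \<noteq> {..<n}" and b: "card (boundary G S) \<le> b"
    and p: "0 \<le> p" "p \<le> 1" and \<eta>: "0 < \<eta>" "\<eta> < 1"
  defines "r \<equiv> \<lambda>e. if e \<in> G then 1 - \<eta> else p / 2" and "X \<equiv> all_pairs n"
  shows "(\<Sum>R\<in>Pow X. wt X (\<lambda>_. p) (\<lambda>_. 1 - p) R * of_bool (cutconn (G \<union> R) S \<and> card (boundary R S) \<le> b))
    \<le> (8 / \<eta>) ^ b * (1 / (1 - \<eta>)) ^ (D * card S) * (1 - p / 4) ^ (card S * (n - card S))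
       * (\<Sum>R\<in>Pow X. wt X r (\<lambda>e. 1 - r e) R * of_bool (cutconn R S \<and> boundary R S = {}))"
proof -
  define I where "I = inside X S"
  define Y where "Y = X - I"
  define B where "B = boundary X S"
  have fX: "finite X" by (simp add: X_def finite_all_pairs)
  have GX: "G \<subseteq> X" using G by (simp add: is_graph_def X_def)
  have fin: "finite I" "finite Y" "finite B" using fX by (auto simp: I_def Y_def B_def inside_def boundary_def)
  have XIY: "X = I \<union> Y" "I \<inter> Y = {}" by (auto simp: I_def Y_def inside_def)
  have BY: "B \<subseteq> Y" by (auto simp: B_def Y_def I_def inside_def boundary_def)
  have fS: "finite S" using S finite_subset by blast
  have r01: "0 \<le> r e \<and> r e \<le> 1" for e using p \<eta> by (simp add: r_def)
  have bd_eq: "boundary R S = (R \<inter> Y) \<inter> B" if "R \<subseteq> X" for R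
    using that by (auto simp: boundary_def B_def Y_def I_def inside_def)
  define J where "J = I \<inter> G"
  define K where "K = I - G"
  have JK: "I = J \<union> K" "J \<inter> K = {}" "finite J" "finite K" using fin by (auto simp: J_def K_def)
  have Jin: "J = inside G S" using GX by (auto simp: J_def I_def inside_def)
  define M where "M = (\<lambda>C. cutconn (G \<union> C) S)"
  define LI where "LI = (\<Sum>A\<in>Pow I. wt I (\<lambda>_. p) (\<lambda>_. 1 - p) A * of_bool (M A))"
  define LY where "LY = (\<Sum>C\<in>Pow Y. wt Y (\<lambda>_. p) (\<lambda>_. 1 - p) C * (1/4) ^ card (C \<inter> B))"
  define QI where "QI = (\<Sum>A\<in>Pow I. wt I r (\<lambda>e. 1 - r e) A * of_bool (cutconn A S))"
  define QY where "QY = (\<Sum>C\<in>Pow Y. wt Y r (\<lambda>e. 1 - r e) C * of_bool (C \<inter> B = {}))"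
  define LK where "LK = (\<Sum>C\<in>Pow K. wt K (\<lambda>_. p) (\<lambda>_. 1 - p) C * of_bool (M C))"
  define QK where "QK = (\<Sum>C\<in>Pow K. wt K (\<lambda>_. p / 2) (\<lambda>_. 1 - p / 2) C * of_bool (M C))"
  have QI0: "0 \<le> QI" unfolding QI_def by (intro sum_nonneg mult_nonneg_nonneg wt_nonneg) (use r01 in auto)

  have "(\<Sum>R\<in>Pow X. wt X (\<lambda>_. p) (\<lambda>_. 1 - p) R * of_bool (cutconn (G \<union> R) S \<and> card (boundary R S) \<le> b))
     \<le> (\<Sum>R\<in>Pow X. 4 ^ b * (wt X (\<lambda>_. p) (\<lambda>_. 1 - p) R * of_bool (M (R \<inter> I)) * (1/4) ^ card ((R \<inter> Y) \<inter> B)))"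
  proof (rule sum_mono)
    fix R assume R: "R \<in> Pow X"
    have w: "0 \<le> wt X (\<lambda>_. p) (\<lambda>_. 1 - p) R" by (rule wt_nonneg) (use p R in auto)
    have "inside (G \<union> R) S = inside (G \<union> (R \<inter> I)) S" using R by (auto simp: inside_def I_def)
    then have M: "cutconn (G \<union> R) S = M (R \<inter> I)" unfolding M_def by (rule cutconn_cong_inside)
    \<comment> \<open>Exponential Markov bound: each random boundary edge is discounted by
      1/4.\<close>
    have "of_bool (card (boundary R S) \<le> b) \<le> (4::real) ^ b * (1/4) ^ card ((R \<inter> Y) \<inter> B)"
      unfolding bd_eq[of R, OF R[THEN PowD]]
      by (cases "card (R \<inter> Y \<inter> B) \<le> b") (auto simp: power_divide power_increasing)
    then have "wt X (\<lambda>_. p) (\<lambda>_. 1 - p) R * of_bool (M (R \<inter> I)) * of_bool (card (boundary R S) \<le> b)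
       \<le> wt X (\<lambda>_. p) (\<lambda>_. 1 - p) R * of_bool (M (R \<inter> I)) * (4 ^ b * (1/4) ^ card ((R \<inter> Y) \<inter> B))"
      using w by (intro mult_left_mono) auto
    then show "wt X (\<lambda>_. p) (\<lambda>_. 1 - p) R * of_bool (cutconn (G \<union> R) S \<and> card (boundary R S) \<le> b)
      \<le> 4 ^ b * (wt X (\<lambda>_. p) (\<lambda>_. 1 - p) R * of_bool (M (R \<inter> I)) * (1/4) ^ card ((R \<inter> Y) \<inter> B))"
      by (simp add: M of_bool_conj mult_ac)
  qed
  also have "\<dots> = 4 ^ b * (LI * LY)"
    unfolding sum_distrib_left[symmetric] LI_def LY_def XIY(1)
    by (subst sum_Pow_Un[OF fin(1,2) XIY(2)]) simp
  also have "LY = (1 - 3 * p / 4) ^ card B"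
  proof -
    have "LY = (\<Prod>e\<in>Y. (if e \<in> B then p / 4 else p) + (1 - p))"
      unfolding LY_def
    proof (rule sum_wt_reweight[OF fin(2)])
      fix C assume "C \<subseteq> Y"
      then have fC: "finite C" using fin finite_subset by blast
      have "(\<Prod>e\<in>C. if e \<in> B then p / 4 else p) = (\<Prod>e\<in>C. p * (if e \<in> B then 1/4 else 1))"
        by (rule prod.cong) auto
      also have "\<dots> = (\<Prod>e\<in>C. p) * (1/4) ^ card (C \<inter> B)"
        unfolding prod.distrib prod_if_pow[OF fC] ..
      finally show "(\<Prod>e\<in>C. p) * (1/4) ^ card (C \<inter> B) = (\<Prod>e\<in>C. if e \<in> B then p / 4 else p)" ..
    qed
    also have "\<dots> = (\<Prod>e\<in>Y. if e \<in> B then 1 - 3 * p / 4 else 1)" by (rule prod.cong) auto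
    also have "\<dots> = (1 - 3 * p / 4) ^ card B" unfolding prod_if_pow[OF fin(2)] using BY by (simp add: Int_absorb1)
    finally show ?thesis .
  qed
  finally have L: "(\<Sum>R\<in>Pow X. wt X (\<lambda>_. p) (\<lambda>_. 1 - p) R * of_bool (cutconn (G \<union> R) S \<and> card (boundary R S) \<le> b))
     \<le> 4 ^ b * (LI * (1 - 3 * p / 4) ^ card B)" .

  have Q: "(\<Sum>R\<in>Pow X. wt X r (\<lambda>e. 1 - r e) R * of_bool (cutconn R S \<and> boundary R S = {})) = QI * QY"
  proof -
    have "(\<Sum>R\<in>Pow X. wt X r (\<lambda>e. 1 - r e) R * of_bool (cutconn R S \<and> boundary R S = {}))
       = (\<Sum>R\<in>Pow X. wt X r (\<lambda>e. 1 - r e) R * of_bool (cutconn (R \<inter> I) S) * of_bool ((R \<inter> Y) \<inter> B = {}))"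
    proof (rule sum.cong)
      fix R assume R: "R \<in> Pow X"
      have "inside R S = inside (R \<inter> I) S" using R by (auto simp: inside_def I_def)
      then have "cutconn R S = cutconn (R \<inter> I) S" by (rule cutconn_cong_inside)
      then show "wt X r (\<lambda>e. 1 - r e) R * of_bool (cutconn R S \<and> boundary R S = {})
        = wt X r (\<lambda>e. 1 - r e) R * of_bool (cutconn (R \<inter> I) S) * of_bool ((R \<inter> Y) \<inter> B = {})"
        using bd_eq[of R] R by (simp add: of_bool_conj)
    qed simp
    also have "\<dots> = QI * QY"
      unfolding QI_def QY_def XIY(1) by (rule sum_Pow_Un[OF fin(1,2) XIY(2)])
    finally show ?thesis .
  qed

  have QY: "\<eta> ^ b * (1 - p / 2) ^ card B \<le> QY"
  proof -
    have "QY = (\<Prod>e\<in>Y. (if e \<in> B then 0 else r e) + (1 - r e))"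
      unfolding QY_def
    proof (rule sum_wt_reweight[OF fin(2)])
      fix C assume "C \<subseteq> Y"
      then have fC: "finite C" using fin finite_subset by blast
      show "(\<Prod>e\<in>C. r e) * of_bool (C \<inter> B = {}) = (\<Prod>e\<in>C. if e \<in> B then 0 else r e)"
      proof (cases "C \<inter> B = {}")
        case True
        then have "(\<Prod>e\<in>C. if e \<in> B then 0 else r e) = (\<Prod>e\<in>C. r e)" by (intro prod.cong) auto
        then show ?thesis using True by simp
      next
        case False
        then have "(\<Prod>e\<in>C. if e \<in> B then 0 else r e) = 0" using fC by (auto simp: prod_zero_iff)
        then show ?thesis using False by simp
      qed
    qed
    also have "\<dots> = (\<Prod>e\<in>Y. if e \<in> B then 1 - r e else 1)" by (rule prod.cong) auto
    also have "\<dots> = (\<Prod>e\<in>B. 1 - r e)"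
      using fin BY by (simp add: prod.If_cases Int_absorb1 flip: Int_def)
    also have "\<dots> \<ge> (\<Prod>e\<in>B. (if e \<in> G then \<eta> else 1) * (1 - p / 2))"
      using p \<eta> by (intro prod_mono) (auto simp: r_def mult_left_le)
    finally have "(\<Prod>e\<in>B. (if e \<in> G then \<eta> else 1) * (1 - p / 2)) \<le> QY" .
    moreover have "(\<Prod>e\<in>B. (if e \<in> G then \<eta> else 1) * (1 - p / 2)) = \<eta> ^ card (B \<inter> G) * (1 - p / 2) ^ card B"
      unfolding prod.distrib prod_if_pow[OF fin(3)] by simp
    moreover have "card (B \<inter> G) \<le> b"
    proof -
      have "B \<inter> G = boundary G S" using GX by (auto simp: B_def boundary_def)
      then show ?thesis using b by simp
    qed
    then have "\<eta> ^ b * (1 - p / 2) ^ card B \<le> \<eta> ^ card (B \<inter> G) * (1 - p / 2) ^ card B"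
      using p \<eta> by (intro mult_right_mono power_decreasing) auto
    ultimately show ?thesis by linarith
  qed

  have "LI = LK"
  proof -
    have "LI = (\<Sum>A\<in>Pow (J \<union> K). wt (J \<union> K) (\<lambda>_. p) (\<lambda>_. 1 - p) A * 1 * of_bool (M (A \<inter> K)))"
      unfolding LI_def JK(1)
    proof (rule sum.cong)
      fix A assume A: "A \<in> Pow (J \<union> K)"
      have "G \<union> A = G \<union> (A \<inter> K)" using A by (auto simp: J_def)
      then show "wt (J \<union> K) (\<lambda>_. p) (\<lambda>_. 1 - p) A * of_bool (M A) = wt (J \<union> K) (\<lambda>_. p) (\<lambda>_. 1 - p) A * 1 * of_bool (M (A \<inter> K))"
        by (simp add: M_def)
    qed simp
    also have "\<dots> = (\<Sum>A\<in>Pow J. wt J (\<lambda>_. p) (\<lambda>_. 1 - p) A * 1) * LK"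
      unfolding LK_def by (rule sum_Pow_Un[OF JK(3,4,2)])
    finally show ?thesis using JK(3) by (simp add: sum_wt)
  qed
  also have "LK \<le> 2 ^ b * QK"
    unfolding LK_def QK_def
  proof (rule thinning[OF JK(4) p])
    show "M B" if "A \<subseteq> B" "M A" for A B using that unfolding M_def by (auto elim: cutconn_mono)
    fix C assume C: "M C"
    have leave: "\<exists>x\<in>U. \<exists>z. z \<notin> U \<and> {x, z} \<in> G" if U: "U \<subseteq> S" "U \<noteq> {}" for U
    proof -
      obtain x z where "x \<in> U" "z \<in> {..<n} - U" "{x, z} \<in> G"
        by (rule cutconnD[OF conn, of U]) (use U S in auto)
      then show ?thesis by blast
    qed
    have fb: "finite (boundary G S)" using finite_graph[OF G] by (simp add: boundary_def)
    obtain C' where "C' \<subseteq> C" "card C' \<le> card (boundary G S)" "cutconn (G \<union> C') S"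
      using few_extra_edges[OF fS S(2) fb leave] C unfolding M_def by blast
    then show "\<exists>C'\<subseteq>C. M C' \<and> card C' \<le> b" using b unfolding M_def by (meson order.trans)
  qed
  finally have LQ: "LI \<le> 2 ^ b * QK" .
  \<comment> \<open>A sufficient event for S to be connected in the percolation: every edge of G
    inside S is kept, and the remaining pairs connect S with their help.\<close>
  have QK: "(1 - \<eta>) ^ card J * QK \<le> QI"
  proof -
    have "(1 - \<eta>) ^ card J * QK = (\<Sum>A\<in>Pow J. wt J r (\<lambda>e. 1 - r e) A * of_bool (A = J)) * (\<Sum>C\<in>Pow K. wt K r (\<lambda>e. 1 - r e) C * of_bool (M C))"
    proof (rule arg_cong2[of _ _ _ _ "(*)"])
      have "(\<Sum>A\<in>Pow J. wt J r (\<lambda>e. 1 - r e) A * of_bool (A = J)) = wt J r (\<lambda>e. 1 - r e) J"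
        using JK(3) by (simp add: of_bool_def if_distrib[of "\<lambda>x. _ * x"] cong: if_cong)
      also have "\<dots> = (\<Prod>e\<in>J. 1 - \<eta>)" unfolding wt_def Diff_cancel prod.empty mult_1_right by (rule prod.cong) (auto simp: r_def J_def)
      finally show "(1 - \<eta>) ^ card J = (\<Sum>A\<in>Pow J. wt J r (\<lambda>e. 1 - r e) A * of_bool (A = J))" by simp
      show "QK = (\<Sum>C\<in>Pow K. wt K r (\<lambda>e. 1 - r e) C * of_bool (M C))"
        unfolding QK_def
      proof (rule sum.cong)
        fix C assume C: "C \<in> Pow K"
        have "(\<Prod>e\<in>C. r e) = (\<Prod>e\<in>C. p / 2)" "(\<Prod>e\<in>K - C. 1 - r e) = (\<Prod>e\<in>K - C. 1 - p / 2)"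
          by (rule prod.cong[OF refl]; use C in \<open>auto simp: r_def K_def\<close>)+
        then show "wt K (\<lambda>_. p / 2) (\<lambda>_. 1 - p / 2) C * of_bool (M C) = wt K r (\<lambda>e. 1 - r e) C * of_bool (M C)"
          by (simp add: wt_def)
      qed simp
    qed
    also have "\<dots> = (\<Sum>A\<in>Pow (J \<union> K). wt (J \<union> K) r (\<lambda>e. 1 - r e) A * of_bool (A \<inter> J = J) * of_bool (M (A \<inter> K)))"
      by (rule sum_Pow_Un[OF JK(3,4,2), symmetric])
    also have "\<dots> \<le> QI"
      unfolding QI_def JK(1)
    proof (rule sum_mono)
      fix A assume A: "A \<in> Pow (J \<union> K)"
      have w: "0 \<le> wt (J \<union> K) r (\<lambda>e. 1 - r e) A" by (rule wt_nonneg) (use A r01 in auto)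
      have "cutconn A S" if "A \<inter> J = J" "M (A \<inter> K)"
      proof -
        have "inside (G \<union> (A \<inter> K)) S \<subseteq> A" using that(1) Jin by (auto simp: inside_def)
        then show ?thesis using that(2) unfolding M_def
          using cutconn_inside cutconn_mono by blast
      qed
      then show "wt (J \<union> K) r (\<lambda>e. 1 - r e) A * of_bool (A \<inter> J = J) * of_bool (M (A \<inter> K))
         \<le> wt (J \<union> K) r (\<lambda>e. 1 - r e) A * of_bool (cutconn A S)"
        using w by (auto simp: of_bool_def)
    qed
    finally show ?thesis .
  qed
  have cJ: "card J \<le> D * card S" unfolding Jin by (rule card_inside_degenerate[OF G deg S(1)])
  have q: "0 < 1 - \<eta>" using \<eta> by simp
  have "QK \<le> (1 / (1 - \<eta>)) ^ card J * QI"
    using QK q by (simp add: power_divide field_simps)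
  also have "\<dots> \<le> (1 / (1 - \<eta>)) ^ (D * card S) * QI"
    using \<eta> cJ QI0 by (intro mult_right_mono power_increasing) auto
  finally have LI: "LI \<le> 2 ^ b * ((1 / (1 - \<eta>)) ^ (D * card S) * QI)"
    using LQ by (meson mult_left_mono order.trans zero_le_numeral zero_le_power)

  have LY: "(1 - 3 * p / 4) ^ card B \<le> (1 - p / 4) ^ (card S * (n - card S)) * ((1 / \<eta>) ^ b * QY)"
  proof -
    \<comment> \<open>The gain: even after the discount 1/4, a crossing pair weighs less on the left
      than its absence does at density p/2.\<close>
    have "1 - 3 * p / 4 \<le> (1 - p / 4) * (1 - p / 2)" by (simp add: field_simps)
    then have "(1 - 3 * p / 4) ^ card B \<le> ((1 - p / 4) * (1 - p / 2)) ^ card B"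
      using p by (intro power_mono) auto
    also have "\<dots> = (1 - p / 4) ^ card B * (1 - p / 2) ^ card B" by (rule power_mult_distrib)
    also have "\<dots> \<le> (1 - p / 4) ^ (card S * (n - card S)) * (1 - p / 2) ^ card B"
      using p card_boundary_all_pairs[OF S(1)] unfolding B_def X_def
      by (intro mult_right_mono power_decreasing) auto
    also have "\<dots> \<le> (1 - p / 4) ^ (card S * (n - card S)) * ((1 / \<eta>) ^ b * QY)"
      using p QY \<eta> by (intro mult_left_mono) (auto simp: power_divide field_simps)
    finally show ?thesis .
  qed
  have "4 ^ b * (LI * (1 - 3 * p / 4) ^ card B)
     \<le> 4 ^ b * ((2 ^ b * ((1 / (1 - \<eta>)) ^ (D * card S) * QI)) * ((1 - p / 4) ^ (card S * (n - card S)) * ((1 / \<eta>) ^ b * QY)))"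
    using LI LY p QI0 \<eta> by (intro mult_left_mono mult_mono) auto
  also have "\<dots> = (8 / \<eta>) ^ b * (1 / (1 - \<eta>)) ^ (D * card S) * (1 - p / 4) ^ (card S * (n - card S)) * (QI * QY)"
  proof -
    have "(8 / \<eta>) ^ b = 4 ^ b * 2 ^ b * (1 / \<eta>) ^ b" by (simp flip: power_mult_distrib)
    then show ?thesis by (simp only: mult_ac)
  qed
  finally show ?thesis using L unfolding Q by linarith
qed

section \<open>Sparsity of the random graph\<close>

lemma binomial_le_exp_power:
  assumes "0 < k" "k \<le> n"
  shows "real (n choose k) \<le> (exp 1 * real n / real k) ^ k"
proof -
  define x where "x = real k / real n"
  have n: "0 < n" using assms by simp
  have x: "0 < x" using assms n by (simp add: x_def)
  \<comment> \<open>One term of the expansion of (1 + x)^n at x = k/n.\<close>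
  have "real (n choose k) * x ^ k * 1 ^ (n - k) \<le> (\<Sum>i\<le>n. real (n choose i) * x ^ i * 1 ^ (n - i))"
    by (rule member_le_sum) (use assms x in auto)
  also have "\<dots> = (x + 1) ^ n" by (rule binomial_ring[symmetric])
  also have "\<dots> \<le> exp x ^ n" using x exp_ge_add_one_self[of x] by (intro power_mono) (auto simp: add.commute)
  also have "\<dots> = exp 1 ^ k" using n by (simp add: x_def flip: exp_of_nat_mult)
  finally have "real (n choose k) \<le> exp 1 ^ k / x ^ k" using x by (simp add: field_simps)
  also have "\<dots> = (exp 1 * real n / real k) ^ k" using assms n by (simp add: x_def power_divide power_mult_distrib)
  finally show ?thesis .
qed

lemma card_inside_all_pairs:
  assumes "finite S"
  shows "card (inside (all_pairs n) S) \<le> card S * card S"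
proof -
  have "inside (all_pairs n) S \<subseteq> (\<lambda>(u, v). {u, v}) ` (S \<times> S)"
  proof
    fix e assume "e \<in> inside (all_pairs n) S"
    then obtain u v where "e = {u, v}" "u \<in> S" "v \<in> S" by (auto simp: inside_def all_pairs_def card_2_iff)
    then show "e \<in> (\<lambda>(u, v). {u, v}) ` (S \<times> S)" by auto
  qed
  then have "card (inside (all_pairs n) S) \<le> card (S \<times> S)"
    using assms by (meson card_image_le card_mono finite_SigmaI finite_imageI order.trans)
  then show ?thesis by (simp add: card_cartesian_product)
qed

text \<open>A Chernoff bound with tilt \<theta> for the number of random edges inside S.\<close>

lemma dense_set_prob:
  fixes p \<theta> :: real and n :: nat
  assumes p: "0 \<le> p" "p \<le> 1" and S: "finite S" and \<theta>: "1 \<le> \<theta>"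
  defines "X \<equiv> all_pairs n"
  shows "(\<Sum>R\<in>Pow X. wt X (\<lambda>_. p) (\<lambda>_. 1 - p) R * of_bool (m \<le> card (inside R S)))
     \<le> (1 / \<theta>) ^ m * exp (p * \<theta> * real (card S * card S))"
proof -
  define I where "I = inside X S"
  have fX: "finite X" by (simp add: X_def finite_all_pairs)
  have IX: "I \<subseteq> X" by (auto simp: I_def inside_def)
  have "(\<Sum>R\<in>Pow X. wt X (\<lambda>_. p) (\<lambda>_. 1 - p) R * of_bool (m \<le> card (inside R S)))
     \<le> (\<Sum>R\<in>Pow X. (1 / \<theta>) ^ m * (wt X (\<lambda>_. p) (\<lambda>_. 1 - p) R * \<theta> ^ card (R \<inter> I)))"
  proof (rule sum_mono)
    fix R assume R: "R \<in> Pow X"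
    have "inside R S = R \<inter> I" using R by (auto simp: I_def inside_def)
    then have "of_bool (m \<le> card (inside R S)) \<le> (1 / \<theta>) ^ m * \<theta> ^ card (R \<inter> I)"
      using \<theta> by (cases "m \<le> card (R \<inter> I)") (auto simp: power_divide power_increasing)
    then have "wt X (\<lambda>_. p) (\<lambda>_. 1 - p) R * of_bool (m \<le> card (inside R S))
       \<le> wt X (\<lambda>_. p) (\<lambda>_. 1 - p) R * ((1 / \<theta>) ^ m * \<theta> ^ card (R \<inter> I))"
      using R p by (intro mult_left_mono wt_nonneg) auto
    then show "wt X (\<lambda>_. p) (\<lambda>_. 1 - p) R * of_bool (m \<le> card (inside R S))
       \<le> (1 / \<theta>) ^ m * (wt X (\<lambda>_. p) (\<lambda>_. 1 - p) R * \<theta> ^ card (R \<inter> I))"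
      by (simp only: mult.left_commute)
  qed
  also have "\<dots> = (1 / \<theta>) ^ m * (\<Sum>R\<in>Pow X. wt X (\<lambda>_. p) (\<lambda>_. 1 - p) R * \<theta> ^ card (R \<inter> I))"
    by (simp only: sum_distrib_left)
  also have "(\<Sum>R\<in>Pow X. wt X (\<lambda>_. p) (\<lambda>_. 1 - p) R * \<theta> ^ card (R \<inter> I)) = (\<Prod>e\<in>X. (if e \<in> I then p * \<theta> else p) + (1 - p))"
  proof (rule sum_wt_reweight[OF fX])
    fix C assume "C \<subseteq> X"
    then have fC: "finite C" using fX finite_subset by blast
    have "(\<Prod>e\<in>C. if e \<in> I then p * \<theta> else p) = (\<Prod>e\<in>C. p * (if e \<in> I then \<theta> else 1))"
      by (rule prod.cong) auto
    also have "\<dots> = (\<Prod>e\<in>C. p) * \<theta> ^ card (C \<inter> I)"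
      unfolding prod.distrib prod_if_pow[OF fC] ..
    finally show "(\<Prod>e\<in>C. p) * \<theta> ^ card (C \<inter> I) = (\<Prod>e\<in>C. if e \<in> I then p * \<theta> else p)" ..
  qed
  also have "\<dots> = (\<Prod>e\<in>X. if e \<in> I then p * \<theta> + (1 - p) else 1)" by (rule prod.cong) auto
  also have "\<dots> = (p * \<theta> + (1 - p)) ^ card I" unfolding prod_if_pow[OF fX] using IX by (simp add: Int_absorb1)
  also have "\<dots> \<le> exp (p * \<theta>) ^ card I"
  proof (rule power_mono)
    show "p * \<theta> + (1 - p) \<le> exp (p * \<theta>)" using p exp_ge_add_one_self[of "p * \<theta>"] by linarith
    show "0 \<le> p * \<theta> + (1 - p)" using p \<theta> by (intro add_nonneg_nonneg mult_nonneg_nonneg) auto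
  qed
  also have "\<dots> \<le> exp (p * \<theta>) ^ (card S * card S)"
    using card_inside_all_pairs[OF S, of n] p \<theta> by (intro power_increasing) (auto simp: I_def X_def)
  also have "\<dots> = exp (p * \<theta> * real (card S * card S))" by (simp add: mult.commute flip: exp_of_nat_mult)
  finally show ?thesis using \<theta> by (simp add: mult_left_mono)
qed

text \<open>With the tilt \<theta> = e n/k, one factor \<theta>^(-k) cancels the number of k-sets,
  the other C - 1 factors give at most exp(-(C - 1) k), and the moment term is exp(e \<epsilon> k).
  The condition on C leaves exp(-2k) for each size k.\<close>

lemma sparse_prob:
  fixes \<epsilon> :: real
  assumes n: "0 < n" and \<epsilon>: "0 < \<epsilon>" "\<epsilon> \<le> real n" and C: "3 + exp 1 * \<epsilon> \<le> real C" and k0: "0 < k0"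
  defines "X \<equiv> all_pairs n" and "p \<equiv> \<epsilon> / real n"
  shows "(\<Sum>S | S \<subseteq> {..<n} \<and> k0 \<le> card S. \<Sum>R\<in>Pow X. wt X (\<lambda>_. p) (\<lambda>_. 1 - p) R * of_bool (C * card S \<le> card (inside R S)))
     \<le> (real n + 1) * exp (- 2 * real k0)"
proof -
  have p: "0 \<le> p" "p \<le> 1" using \<epsilon> n by (auto simp: p_def)
  have one: "(\<Sum>R\<in>Pow X. wt X (\<lambda>_. p) (\<lambda>_. 1 - p) R * of_bool (C * card S \<le> card (inside R S)))
     \<le> exp (- 2 * real k0) / real (n choose card S)" if S: "S \<subseteq> {..<n}" "k0 \<le> card S" for S
  proof -
    define k where "k = card S"
    have k: "0 < k" "k \<le> n" "k0 \<le> k" using S k0 card_mono[of "{..<n}" S] by (auto simp: k_def)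
    define \<theta> where "\<theta> = exp 1 * real n / real k"
    have \<theta>e: "exp 1 \<le> \<theta>" using k by (simp add: \<theta>_def field_simps)
    have \<theta>1: "1 \<le> \<theta>" using \<theta>e one_le_exp_iff[of 1] by linarith
    have "0 < exp 1 * \<epsilon>" using \<epsilon> by simp
    then have "1 \<le> real C" using C by linarith
    then have C1: "1 \<le> C" by simp
    have fS: "finite S" using S finite_subset by blast
    have "(\<Sum>R\<in>Pow X. wt X (\<lambda>_. p) (\<lambda>_. 1 - p) R * of_bool (C * card S \<le> card (inside R S)))
      \<le> (1 / \<theta>) ^ (C * k) * exp (p * \<theta> * real (k * k))"
      unfolding X_def k_def by (rule dense_set_prob[OF p fS \<theta>1])
    also have "p * \<theta> * real (k * k) = exp 1 * \<epsilon> * real k" using k n by (simp add: p_def \<theta>_def)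
    also have "(1 / \<theta>) ^ (C * k) = (1 / \<theta>) ^ k * (1 / \<theta>) ^ ((C - 1) * k)"
      using C1 by (simp add: algebra_simps flip: power_add)
    also have "(1 / \<theta>) ^ ((C - 1) * k) \<le> (1 / exp 1) ^ ((C - 1) * k)"
      using \<theta>e \<theta>1 by (intro power_mono divide_left_mono) auto
    also have "(1 / exp 1) ^ ((C - 1) * k) = exp (- (real (C - 1) * real k))"
      by (simp add: exp_minus power_divide inverse_eq_divide flip: exp_of_nat_mult)
    finally have "(\<Sum>R\<in>Pow X. wt X (\<lambda>_. p) (\<lambda>_. 1 - p) R * of_bool (C * card S \<le> card (inside R S)))
      \<le> (1 / \<theta>) ^ k * (exp (- (real (C - 1) * real k)) * exp (exp 1 * \<epsilon> * real k))"
      using \<theta>1 by (simp add: mult.assoc mult_left_mono mult_right_mono)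
    also have "exp (- (real (C - 1) * real k)) * exp (exp 1 * \<epsilon> * real k) \<le> exp (- 2 * real k0)"
    proof -
      have "2 * real k0 \<le> (real (C - 1) - exp 1 * \<epsilon>) * real k"
        using C C1 k by (intro mult_mono) auto
      then show ?thesis by (simp add: algebra_simps flip: exp_add)
    qed
    also have "(1 / \<theta>) ^ k \<le> 1 / real (n choose k)"
    proof -
      have "0 < real (n choose k)" using k by simp
      moreover have "real (n choose k) \<le> \<theta> ^ k" unfolding \<theta>_def by (rule binomial_le_exp_power[OF k(1,2)])
      ultimately show ?thesis by (simp add: power_divide frac_le)
    qed
    finally show ?thesis using \<theta>1 by (simp add: k_def mult_right_mono mult_left_mono)
  qed
  have "(\<Sum>S | S \<subseteq> {..<n} \<and> k0 \<le> card S. \<Sum>R\<in>Pow X. wt X (\<lambda>_. p) (\<lambda>_. 1 - p) R * of_bool (C * card S \<le> card (inside R S)))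
     \<le> (\<Sum>S | S \<subseteq> {..<n} \<and> k0 \<le> card S. exp (- 2 * real k0) / real (n choose card S))"
    by (rule sum_mono) (use one in auto)
  also have "\<dots> \<le> (\<Sum>S\<in>Pow {..<n}. exp (- 2 * real k0) / real (n choose card S))"
    by (rule sum_mono2) auto
  also have "\<dots> = (\<Sum>k\<in>{..n}. \<Sum>S\<in>{S \<in> Pow {..<n}. card S = k}. exp (- 2 * real k0) / real (n choose card S))"
    by (rule sum.group[symmetric]) (auto simp: card_mono dest: card_mono[of "{..<n}", rotated])
  also have "\<dots> = (\<Sum>k\<in>{..n}. exp (- 2 * real k0))"
  proof (rule sum.cong)
    fix k assume k: "k \<in> {..n}"
    have "card {S \<in> Pow {..<n}. card S = k} = n choose k" using n_subsets[of "{..<n}" k] by simp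
    moreover have "0 < n choose k" using k by simp
    ultimately show "(\<Sum>S\<in>{S \<in> Pow {..<n}. card S = k}. exp (- 2 * real k0) / real (n choose card S)) = exp (- 2 * real k0)"
      by simp
  qed simp
  also have "\<dots> = (real n + 1) * exp (- 2 * real k0)" by simp
  finally show ?thesis .
qed

text \<open>The crossing pairs gain exp(-\<beta> k), because p/4 * k * \<gamma> n = \<beta> k. Each
  of the two costs of \<open>bad_set_prob\<close> is limited to exp(\<beta> k/4), so exp(-\<beta>
  k/2) is left, while the cluster probabilities sum to at most 1 for each vertex.\<close>

lemma expansion_prob:
  fixes \<epsilon> \<gamma> \<eta> c :: real
  assumes G: "is_graph n G" and conn: "cutconn G {..<n}" and deg: "degenerate D n G"
    and n: "0 < n" and \<epsilon>: "0 < \<epsilon>" "\<epsilon> \<le> real n" and k0: "0 < k0" and \<gamma>: "0 < \<gamma>"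
    and \<eta>: "0 < \<eta>" "\<eta> < 1" and c: "0 \<le> c"
    and h1: "(1 / (1 - \<eta>)) ^ D \<le> exp (\<beta> / 4)" and h2: "(8 / \<eta>) powr c \<le> exp (\<beta> / 4)"
    and \<beta>: "\<beta> = \<epsilon> * \<gamma> / 4"
  defines "X \<equiv> all_pairs n" and "p \<equiv> \<epsilon> / real n" and "b \<equiv> \<lambda>S. nat \<lfloor>c * real (card S)\<rfloor>"
  shows "(\<Sum>S | S \<subseteq> {..<n} \<and> k0 \<le> card S \<and> \<gamma> * real n \<le> real n - real (card S).
     \<Sum>R\<in>Pow X. wt X (\<lambda>_. p) (\<lambda>_. 1 - p) R *
        of_bool (cutconn (G \<union> R) S \<and> card (boundary G S) \<le> b S \<and> card (boundary R S) \<le> b S))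
     \<le> real n * exp (- \<beta> * real k0 / 2)"
proof -
  let ?F = "{S. S \<subseteq> {..<n} \<and> k0 \<le> card S \<and> \<gamma> * real n \<le> real n - real (card S)}"
  define r where "r = (\<lambda>e. if e \<in> G then 1 - \<eta> else p / 2)"
  define pr where "pr = (\<lambda>S. \<Sum>R\<in>Pow X. wt X (\<lambda>_. p) (\<lambda>_. 1 - p) R *
        of_bool (cutconn (G \<union> R) S \<and> card (boundary G S) \<le> b S \<and> card (boundary R S) \<le> b S))"
  define cl where "cl = (\<lambda>S. \<Sum>R\<in>Pow X. wt X r (\<lambda>e. 1 - r e) R * of_bool (cutconn R S \<and> boundary R S = {}))"
  have p: "0 \<le> p" "p \<le> 1" using \<epsilon> n by (auto simp: p_def)
  have r01: "0 \<le> r e \<and> r e \<le> 1" for e using p \<eta> by (simp add: r_def)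
  have cl0: "0 \<le> cl S" for S
    unfolding cl_def by (intro sum_nonneg mult_nonneg_nonneg wt_nonneg) (use r01 in auto)
  have pr0: "0 \<le> pr S" for S
    unfolding pr_def by (intro sum_nonneg mult_nonneg_nonneg wt_nonneg) (use p in auto)
  have \<beta>0: "0 < \<beta>" unfolding \<beta> using \<epsilon> \<gamma> by simp
  have finF: "finite ?F" by (rule finite_subset[of _ "Pow {..<n}"]) auto
  have one: "pr S \<le> exp (- \<beta> * real k0 / 2) * cl S" if "S \<in> ?F" for S
  proof (cases "card (boundary G S) \<le> b S")
    case False
    then have "pr S = 0" by (simp add: pr_def)
    then show ?thesis using cl0 by simp
  next
    case True
    have "0 < \<gamma> * real n" using \<gamma> n by simp
    then have "card S \<noteq> n" using that by auto
    then have S: "S \<subseteq> {..<n}" "S \<noteq> {}" "S \<noteq> {..<n}" using that k0 by auto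
    define k where "k = card S"
    have k: "k0 \<le> k" "\<gamma> * real n \<le> real n - real k" "k \<le> n"
      using that card_mono[of "{..<n}" S] by (auto simp: k_def)
    have "pr S \<le> (8 / \<eta>) ^ b S * (1 / (1 - \<eta>)) ^ (D * k) * (1 - p / 4) ^ (k * (n - k)) * cl S"
      using bad_set_prob[OF G conn deg S True p \<eta>] True by (simp add: pr_def cl_def X_def r_def k_def)
    also have "\<dots> \<le> exp (- \<beta> * real k0 / 2) * cl S"
    proof (rule mult_right_mono[OF _ cl0])
      have "(8 / \<eta>) ^ b S = (8 / \<eta>) powr real (b S)" using \<eta> by (simp add: powr_realpow)
      also have "\<dots> \<le> (8 / \<eta>) powr (c * real k)"
        using \<eta> c by (intro powr_mono) (auto simp: b_def k_def)
      also have "\<dots> = ((8 / \<eta>) powr c) powr real k" by (simp add: powr_powr)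
      also have "\<dots> \<le> exp (\<beta> / 4) powr real k" using h2 by (intro powr_mono2) auto
      also have "\<dots> = exp (\<beta> / 4 * real k)" by (simp add: exp_powr_real)
      finally have 1: "(8 / \<eta>) ^ b S \<le> exp (\<beta> / 4 * real k)" .
      have "(1 / (1 - \<eta>)) ^ (D * k) \<le> exp (\<beta> / 4) ^ k"
        unfolding power_mult using h1 \<eta> by (intro power_mono) auto
      then have 2: "(1 / (1 - \<eta>)) ^ (D * k) \<le> exp (\<beta> / 4 * real k)" by (simp add: mult.commute flip: exp_of_nat_mult)
      have "(1 - p / 4) ^ (k * (n - k)) \<le> exp (- (p / 4)) ^ (k * (n - k))"
        using p exp_ge_add_one_self[of "- (p / 4)"] by (intro power_mono) auto
      also have "\<dots> = exp (- (p / 4 * (real k * (real n - real k))))"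
        using k by (simp add: mult.commute of_nat_diff flip: exp_of_nat_mult)
      also have "\<dots> \<le> exp (- (p / 4 * (real k * (\<gamma> * real n))))"
        using p k by (auto intro!: mult_left_mono)
      also have "p / 4 * (real k * (\<gamma> * real n)) = \<beta> * real k" using n by (simp add: p_def \<beta>)
      finally have 3: "(1 - p / 4) ^ (k * (n - k)) \<le> exp (- (\<beta> * real k))" .
      have "(8 / \<eta>) ^ b S * (1 / (1 - \<eta>)) ^ (D * k) * (1 - p / 4) ^ (k * (n - k))
        \<le> exp (\<beta> / 4 * real k) * exp (\<beta> / 4 * real k) * exp (- (\<beta> * real k))"
        using 1 2 3 p \<eta> by (intro mult_mono) auto
      also have "\<dots> = exp (- \<beta> * real k / 2)" by (simp flip: exp_add)
      also have "\<dots> \<le> exp (- \<beta> * real k0 / 2)" using k \<beta>0 by simp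
      finally show "(8 / \<eta>) ^ b S * (1 / (1 - \<eta>)) ^ (D * k) * (1 - p / 4) ^ (k * (n - k)) \<le> exp (- \<beta> * real k0 / 2)" .
    qed
    finally show ?thesis .
  qed
  \<comment> \<open>Each set is charged to all its vertices, which is at least once since it is
    nonempty.\<close>
  have "(\<Sum>S\<in>?F. pr S) \<le> (\<Sum>S\<in>?F. \<Sum>v<n. if v \<in> S then pr S else 0)"
  proof (rule sum_mono)
    fix S assume S: "S \<in> ?F"
    then obtain v where v: "v \<in> S" "v < n" using k0 by (cases "S = {}") auto
    then have "pr S = (if v \<in> S then pr S else 0)" by simp
    also have "\<dots> \<le> (\<Sum>v<n. if v \<in> S then pr S else 0)"
      by (rule member_le_sum) (use v pr0 in auto)
    finally show "pr S \<le> (\<Sum>v<n. if v \<in> S then pr S else 0)" .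
  qed
  also have "\<dots> = (\<Sum>v<n. \<Sum>S\<in>?F. if v \<in> S then pr S else 0)" by (rule sum.swap)
  also have "\<dots> \<le> (\<Sum>v<n. exp (- \<beta> * real k0 / 2))"
  proof (rule sum_mono)
    fix v
    have "(\<Sum>S\<in>?F. if v \<in> S then pr S else 0) \<le> (\<Sum>S\<in>?F. if v \<in> S then exp (- \<beta> * real k0 / 2) * cl S else 0)"
      by (rule sum_mono) (use one in auto)
    also have "\<dots> = (\<Sum>S\<in>{S \<in> ?F. v \<in> S}. exp (- \<beta> * real k0 / 2) * cl S)"
      using finF by (simp add: sum.If_cases Int_def)
    also have "\<dots> \<le> (\<Sum>S\<in>{S. S \<subseteq> {..<n} \<and> v \<in> S}. exp (- \<beta> * real k0 / 2) * cl S)"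
      by (rule sum_mono2) (use cl0 in \<open>auto intro: finite_subset[of _ "Pow {..<n}"]\<close>)
    also have "\<dots> = exp (- \<beta> * real k0 / 2) * (\<Sum>S\<in>{S. S \<subseteq> {..<n} \<and> v \<in> S}. cl S)"
      by (simp only: sum_distrib_left)
    also have "\<dots> \<le> exp (- \<beta> * real k0 / 2) * 1"
      unfolding cl_def X_def
      by (rule mult_left_mono[OF cluster_sum_le]) (use r01 finite_all_pairs in auto)
    finally show "(\<Sum>S\<in>?F. if v \<in> S then pr S else 0) \<le> exp (- \<beta> * real k0 / 2)" by simp
  qed
  also have "\<dots> = real n * exp (- \<beta> * real k0 / 2)" by simp
  finally show ?thesis by (simp add: pr_def)
qed

section \<open>Mixing time of the augmented graph\<close>

text \<open>Sets of at least k0 vertices satisfy the linear bound: by expansion if the outside has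
  at least n/(20q) vertices, and otherwise because a small complement spans too few edges to account
  for its share of the volume. Only sets below k0 may need the second alternative.\<close>

lemma volume_dichotomy:
  fixes q c :: real
  assumes E: "is_graph n E" and q: "1 \<le> q" and c: "0 < c" and n: "0 < n"
    and k0: "20 * q * real k0 \<le> real n"
    and sparse: "\<And>T. T \<subseteq> {..<n} \<Longrightarrow> k0 \<le> card T \<Longrightarrow> real (card (inside E T)) \<le> q * real (card T)"
    and expand: "\<And>T. T \<subseteq> {..<n} \<Longrightarrow> k0 \<le> card T \<Longrightarrow> real n / (20 * q) \<le> real n - real (card T) \<Longrightarrow> cutconn E T \<Longrightarrow>
      c * real (card T) \<le> real (card (boundary E T))"
    and dp: "\<And>v. v < n \<Longrightarrow> 0 < degree E v"
    and S: "S \<subseteq> {..<n}" "cutconn E S" "5 * (\<Sum>v\<in>S. degree E v) \<le> 8 * card E"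
  shows "real (\<Sum>v\<in>S. degree E v) \<le> (2 * q / c + 20 * q + 2) * real (card (boundary E S))
    \<or> real (\<Sum>v\<in>S. degree E v) \<le> 4 * q * real k0"
proof -
  have "20 * 1 * real k0 \<le> 20 * q * real k0" using q by (intro mult_right_mono) auto
  then have "real k0 \<le> real n" using k0 by linarith
  then have k0n: "k0 \<le> n" by simp
  \<comment> \<open>Sparsity is known from size k0 on; smaller sets are padded to that size.\<close>
  have inside_le: "real (card (inside E T)) \<le> q * real (max (card T) k0)" if T: "T \<subseteq> {..<n}" for T
  proof (cases "k0 \<le> card T")
    case True
    then show ?thesis using sparse[OF T] by (simp add: max_def)
  next
    case False
    then obtain T' where T': "T \<subseteq> T'" "T' \<subseteq> {..<n}" "card T' = k0"
      using exists_subset_between[of T k0 "{..<n}"] T k0n by auto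
    have "card (inside E T) \<le> card (inside E T')"
      using T' finite_graph[OF E] by (intro card_mono) (auto simp: inside_def)
    then have "real (card (inside E T)) \<le> q * real k0" using sparse[OF T'(2)] T'(3) by simp
    then show ?thesis using False by (simp add: max_def)
  qed
  define vol b i where "vol = real (\<Sum>v\<in>S. degree E v)" and "b = real (card (boundary E S))"
    and "i = real (card (inside E S))"
  have fS: "finite S" using S finite_subset by blast
  have vol: "vol = 2 * i + b" unfolding vol_def b_def i_def sum_degree[OF E fS] by simp
  have b0: "0 \<le> b" by (simp add: b_def)
  have qc: "0 \<le> q / c" using q c by simp
  have sn: "card S \<le> n" using S card_mono[of "{..<n}" S] by simp
  show ?thesis
  proof (cases "card S < k0")
    case True
    then have i: "i \<le> q * real k0" using inside_le[OF S(1)] by (simp add: i_def max_def)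
    \<comment> \<open>Few vertices do not mean small volume, since degrees are unbounded; but as few
      edges lie inside, a large volume forces a large boundary.\<close>
    show ?thesis
    proof (cases "2 * q * real k0 \<le> b")
      case True
      then have "vol \<le> 2 * b" using vol i by linarith
      also have "\<dots> \<le> (2 * q / c + 20 * q + 2) * b" using b0 qc q by (intro mult_right_mono) auto
      finally show ?thesis by (simp add: vol_def b_def)
    next
      case False
      then have "vol \<le> 4 * q * real k0" using vol i by linarith
      then show ?thesis by (simp add: vol_def)
    qed
  next
    case False
    then have kS: "k0 \<le> card S" by simp
    then have i: "i \<le> q * real (card S)" using sparse[OF S(1)] by (simp add: i_def)
    have "vol \<le> (2 * q / c + 20 * q + 2) * b"
    proof (cases "real n / (20 * q) \<le> real n - real (card S)")
      case True
      have "c * real (card S) \<le> b" using expand[OF S(1) kS True S(2)] by (simp add: b_def)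
      then have "2 * (q / c) * (c * real (card S)) \<le> 2 * (q / c) * b" using qc by (intro mult_left_mono) auto
      then have "vol \<le> (2 * q / c + 1) * b" using vol i c by (simp add: algebra_simps)
      also have "\<dots> \<le> (2 * q / c + 20 * q + 2) * b" using b0 q by (intro mult_right_mono) auto
      finally show ?thesis .
    next
      case large: False
      \<comment> \<open>The complement has volume at least 2m/5 \<ge> n/5. At most n/20 edges lie
        inside it, accounting for n/10, so the boundary supplies the other n/10; this fixes the
        constant 20.\<close>
      define T where "T = {..<n} - S"
      have T: "T \<subseteq> {..<n}" "finite T" by (auto simp: T_def)
      have "card T = n - card S" unfolding T_def using S fS by (simp add: card_Diff_subset)
      then have "real (card T) \<le> real n / (20 * q)" using large sn by (simp add: of_nat_diff)
      moreover have "real k0 \<le> real n / (20 * q)" using k0 q by (simp add: field_simps)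
      ultimately have "q * real (max (card T) k0) \<le> q * (real n / (20 * q))" using q by (intro mult_left_mono) auto
      then have iT: "real (card (inside E T)) \<le> real n / 20" using inside_le[OF T(1)] q by simp
      have bT: "boundary E T = boundary E S"
      proof (intro set_eqI)
        fix e show "e \<in> boundary E T \<longleftrightarrow> e \<in> boundary E S"
        proof (cases "e \<in> E")
          case True
          then obtain u v where "e = {u, v}" "u \<noteq> v" "u < n" "v < n" using graph_edge[OF E] by metis
          then show ?thesis by (auto simp: boundary_def T_def)
        qed (simp add: boundary_def)
      qed
      have split: "(\<Sum>v<n. degree E v) = (\<Sum>v\<in>T. degree E v) + (\<Sum>v\<in>S. degree E v)"
        unfolding T_def by (rule sum.subset_diff) (use S in auto)
      have volT: "(\<Sum>v\<in>T. degree E v) = 2 * card (inside E T) + card (boundary E S)"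
        using sum_degree[OF E T(2)] bT by simp
      have "n = (\<Sum>v<n. 1)" by simp
      also have "\<dots> \<le> (\<Sum>v<n. degree E v)" by (rule sum_mono) (use dp in \<open>auto simp: Suc_le_eq\<close>)
      finally have "n \<le> 2 * card E" unfolding sum_degree_all[OF E] .
      then have "n \<le> 5 * (\<Sum>v\<in>T. degree E v)" using S(3) split unfolding sum_degree_all[OF E] by linarith
      then have "real n \<le> real (5 * (2 * card (inside E T) + card (boundary E S)))"
        unfolding volT by (simp only: of_nat_le_iff)
      then have "real n \<le> 10 * real (card (inside E T)) + 5 * b" by (simp add: b_def)
      moreover have "10 * real (card (inside E T)) \<le> real n / 2" using iT by simp
      ultimately have bn: "real n \<le> 10 * b" by (simp add: field_simps)
      have "i \<le> q * real n" using i sn q by (meson mult_left_mono of_nat_le_iff order.trans zero_le_one)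
      also have "\<dots> \<le> q * (10 * b)" using bn q by (intro mult_left_mono) auto
      finally have "vol \<le> (20 * q + 1) * b" using vol by (simp add: algebra_simps)
      also have "\<dots> \<le> (2 * q / c + 20 * q + 2) * b" using b0 qc by (intro mult_right_mono) auto
      finally show ?thesis .
    qed
    then show ?thesis by (simp add: vol_def b_def)
  qed
qed

lemma (in lazy_chain) sum_funpow_push:
  "(\<Sum>v\<in>V. (push ^^ T) x v * \<phi> v) = (\<Sum>v\<in>V. x v * (op ^^ T) \<phi> v)"
  by (induction T arbitrary: \<phi>) (auto simp: sum_push funpow_swap1[of op])

text \<open>The discrepancy on an event A is the walk's law paired with the centred indicator of A,
  which has mean zero and oscillation at most 1. Duality moves the steps onto this function, so
  bounds at point starts average to any initial distribution.\<close>

lemma mixing_time_le: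
  assumes E: "is_graph n E" and conn: "cutconn E {..<n}" and n: "2 \<le> n"
    and h: "\<And>s t. s < n \<Longrightarrow> (\<Sum>v<n. lazy_chain.exits {..<n} (trans E) (stationary E) (5/4) s t v) \<le> h"
    and N: "16 * h \<le> real N" "0 < N"
  shows "mixing_time n E \<le> enat (20 * N)"
proof -
  interpret lazy_chain "{..<n}" "trans E" "stationary E" by (rule lazy_chain_graph[OF E conn n])
  have walk: "walk_step n E = push" by (intro ext) (simp add: walk_step_def push_def)
  have tv: "dTV n ((walk_step n E ^^ (20 * N)) x) (stationary E) \<le> 1/4" if x: "is_distribution n x" for x
    unfolding dTV_def walk
  proof (rule Max.boundedI)
    fix d assume "d \<in> (\<lambda>A. \<bar>(\<Sum>v\<in>A. (push ^^ (20 * N)) x v) - (\<Sum>v\<in>A. stationary E v)\<bar>) ` Pow {..<n}"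
    then obtain A where A: "A \<subseteq> {..<n}"
      and d: "d = \<bar>(\<Sum>v\<in>A. (push ^^ (20 * N)) x v) - (\<Sum>v\<in>A. stationary E v)\<bar>" by auto
    define a where "a = (\<Sum>v\<in>A. stationary E v)"
    define \<phi> where "\<phi> = (\<lambda>v. of_bool (v \<in> A) - a)"
    have ind: "(\<Sum>v<n. y v * of_bool (v \<in> A)) = (\<Sum>v\<in>A. y v)" for y :: "nat \<Rightarrow> real"
      using A by (simp add: of_bool_def if_distrib[of "\<lambda>x. _ * x"] sum.If_cases Int_absorb1 cong: if_cong)
    have mean: "(\<Sum>v<n. stationary E v * \<phi> v) = 0"
      using mu_sum ind[of "stationary E"] by (simp add: \<phi>_def a_def right_diff_distrib sum_subtractf flip: sum_distrib_right)
    have osc: "\<phi> u - \<phi> v \<le> 1" for u v by (simp add: \<phi>_def)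
    have bnd: "\<bar>(op ^^ (20 * N)) \<phi> s\<bar> \<le> 1/4" if "s < n" for s
      by (rule mixing_of_exits[of h]) (use h N mean osc that in auto)
    have mass: "(\<Sum>v<n. (push ^^ k) x v) = 1" for k
      using x by (induction k) (auto simp: is_distribution_def sum_push_mass)
    have "(\<Sum>v\<in>A. (push ^^ (20 * N)) x v) - a = (\<Sum>v<n. (push ^^ (20 * N)) x v * \<phi> v)"
      using mass ind[of "(push ^^ (20 * N)) x"]
      by (simp add: \<phi>_def right_diff_distrib sum_subtractf flip: sum_distrib_right)
    also have "\<dots> = (\<Sum>v<n. x v * (op ^^ (20 * N)) \<phi> v)" by (rule sum_funpow_push)
    finally have "d = \<bar>\<Sum>v<n. x v * (op ^^ (20 * N)) \<phi> v\<bar>" by (simp add: d a_def)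
    also have "\<dots> \<le> (\<Sum>v<n. \<bar>x v * (op ^^ (20 * N)) \<phi> v\<bar>)" by (rule sum_abs)
    also have "\<dots> \<le> (\<Sum>v<n. x v * (1/4))"
    proof (rule sum_mono)
      fix v assume "v \<in> {..<n}"
      then show "\<bar>x v * (op ^^ (20 * N)) \<phi> v\<bar> \<le> x v * (1/4)"
        using x bnd[of v] unfolding abs_mult by (intro mult_mono) (auto simp: is_distribution_def)
    qed
    also have "\<dots> = 1/4" using x by (simp add: is_distribution_def flip: sum_distrib_right sum_divide_distrib)
    finally show "d \<le> 1/4" .
  qed auto
  show ?thesis
    unfolding mixing_time_def
  proof (rule SUP_least)
    fix x assume "x \<in> {x. is_distribution n x}"
    then have "20 * N \<in> {t. dTV n ((walk_step n E ^^ t) x) (stationary E) \<le> 1/4}" using tv by simp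
    then show "(INF t\<in>{t. dTV n ((walk_step n E ^^ t) x) (stationary E) \<le> 1/4}. enat t) \<le> enat (20 * N)"
      by (rule INF_lower)
  qed
qed

section \<open>From expansion to the probabilistic statement\<close>

lemma connected_graph_cutconn:
  assumes "is_graph n G" "connected_graph n G"
  shows "cutconn G {..<n}"
  unfolding cutconn_def
proof (intro allI impI)
  fix U assume U: "U \<subseteq> {..<n} \<and> U \<noteq> {} \<and> U \<noteq> {..<n}"
  then obtain u v where uv: "u \<in> U" "v \<in> {..<n} - U" by blast
  show "\<exists>x\<in>U. \<exists>y\<in>{..<n} - U. {x, y} \<in> G"
  proof (rule ccontr)
    assume no: "\<not> ?thesis"
    have "(u, v) \<in> (adj G)\<^sup>*" using assms(2) uv U unfolding connected_graph_def by blast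
    then have "v \<in> U"
    proof (induction rule: rtrancl_induct)
      case (step y z)
      then have "{y, z} \<in> G" by (simp add: adj_def)
      then show ?case using no step.IH graph_edgeD[OF assms(1)] by blast
    qed (use uv in simp)
    then show False using uv by simp
  qed
qed

lemma gnp_prob_wt:
  "gnp_prob n p Q = (\<Sum>R\<in>Pow (all_pairs n). wt (all_pairs n) (\<lambda>_. p) (\<lambda>_. 1 - p) R * of_bool (Q R))"
  unfolding gnp_prob_def
proof (rule sum.cong)
  fix R assume R: "R \<in> Pow (all_pairs n)"
  then have "card (all_pairs n - R) = card (all_pairs n) - card R"
    using finite_all_pairs finite_subset by (intro card_Diff_subset) auto
  then show "(if Q R then p ^ card R * (1 - p) ^ (card (all_pairs n) - card R) else 0)
     = wt (all_pairs n) (\<lambda>_. p) (\<lambda>_. 1 - p) R * of_bool (Q R)" by (simp add: wt_def)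
qed simp

lemma gnp_prob_ge:
  assumes p: "0 \<le> p" "p \<le> 1"
    and F: "finite F\<^sub>1" "finite F\<^sub>2"
    and good: "\<And>R. R \<subseteq> all_pairs n \<Longrightarrow> (\<And>S. S \<in> F\<^sub>1 \<Longrightarrow> \<not> B\<^sub>1 S R) \<Longrightarrow> (\<And>S. S \<in> F\<^sub>2 \<Longrightarrow> \<not> B\<^sub>2 S R) \<Longrightarrow> Q R"
  defines "w \<equiv> wt (all_pairs n) (\<lambda>_. p) (\<lambda>_. 1 - p)"
  shows "1 - (\<Sum>S\<in>F\<^sub>1. \<Sum>R\<in>Pow (all_pairs n). w R * of_bool (B\<^sub>1 S R))
     - (\<Sum>S\<in>F\<^sub>2. \<Sum>R\<in>Pow (all_pairs n). w R * of_bool (B\<^sub>2 S R)) \<le> gnp_prob n p Q"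
    and "gnp_prob n p Q \<le> 1"
proof -
  let ?X = "Pow (all_pairs n)"
  have w0: "0 \<le> w R" if "R \<in> ?X" for R unfolding w_def by (rule wt_nonneg) (use p that in auto)
  have total: "(\<Sum>R\<in>?X. w R) = 1" unfolding w_def by (simp add: sum_wt finite_all_pairs)
  have "1 \<le> (\<Sum>R\<in>?X. w R * (of_bool (Q R) + (\<Sum>S\<in>F\<^sub>1. of_bool (B\<^sub>1 S R)) + (\<Sum>S\<in>F\<^sub>2. of_bool (B\<^sub>2 S R))))"
  proof -
    have "(\<Sum>R\<in>?X. w R * 1) \<le> (\<Sum>R\<in>?X. w R * (of_bool (Q R) + (\<Sum>S\<in>F\<^sub>1. of_bool (B\<^sub>1 S R)) + (\<Sum>S\<in>F\<^sub>2. of_bool (B\<^sub>2 S R))))"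
    proof (intro sum_mono mult_left_mono w0)
      fix R assume R: "R \<in> ?X"
      have nn: "0 \<le> (\<Sum>S\<in>F\<^sub>1. of_bool (B\<^sub>1 S R) :: real)" "0 \<le> (\<Sum>S\<in>F\<^sub>2. of_bool (B\<^sub>2 S R) :: real)"
        by (auto intro: sum_nonneg)
      consider "Q R" | S where "S \<in> F\<^sub>1" "B\<^sub>1 S R" | S where "S \<in> F\<^sub>2" "B\<^sub>2 S R" using good[of R] R by blast
      then show "1 \<le> (of_bool (Q R) + (\<Sum>S\<in>F\<^sub>1. of_bool (B\<^sub>1 S R)) + (\<Sum>S\<in>F\<^sub>2. of_bool (B\<^sub>2 S R)) :: real)"
      proof cases
        case 1
        then show ?thesis using nn by simp
      next
        case (2 S)
        then have "(1::real) \<le> (\<Sum>S\<in>F\<^sub>1. of_bool (B\<^sub>1 S R))"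
          using member_le_sum[of S F\<^sub>1 "\<lambda>S. of_bool (B\<^sub>1 S R) :: real"] F by simp
        then show ?thesis using nn(2) by simp
      next
        case (3 S)
        then have "(1::real) \<le> (\<Sum>S\<in>F\<^sub>2. of_bool (B\<^sub>2 S R))"
          using member_le_sum[of S F\<^sub>2 "\<lambda>S. of_bool (B\<^sub>2 S R) :: real"] F by simp
        then show ?thesis using nn(1) by simp
      qed
    qed
    then show ?thesis using total by simp
  qed
  also have "\<dots> = gnp_prob n p Q + (\<Sum>S\<in>F\<^sub>1. \<Sum>R\<in>?X. w R * of_bool (B\<^sub>1 S R))
     + (\<Sum>S\<in>F\<^sub>2. \<Sum>R\<in>?X. w R * of_bool (B\<^sub>2 S R))"
    unfolding gnp_prob_wt w_def[symmetric] distrib_left sum.distrib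
    by (simp only: sum_distrib_left sum.swap[of _ ?X])
  finally show "1 - (\<Sum>S\<in>F\<^sub>1. \<Sum>R\<in>?X. w R * of_bool (B\<^sub>1 S R))
     - (\<Sum>S\<in>F\<^sub>2. \<Sum>R\<in>?X. w R * of_bool (B\<^sub>2 S R)) \<le> gnp_prob n p Q" by linarith
  have "gnp_prob n p Q \<le> (\<Sum>R\<in>?X. w R * 1)"
    unfolding gnp_prob_wt w_def[symmetric] by (intro sum_mono mult_left_mono w0) auto
  then show "gnp_prob n p Q \<le> 1" using total by simp
qed

text \<open>In the constant, 320 = 20 * 16 combines the time 20N with N of order 16h; the added 20
  pays for rounding N up, as ln n \<ge> 1. The factor 2 beside A (1 + A) comes from bounding 1 + |E|
  by n^2.\<close>

lemma mixing_time_expander: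
  fixes q c K :: real
  assumes E: "is_graph n E" and conn: "cutconn E {..<n}" and n: "2 \<le> n"
    and q: "1 \<le> q" and c: "0 < c" and ln1: "1 \<le> ln (real n)" and qn: "1 + q \<le> real n"
    and k0: "20 * q * real k0 \<le> real n" "real k0 \<le> K * ln (real n)"
    and sparse: "\<And>T. T \<subseteq> {..<n} \<Longrightarrow> k0 \<le> card T \<Longrightarrow> real (card (inside E T)) \<le> q * real (card T)"
    and expand: "\<And>T. T \<subseteq> {..<n} \<Longrightarrow> k0 \<le> card T \<Longrightarrow> real n / (20 * q) \<le> real n - real (card T) \<Longrightarrow> cutconn E T \<Longrightarrow>
      c * real (card T) \<le> real (card (boundary E T))"
  defines "A \<equiv> 2 * q / c + 20 * q + 2"
  shows "ereal_of_enat (mixing_time n E)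
    \<le> ereal ((320 * (2 * (A * (1 + A) * 2 + (4 * q * K)\<^sup>2)) + 20) * (ln (real n))\<^sup>2)"
proof -
  define l where "l = ln (real n)"
  have l1: "1 \<le> l" using ln1 by (simp add: l_def)
  define L where "L = 4 * q * real k0"
  have A0: "0 \<le> A" using q c by (simp add: A_def)
  have L0: "0 \<le> L" using q by (simp add: L_def)
  note dp = cutconn_degree_pos[OF E conn n]
  have ex: "(\<Sum>v<n. lazy_chain.exits {..<n} (trans E) (stationary E) (5/4) s t v)
      \<le> 2 * (A * (1 + A) * ln (1 + real (card E)) + L * L)" if "s < n" for s t
  proof (rule exits_bound_graph[OF E conn n that A0 L0])
    fix S assume "S \<subseteq> {..<n}" "cutconn E S" "5 * (\<Sum>v\<in>S. degree E v) \<le> 8 * card E"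
    then show "real (\<Sum>v\<in>S. degree E v) \<le> A * real (card (boundary E S)) \<or> real (\<Sum>v\<in>S. degree E v) \<le> L"
      unfolding A_def L_def using n by (intro volume_dichotomy[OF E q c _ k0(1) sparse expand dp]) auto
  qed
  have lnE: "ln (1 + real (card E)) \<le> 2 * l"
  proof -
    have "20 * 1 * real k0 \<le> 20 * q * real k0" using q by (intro mult_right_mono) auto
    then have "real k0 \<le> real n" using k0(1) by linarith
    moreover have "inside E {..<n} = E" using E by (auto simp: inside_def is_graph_def all_pairs_def)
    ultimately have "real (card E) \<le> q * real n" using sparse[of "{..<n}"] by simp
    then have "1 + real (card E) \<le> (1 + q) * real n" using n by (simp add: algebra_simps)
    also have "\<dots> \<le> real n * real n" using qn by (intro mult_right_mono) auto
    finally have "ln (1 + real (card E)) \<le> ln (real n * real n)" by (subst ln_le_cancel_iff) (use n in auto)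
    then show ?thesis using n by (simp add: ln_mult l_def)
  qed
  have ll: "l \<le> l\<^sup>2" "1 \<le> l\<^sup>2" using l1 by (auto simp: power2_eq_square mult_le_cancel_right1 intro: order.trans[OF l1])
  define H where "H = 2 * (A * (1 + A) * 2 + (4 * q * K)\<^sup>2)"
  have H0: "0 \<le> H" using A0 by (simp add: H_def)
  have h: "(\<Sum>v<n. lazy_chain.exits {..<n} (trans E) (stationary E) (5/4) s t v) \<le> H * l\<^sup>2" if "s < n" for s t
  proof -
    have "A * (1 + A) * ln (1 + real (card E)) \<le> A * (1 + A) * (2 * l\<^sup>2)"
      using lnE ll A0 by (intro mult_left_mono) auto
    moreover have "L * L \<le> (4 * q * (K * l)) * (4 * q * (K * l))"
      unfolding L_def using k0(2) q by (intro mult_mono mult_left_mono) (auto simp: l_def intro: order.trans[OF of_nat_0_le_iff])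
    ultimately have "2 * (A * (1 + A) * ln (1 + real (card E)) + L * L) \<le> H * l\<^sup>2"
      by (simp add: H_def power2_eq_square algebra_simps)
    then show ?thesis using ex[OF that, of t] by linarith
  qed
  define N where "N = Suc (nat \<lfloor>16 * (H * l\<^sup>2)\<rfloor>)"
  have pos: "0 \<le> 16 * (H * l\<^sup>2)" using H0 by simp
  have N: "16 * (H * l\<^sup>2) \<le> real N" "real N \<le> 16 * (H * l\<^sup>2) + 1" "0 < N"
    using pos unfolding N_def by (auto intro: less_imp_le) linarith+
  have "mixing_time n E \<le> enat (20 * N)"
    by (rule mixing_time_le[OF E conn n h N(1,3)])
  then have "ereal_of_enat (mixing_time n E) \<le> ereal_of_enat (enat (20 * N))"
    by (simp only: ereal_of_enat_le_iff)
  also have "\<dots> = ereal (real (20 * N))" by simp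
  also have "\<dots> \<le> ereal ((320 * H + 20) * l\<^sup>2)"
    using N(2) ll(2) by (simp add: algebra_simps)
  finally show ?thesis by (simp add: H_def l_def)
qed

lemma gnp_mixing:
  fixes \<epsilon> \<eta> c \<beta> K :: real and D C k0 n :: nat
  defines "q \<equiv> real (D + C)"
  defines "A \<equiv> 2 * q / c + 20 * q + 2"
  assumes G: "is_graph n G" "connected_graph n G" "degenerate D n G"
    and D: "0 < D" and \<epsilon>: "0 < \<epsilon>" "\<epsilon> \<le> real n" and n: "2 \<le> n"
    and C: "3 + exp 1 * \<epsilon> \<le> real C" and \<eta>: "0 < \<eta>" "\<eta> < 1" and c: "0 < c"
    and h1: "(1 / (1 - \<eta>)) ^ D \<le> exp (\<beta> / 4)" and h2: "(8 / \<eta>) powr c \<le> exp (\<beta> / 4)"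
    and \<beta>: "\<beta> = \<epsilon> * (1 / (20 * q)) / 4"
    and ln1: "1 \<le> ln (real n)" and qn: "1 + q \<le> real n"
    and k0: "20 * q * real k0 \<le> real n" "real k0 \<le> K * ln (real n)"
      "4 * ln (real n) \<le> \<beta> * real k0" "ln (real n) \<le> real k0"
  shows "1 - 3 / real n \<le> gnp_prob n (\<epsilon> / real n) (\<lambda>R. ereal_of_enat (mixing_time n (G \<union> R))
      \<le> ereal ((320 * (2 * (A * (1 + A) * 2 + (4 * q * K)\<^sup>2)) + 20) * (ln (real n))\<^sup>2))" (is "_ \<le> gnp_prob n _ ?Q")
    and "gnp_prob n (\<epsilon> / real n) (\<lambda>R. ereal_of_enat (mixing_time n (G \<union> R))
      \<le> ereal ((320 * (2 * (A * (1 + A) * 2 + (4 * q * K)\<^sup>2)) + 20) * (ln (real n))\<^sup>2)) \<le> 1"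
proof -
  define p where "p = \<epsilon> / real n"
  have p: "0 \<le> p" "p \<le> 1" using \<epsilon> n by (auto simp: p_def)
  have n0: "0 < n" using n by simp
  have q1: "1 \<le> q" using D by (simp add: q_def)
  define b where "b = (\<lambda>S::nat set. nat \<lfloor>c * real (card S)\<rfloor>)"
  define F1 where "F1 = {S. S \<subseteq> {..<n} \<and> k0 \<le> card S \<and> 1 / (20 * q) * real n \<le> real n - real (card S)}"
  define F2 where "F2 = {S. S \<subseteq> {..<n} \<and> k0 \<le> card S}"
  define B1 where "B1 = (\<lambda>S R. cutconn (G \<union> R) S \<and> card (boundary G S) \<le> b S \<and> card (boundary R S) \<le> b S)"
  define B2 where "B2 = (\<lambda>S R. C * card S \<le> card (inside R S))"
  have fin: "finite F1" "finite F2" unfolding F1_def F2_def by (auto intro: finite_subset[of _ "Pow {..<n}"])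
  have k0p: "0 < k0" using k0(4) ln1 by (cases k0) auto
  have conn: "cutconn G {..<n}" by (rule connected_graph_cutconn[OF G(1,2)])
  have good: "?Q R" if R: "R \<subseteq> all_pairs n" and 1: "\<And>S. S \<in> F1 \<Longrightarrow> \<not> B1 S R" and 2: "\<And>S. S \<in> F2 \<Longrightarrow> \<not> B2 S R" for R
  proof -
    have E: "is_graph n (G \<union> R)" using G(1) R by (simp add: is_graph_def)
    have connE: "cutconn (G \<union> R) {..<n}" by (rule cutconn_mono[OF conn]) simp
    note fE = finite_graph[OF E]
    show ?thesis
      unfolding A_def
    proof (rule mixing_time_expander[OF E connE n q1 c ln1 qn k0(1,2)])
      fix T assume T: "T \<subseteq> {..<n}" "k0 \<le> card T"
      have "inside (G \<union> R) T = inside G T \<union> inside R T" by (auto simp: inside_def)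
      then have "card (inside (G \<union> R) T) \<le> card (inside G T) + card (inside R T)" by (simp add: card_Un_le)
      also have "\<dots> \<le> D * card T + C * card T"
        using card_inside_degenerate[OF G(1,3) T(1)] 2[of T] T by (intro add_mono) (auto simp: F2_def B2_def)
      also have "\<dots> = (D + C) * card T" by (simp add: algebra_simps)
      finally have "real (card (inside (G \<union> R) T)) \<le> real ((D + C) * card T)" by (simp only: of_nat_le_iff)
      then show "real (card (inside (G \<union> R) T)) \<le> q * real (card T)" by (simp add: q_def)
    next
      fix T assume T: "T \<subseteq> {..<n}" "k0 \<le> card T" "real n / (20 * q) \<le> real n - real (card T)" "cutconn (G \<union> R) T"
      then have "\<not> B1 T R" using 1[of T] by (simp add: F1_def)
      \<comment> \<open>An integer above the floor of c|T| is at least c|T|, and either boundary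
        lies in that of the union; so it suffices that one of them is large.\<close>
      then have "b T < card (boundary G T) \<or> b T < card (boundary R T)" using T by (auto simp: B1_def)
      moreover have "card (boundary G T) \<le> card (boundary (G \<union> R) T)" "card (boundary R T) \<le> card (boundary (G \<union> R) T)"
        using fE by (auto intro!: card_mono simp: boundary_def)
      ultimately have "b T < card (boundary (G \<union> R) T)" by linarith
      then show "c * real (card T) \<le> real (card (boundary (G \<union> R) T))" unfolding b_def by linarith
    qed
  qed
  define w where "w = wt (all_pairs n) (\<lambda>_. p) (\<lambda>_. 1 - p)"
  have "(\<Sum>S\<in>F1. \<Sum>R\<in>Pow (all_pairs n). w R * of_bool (B1 S R)) \<le> real n * exp (- \<beta> * real k0 / 2)"
    unfolding F1_def B1_def b_def w_def p_def
    by (rule expansion_prob[OF G(1) conn G(3) n0 \<epsilon> k0p _ \<eta> _ h1 h2 \<beta>]) (use q1 c in auto)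
  \<comment> \<open>The lower bounds on k0 are made for these estimates: \<beta> k0 \<ge> 4 ln n
    here, and k0 \<ge> ln n for the density event below.\<close>
  also have "\<dots> \<le> real n * exp (- (2 * ln (real n)))" using k0(3) by (intro mult_left_mono) auto
  also have "\<dots> = 1 / real n" using n by (simp add: exp_minus exp_double power2_eq_square field_simps)
  finally have P1: "(\<Sum>S\<in>F1. \<Sum>R\<in>Pow (all_pairs n). w R * of_bool (B1 S R)) \<le> 1 / real n" .
  have "(\<Sum>S\<in>F2. \<Sum>R\<in>Pow (all_pairs n). w R * of_bool (B2 S R)) \<le> (real n + 1) * exp (- 2 * real k0)"
    unfolding F2_def B2_def w_def p_def by (rule sparse_prob[OF n0 \<epsilon> C k0p])
  also have "\<dots> \<le> (2 * real n) * exp (- (2 * ln (real n)))" using k0(4) n by (intro mult_mono) auto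
  also have "\<dots> = 2 / real n" using n by (simp add: exp_minus exp_double power2_eq_square field_simps)
  finally have P2: "(\<Sum>S\<in>F2. \<Sum>R\<in>Pow (all_pairs n). w R * of_bool (B2 S R)) \<le> 2 / real n" .
  have "1 - (\<Sum>S\<in>F1. \<Sum>R\<in>Pow (all_pairs n). w R * of_bool (B1 S R))
     - (\<Sum>S\<in>F2. \<Sum>R\<in>Pow (all_pairs n). w R * of_bool (B2 S R)) \<le> gnp_prob n p ?Q"
    unfolding w_def by (rule gnp_prob_ge(1)[OF p fin good])
  moreover have "3 / real n = 1 / real n + 2 / real n" by simp
  ultimately have "1 - 3 / real n \<le> gnp_prob n p ?Q" using P1 P2 by linarith
  then show "1 - 3 / real n \<le> gnp_prob n (\<epsilon> / real n) ?Q" by (simp only: p_def)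
  have "gnp_prob n p ?Q \<le> 1" by (rule gnp_prob_ge(2)[OF p fin good])
  then show "gnp_prob n (\<epsilon> / real n) ?Q \<le> 1" by (simp only: p_def)
qed

theorem theorem5:
  fixes D :: nat and \<epsilon> :: real
  assumes "D > 0" and "\<epsilon> > 0"
  shows "\<exists>M::real. \<forall>G :: nat \<Rightarrow> nat set set.
           (\<forall>n. is_graph n (G n) \<and> connected_graph n (G n) \<and> degenerate D n (G n)) \<longrightarrow>
           ((\<lambda>n. gnp_prob n (\<epsilon> / real n)
                   (\<lambda>R. ereal_of_enat (mixing_time n (G n \<union> R)) \<le> ereal (M * (ln (real n))\<^sup>2)))
             \<longlonglongrightarrow> 1)"
proof -
  \<comment> \<open>Each constant depends only on D, \<epsilon> and earlier ones. \<beta> is the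
    decay rate for sets whose outside has at least n/(20q) vertices; \<eta> and c make each of the
    two costs exactly exp(\<beta>/4) per vertex.\<close>
  define C where "C = nat \<lceil>3 + exp 1 * \<epsilon>\<rceil>"
  define q where "q = real (D + C)"
  define \<beta> where "\<beta> = \<epsilon> * (1 / (20 * q)) / 4"
  define \<eta> where "\<eta> = 1 - exp (- (\<beta> / (4 * real D)))"
  define c where "c = \<beta> / (4 * ln (8 / \<eta>))"
  define K where "K = 4 / \<beta> + 2"
  define A where "A = 2 * q / c + 20 * q + 2"
  have C: "3 + exp 1 * \<epsilon> \<le> real C" unfolding C_def by linarith
  have q1: "1 \<le> q" using assms by (simp add: q_def)
  have \<beta>0: "0 < \<beta>" using assms q1 by (simp add: \<beta>_def)
  have \<eta>: "0 < \<eta>" "\<eta> < 1" using \<beta>0 assms by (auto simp: \<eta>_def)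
  have ln8: "0 < ln (8 / \<eta>)" using \<eta> by simp
  have c0: "0 < c" using \<beta>0 ln8 by (simp add: c_def)
  have h1: "(1 / (1 - \<eta>)) ^ D \<le> exp (\<beta> / 4)"
  proof -
    have "1 / (1 - \<eta>) = exp (\<beta> / (4 * real D))" by (simp add: \<eta>_def exp_minus inverse_eq_divide)
    then have "(1 / (1 - \<eta>)) ^ D = exp (real D * (\<beta> / (4 * real D)))" by (simp only: exp_of_nat_mult)
    then show ?thesis using assms by simp
  qed
  have h2: "(8 / \<eta>) powr c \<le> exp (\<beta> / 4)" using \<eta> ln8 by (simp add: powr_def c_def)
  define M where "M = 320 * (2 * (A * (1 + A) * 2 + (4 * q * K)\<^sup>2)) + 20"
  show ?thesis
  proof (intro exI[of _ M] allI impI)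
    fix G :: "nat \<Rightarrow> nat set set"
    assume G: "\<forall>n. is_graph n (G n) \<and> connected_graph n (G n) \<and> degenerate D n (G n)"
    let ?P = "\<lambda>n. gnp_prob n (\<epsilon> / real n)
                   (\<lambda>R. ereal_of_enat (mixing_time n (G n \<union> R)) \<le> ereal (M * (ln (real n))\<^sup>2))"
    have lnn: "(\<lambda>n. ln (real n) / real n) \<longlonglongrightarrow> 0" by (rule lim_ln_over_n)
    \<comment> \<open>Eventually the logarithmic threshold k0 is at most n/(20q), as the treatment
      of small complements requires.\<close>
    have "\<forall>\<^sub>F n in sequentially. ln (real n) / real n < 1 / (20 * q * K)"
      by (rule order_tendstoD(2)[OF lnn]) (use q1 \<beta>0 in \<open>simp add: K_def add_pos_pos\<close>)
    moreover have "\<forall>\<^sub>F n in sequentially. max (exp 1) (max \<epsilon> (1 + q)) \<le> real n"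
      by (rule eventually_ge_at_top[THEN filterlim_real_sequentially[unfolded filterlim_iff, rule_format]])
    ultimately have ev: "\<forall>\<^sub>F n in sequentially. 1 - 3 / real n \<le> ?P n \<and> ?P n \<le> 1"
    proof eventually_elim
      case (elim n)
      have n: "2 \<le> n" "\<epsilon> \<le> real n" "1 + q \<le> real n" "exp 1 \<le> real n" using elim(2) q1 by auto
      have ln1: "1 \<le> ln (real n)" using n by (simp add: ln_ge_iff)
      \<comment> \<open>The part 4/\<beta> serves the expansion event and the part 1 the density
        event; K has one more unit to absorb the ceiling.\<close>
      define k0 where "k0 = nat \<lceil>(4 / \<beta> + 1) * ln (real n)\<rceil>"
      have pos: "0 \<le> (4 / \<beta> + 1) * ln (real n)" using \<beta>0 ln1 by simp
      have k_ge: "(4 / \<beta> + 1) * ln (real n) \<le> real k0" unfolding k0_def by linarith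
      have k_le: "real k0 \<le> (4 / \<beta> + 1) * ln (real n) + 1" using pos unfolding k0_def by linarith
      have k2: "real k0 \<le> K * ln (real n)" using k_le ln1 by (simp add: K_def algebra_simps)
      have K0: "0 < K" using \<beta>0 by (simp add: K_def add_pos_pos)
      have k1: "20 * q * real k0 \<le> real n"
      proof -
        have "20 * q * real k0 \<le> 20 * q * (K * ln (real n))" using k2 q1 by (intro mult_left_mono) auto
        also have "\<dots> \<le> real n" using elim(1) n q1 K0 by (simp add: field_simps)
        finally show ?thesis .
      qed
      have k3: "4 * ln (real n) \<le> \<beta> * real k0"
      proof -
        have "4 * ln (real n) \<le> \<beta> * ((4 / \<beta> + 1) * ln (real n))" using \<beta>0 ln1 by (simp add: field_simps)
        also have "\<dots> \<le> \<beta> * real k0" using k_ge \<beta>0 by (intro mult_left_mono) auto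
        finally show ?thesis .
      qed
      have k4: "ln (real n) \<le> real k0"
      proof -
        have "1 * ln (real n) \<le> (4 / \<beta> + 1) * ln (real n)" using \<beta>0 ln1 by (intro mult_right_mono) auto
        then show ?thesis using k_ge by linarith
      qed
      have "is_graph n (G n)" "connected_graph n (G n)" "degenerate D n (G n)" using G by auto
      note gm = gnp_mixing[OF this assms(1,2) n(2,1) C \<eta> c0 h1 h2 \<beta>_def[unfolded q_def] ln1
          n(3)[unfolded q_def] k1[unfolded q_def] k2 k3 k4]
      show ?case using gm unfolding M_def A_def q_def by blast
    qed
    have "(\<lambda>n. 1 - 3 / real n) \<longlonglongrightarrow> 1 - 0"
      by (intro tendsto_diff tendsto_const lim_const_over_n)
    then have lower: "(\<lambda>n. 1 - 3 / real n) \<longlonglongrightarrow> 1" by simp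
    show "?P \<longlonglongrightarrow> 1"
      by (rule tendsto_sandwich[OF _ _ lower tendsto_const]) (use ev in \<open>auto elim: eventually_mono\<close>)
  qed
qed

end
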